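(* Assume that $f\colon Y\to X$ is an étale annular $p$-cover. Then $f$ admits a presentation $x=y^p+t$, where $t$ is a dominant tame term of $f$. Conversely, any Kummer or binomial presentation of $f$ is of this form.
   Context: $k$ is an algebraically closed complete real-valued field of residual characteristic $p>0$. A closed annulus $Y=\mathcal M(\mathcal A)$ of exponential modulus $r\in|k^\times|$, $0<r\le1$, is one isomorphic to $A(r,1)=\mathcal M(k\{y,ry^{-1}\})$; a monic coordinate is an element $y\in\mathcal A$ inducing such an isomorphism. Its skeleton $l$ is the interval joining its boundary points (identified with $[r,1]$ via $|y|$). For $u,v\in\mathcal A$ with $u$ a unit, $u$ strictly dominates $v$ if the spectral norm satisfies $|v/u|_{\mathcal A}<1$. An element $\sum_{i\in\mathbb Z}a_iy^i$ is a unit if and only if it has a dominant term, i.e. a term $a_ny^n$ strictly dominating all other terms. An annular $p$-cover is a finite morphism $f\colon Y\to X$ of degree $p$ between closed annuli. A presentation of $f$ is its expression $x=\varphi(y)=\sum_{i\in\mathbb Z}c_iy^i$ in terms of monic coordinates $y$ on $Y$ and $x$ on $X$; it is monic if its dominant term is $y^p$. One orients $Y$ (orders its boundary) so that the different $\delta_f$ is non-decreasing on $l$, orients $X$ compatibly, and uses only coordinates compatible with these orientations. A Kummer presentation is a monic presentation $x=y^p$; a binomial presentation is a monic presentation of the form $x=y^p+c_ny^n$. The different function is $\delta_f(q)=\delta_{\mathcal H(q)/\mathcal H(f(q))}$, where $\delta_{L/K}=\sup\{|a|:a\in L^\circ,\ a\,\Omega_{L^\circ/K^\circ}=0\}$ for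 a finite separable extension $L/K$ of real-valued fields; in terms of a monic presentation it equals $|nc_ny^{n-p}|$ on $l$, with $n$ as below. If $f$ is étale and $\varphi$ is a monic presentation, the derivative $\sum_iic_iy^{i-1}$ of $\varphi$ is a unit with a dominant term $nc_ny^{n-1}$, where $n\ge p$ and either (1) $n=p$ and $k$ is of mixed characteristic, or (2) $(n,p)=1$ and $1>|c_ny^{n-p}|>|p|$ on $l$. The dominant tame term of $\varphi$ is $0$ in case (1) and $c_ny^n$ in case (2). A dominant tame term of $f$ is any monomial $ct$, where $t$ is the dominant tame term of a monic presentation of $f$ and $c\in k$ satisfies $|c|=1$.
   Formalization: In a binomial presentation x=y^p+c_n y^n, n is required to be the exponent for which n c_n y^(n-1) is the dominant term of the derivative (else y^p+c y^(p+1), 0<|c|<|p|, is a counterexample); n≥p, which can fail for r=1, is not part of the definition of dominant tame term. *)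

theory Defs
  imports "HOL-Analysis.Analysis" "HOL-Algebra.Ring" "HOL-Computational_Algebra.Computational_Algebra"
begin

section \<open>Non-archimedean Banach rings and the ground field\<close>

class nonarch_banach_ring = comm_ring_1 + complete_space +
  fixes bnorm :: "'a \<Rightarrow> real"
  assumes dist_bnorm: "dist x y = bnorm (x - y)"
    and bnorm_add_le_max: "bnorm (x + y) \<le> max (bnorm x) (bnorm y)"
    and bnorm_mult_le: "bnorm (x * y) \<le> bnorm x * bnorm y"
    and bnorm_one: "bnorm 1 = 1"

text \<open>Algebraically closed complete real-valued fields.\<close>

class alg_closed_valued_field = alg_closed_field + nonarch_banach_ring +
  assumes bnorm_mult: "bnorm (x * y) = bnorm x * bnorm y"

text \<open>The residue field of \<open>'k\<close> has characteristic \<open>p > 0\<close>: \<open>p\<close> is a prime lying in the maximal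
  ideal of the ring of integers.\<close>

definition residual_char :: "'k::alg_closed_valued_field itself \<Rightarrow> nat \<Rightarrow> bool" where
  "residual_char _ p \<longleftrightarrow> prime p \<and> bnorm (of_nat p :: 'k) < 1"

definition ring_hom_type :: "('b::comm_ring_1 \<Rightarrow> 'a::comm_ring_1) \<Rightarrow> bool" where
  "ring_hom_type f \<longleftrightarrow> f 1 = 1 \<and> (\<forall>x y. f (x + y) = f x + f y) \<and> (\<forall>x y. f (x * y) = f x * f y)"

text \<open>A Banach \<open>k\<close>-algebra is given by its structure map \<open>\<iota>\<close>; that \<open>\<iota>\<close> is isometric is equivalent to
  \<open>bnorm (\<iota> c * a) = bnorm c * bnorm a\<close>.\<close>

definition banach_algebra ::
    "('k::alg_closed_valued_field \<Rightarrow> 'a::nonarch_banach_ring) \<Rightarrow> bool" where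
  "banach_algebra \<iota> \<longleftrightarrow> ring_hom_type \<iota> \<and> (\<forall>c. bnorm (\<iota> c) = bnorm c)"

definition bounded_algebra_hom ::
    "('k::alg_closed_valued_field \<Rightarrow> 'b::nonarch_banach_ring) \<Rightarrow>
     ('k \<Rightarrow> 'a::nonarch_banach_ring) \<Rightarrow> ('b \<Rightarrow> 'a) \<Rightarrow> bool" where
  "bounded_algebra_hom \<iota>B \<iota>A f \<longleftrightarrow>
     ring_hom_type f \<and> (\<forall>c. f (\<iota>B c) = \<iota>A c) \<and> (\<exists>C. \<forall>b. bnorm (f b) \<le> C * bnorm b)"

definition spectral_norm :: "'a::nonarch_banach_ring \<Rightarrow> real" where
  "spectral_norm a = lim (\<lambda>n. root n (bnorm (a ^ n)))"

definition ring_inverse :: "'a::comm_ring_1 \<Rightarrow> 'a" where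
  "ring_inverse u = (THE w. u * w = 1)"

text \<open>Integral powers of a unit of a commutative ring.\<close>

definition unit_powi :: "'a::comm_ring_1 \<Rightarrow> int \<Rightarrow> 'a" where
  "unit_powi u i = (if 0 \<le> i then u ^ nat i else ring_inverse u ^ nat (- i))"

definition strictly_dominates :: "'a::nonarch_banach_ring \<Rightarrow> 'a \<Rightarrow> bool" where
  "strictly_dominates u v \<longleftrightarrow> u dvd 1 \<and> spectral_norm (v * ring_inverse u) < 1"


section \<open>Closed annuli\<close>

text \<open>The algebra \<open>k{Y, r Y\<inverse>}\<close>, as a space of Laurent coefficient families with its Banach norm
  \<open>sup \<bar>c\<^sub>i\<bar> max(1, r\<^sup>i)\<close>.\<close>

definition laurent_algebra :: "real \<Rightarrow> (int \<Rightarrow> 'k::alg_closed_valued_field) set" where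
  "laurent_algebra r = {c. ((\<lambda>i. bnorm (c i) * max 1 (r powi i)) \<longlongrightarrow> 0) cofinite}"

definition laurent_norm :: "real \<Rightarrow> (int \<Rightarrow> 'k::alg_closed_valued_field) \<Rightarrow> real" where
  "laurent_norm r c = (SUP i. bnorm (c i) * max 1 (r powi i))"

definition laurent_eval ::
    "('k::alg_closed_valued_field \<Rightarrow> 'a::nonarch_banach_ring) \<Rightarrow> 'a \<Rightarrow> (int \<Rightarrow> 'k) \<Rightarrow> 'a" where
  "laurent_eval \<iota> y c = (\<Sum>\<^sub>\<infinity>i. \<iota> (c i) * unit_powi y i)"

text \<open>\<open>y\<close> induces an isomorphism of Banach algebras \<open>k{Y, r Y\<inverse>} \<rightarrow> \<A>\<close>, \<open>Y \<mapsto> y\<close>. The two-sided bound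
  forces convergence of all the sums, so the map is automatically a \<open>k\<close>-algebra homomorphism.\<close>

definition monic_coordinate ::
    "('k::alg_closed_valued_field \<Rightarrow> 'a::nonarch_banach_ring) \<Rightarrow> real \<Rightarrow> 'a \<Rightarrow> bool" where
  "monic_coordinate \<iota> r y \<longleftrightarrow>
     y dvd 1 \<and>
     bij_betw (laurent_eval \<iota> y) (laurent_algebra r) UNIV \<and>
     (\<exists>C. \<forall>c\<in>laurent_algebra r.
        bnorm (laurent_eval \<iota> y c) \<le> C * laurent_norm r c \<and>
        laurent_norm r c \<le> C * bnorm (laurent_eval \<iota> y c))"

definition closed_annulus ::
    "('k::alg_closed_valued_field \<Rightarrow> 'a::nonarch_banach_ring) \<Rightarrow> real \<Rightarrow> bool" where
  "closed_annulus \<iota> r \<longleftrightarrow>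
     banach_algebra \<iota> \<and> 0 < r \<and> r \<le> 1 \<and> (\<exists>c::'k. c \<noteq> 0 \<and> bnorm c = r) \<and>
     (\<exists>y. monic_coordinate \<iota> r y)"

definition laurent_coeffs ::
    "('k::alg_closed_valued_field \<Rightarrow> 'a::nonarch_banach_ring) \<Rightarrow> real \<Rightarrow> 'a \<Rightarrow> 'a \<Rightarrow> int \<Rightarrow> 'k" where
  "laurent_coeffs \<iota> r y = inv_into (laurent_algebra r) (laurent_eval \<iota> y)"

text \<open>Points of the Berkovich spectrum are seminorms. The point of the skeleton on which
  \<open>\<bar>y\<bar> = s\<close> (with \<open>r \<le> s \<le> 1\<close>) is the Gauss norm of radius \<open>s\<close>; the boundary points are \<open>s = r\<close>
  and \<open>s = 1\<close>.\<close>

definition gauss_point ::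
    "('k::alg_closed_valued_field \<Rightarrow> 'a::nonarch_banach_ring) \<Rightarrow> real \<Rightarrow> 'a \<Rightarrow> real \<Rightarrow> 'a \<Rightarrow> real" where
  "gauss_point \<iota> r y s a = (SUP i. bnorm (laurent_coeffs \<iota> r y a i) * s powi i)"

definition skeleton ::
    "('k::alg_closed_valued_field \<Rightarrow> 'a::nonarch_banach_ring) \<Rightarrow> real \<Rightarrow> 'a \<Rightarrow> ('a \<Rightarrow> real) set" where
  "skeleton \<iota> r y = gauss_point \<iota> r y ` {r..1}"


section \<open>Kaehler differentials of a ring homomorphism\<close>

text \<open>For \<open>h : R \<rightarrow> S\<close>, the module of differentials is the quotient of the free \<open>S\<close>-module on symbols
  \<open>d b\<close> (\<open>b \<in> S\<close>), i.e. of the finitely supported functions on \<open>S\<close>, by the submodule generated by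
  \<open>d (b + c) - d b - d c\<close>, \<open>d (b c) - b d c - c d b\<close> and \<open>d (h r)\<close>.\<close>

definition d_symbol :: "('s, 'm) ring_scheme \<Rightarrow> 's \<Rightarrow> 's \<Rightarrow> 's \<Rightarrow> 's" where
  "d_symbol S s b = (\<lambda>x. if x = b then s else \<zero>\<^bsub>S\<^esub>)"

definition kaehler_free :: "('s, 'm) ring_scheme \<Rightarrow> ('s \<Rightarrow> 's) set" where
  "kaehler_free S = {u. (\<forall>x. u x \<in> carrier S) \<and> (\<forall>x. x \<notin> carrier S \<longrightarrow> u x = \<zero>\<^bsub>S\<^esub>) \<and>
     finite {x. u x \<noteq> \<zero>\<^bsub>S\<^esub>}}"

inductive_set kaehler_relations ::
    "('r, 'n) ring_scheme \<Rightarrow> ('s, 'm) ring_scheme \<Rightarrow> ('r \<Rightarrow> 's) \<Rightarrow> ('s \<Rightarrow> 's) set"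
  for R S h where
    zero: "(\<lambda>_. \<zero>\<^bsub>S\<^esub>) \<in> kaehler_relations R S h"
  | add: "\<lbrakk>u \<in> kaehler_relations R S h; v \<in> kaehler_relations R S h\<rbrakk> \<Longrightarrow>
      (\<lambda>x. u x \<oplus>\<^bsub>S\<^esub> v x) \<in> kaehler_relations R S h"
  | scale: "\<lbrakk>s \<in> carrier S; u \<in> kaehler_relations R S h\<rbrakk> \<Longrightarrow>
      (\<lambda>x. s \<otimes>\<^bsub>S\<^esub> u x) \<in> kaehler_relations R S h"
  | additive: "\<lbrakk>b \<in> carrier S; c \<in> carrier S\<rbrakk> \<Longrightarrow>
      (\<lambda>x. d_symbol S \<one>\<^bsub>S\<^esub> (b \<oplus>\<^bsub>S\<^esub> c) x \<ominus>\<^bsub>S\<^esub> d_symbol S \<one>\<^bsub>S\<^esub> b x \<ominus>\<^bsub>S\<^esub> d_symbol S \<one>\<^bsub>S\<^esub> c x)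
        \<in> kaehler_relations R S h"
  | leibniz: "\<lbrakk>b \<in> carrier S; c \<in> carrier S\<rbrakk> \<Longrightarrow>
      (\<lambda>x. d_symbol S \<one>\<^bsub>S\<^esub> (b \<otimes>\<^bsub>S\<^esub> c) x \<ominus>\<^bsub>S\<^esub> d_symbol S b c x \<ominus>\<^bsub>S\<^esub> d_symbol S c b x)
        \<in> kaehler_relations R S h"
  | base: "a \<in> carrier R \<Longrightarrow> d_symbol S \<one>\<^bsub>S\<^esub> (h a) \<in> kaehler_relations R S h"

definition kaehler_annihilator ::
    "('r, 'n) ring_scheme \<Rightarrow> ('s, 'm) ring_scheme \<Rightarrow> ('r \<Rightarrow> 's) \<Rightarrow> 's set" where
  "kaehler_annihilator R S h =
     {a \<in> carrier S. \<forall>u\<in>kaehler_free S. (\<lambda>x. a \<otimes>\<^bsub>S\<^esub> u x) \<in> kaehler_relations R S h}"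


section \<open>Completed residue fields and the different\<close>

text \<open>The completed residue field \<open>H(q)\<close> at a multiplicative seminorm \<open>q\<close> is the completion of the
  fraction field of \<open>\<A> / ker q\<close>. It is realised by classes of \<open>q\<close>-Cauchy sequences of fractions
  \<open>a / b\<close> (pairs with \<open>q b \<noteq> 0\<close>) modulo null sequences; this subsumes the quotient by \<open>ker q\<close> and the
  identification of equal fractions.\<close>

definition frac_dist :: "('a::comm_ring_1 \<Rightarrow> real) \<Rightarrow> 'a \<times> 'a \<Rightarrow> 'a \<times> 'a \<Rightarrow> real" where
  "frac_dist q z w = q (fst z * snd w - fst w * snd z) / (q (snd z) * q (snd w))"

definition cauchy_fracs :: "('a::comm_ring_1 \<Rightarrow> real) \<Rightarrow> (nat \<Rightarrow> 'a \<times> 'a) set" where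
  "cauchy_fracs q = {z. (\<forall>n. q (snd (z n)) \<noteq> 0) \<and>
     (\<forall>e>0. \<exists>N. \<forall>m\<ge>N. \<forall>n\<ge>N. frac_dist q (z m) (z n) < e)}"

definition frac_rel ::
    "('a::comm_ring_1 \<Rightarrow> real) \<Rightarrow> ((nat \<Rightarrow> 'a \<times> 'a) \<times> (nat \<Rightarrow> 'a \<times> 'a)) set" where
  "frac_rel q = {(z, w). z \<in> cauchy_fracs q \<and> w \<in> cauchy_fracs q \<and>
     (\<lambda>n. frac_dist q (z n) (w n)) \<longlonglongrightarrow> 0}"

definition frac_class ::
    "('a::comm_ring_1 \<Rightarrow> real) \<Rightarrow> (nat \<Rightarrow> 'a \<times> 'a) \<Rightarrow> (nat \<Rightarrow> 'a \<times> 'a) set" where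
  "frac_class q z = frac_rel q `` {z}"

definition completed_residue_field ::
    "('a::comm_ring_1 \<Rightarrow> real) \<Rightarrow> (nat \<Rightarrow> 'a \<times> 'a) set ring" where
  "completed_residue_field q = \<lparr>
     carrier = cauchy_fracs q // frac_rel q,
     mult = (\<lambda>X Y. \<Union>z\<in>X. \<Union>w\<in>Y. frac_class q
       (\<lambda>n. (fst (z n) * fst (w n), snd (z n) * snd (w n)))),
     one = frac_class q (\<lambda>_. (1, 1)),
     zero = frac_class q (\<lambda>_. (0, 1)),
     add = (\<lambda>X Y. \<Union>z\<in>X. \<Union>w\<in>Y. frac_class q
       (\<lambda>n. (fst (z n) * snd (w n) + fst (w n) * snd (z n), snd (z n) * snd (w n))))\<rparr>"

definition residue_norm :: "('a::comm_ring_1 \<Rightarrow> real) \<Rightarrow> (nat \<Rightarrow> 'a \<times> 'a) set \<Rightarrow> real" where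
  "residue_norm q X = (let z = (SOME z. z \<in> X) in lim (\<lambda>n. q (fst (z n)) / q (snd (z n))))"

definition residue_integers ::
    "('a::comm_ring_1 \<Rightarrow> real) \<Rightarrow> (nat \<Rightarrow> 'a \<times> 'a) set ring" where
  "residue_integers q = (completed_residue_field q)
     \<lparr>carrier := {X \<in> carrier (completed_residue_field q). residue_norm q X \<le> 1}\<rparr>"

text \<open>For \<open>f : \<B> \<rightarrow> \<A>\<close>, the image of the point \<open>q\<close> of \<open>M(\<A>)\<close> in \<open>M(\<B>)\<close> is \<open>q \<circ> f\<close>, and \<open>f\<close> induces
  \<open>H(q \<circ> f) \<rightarrow> H(q)\<close>.\<close>

definition residue_map ::
    "('b::comm_ring_1 \<Rightarrow> 'a::comm_ring_1) \<Rightarrow> ('a \<Rightarrow> real) \<Rightarrow>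
     (nat \<Rightarrow> 'b \<times> 'b) set \<Rightarrow> (nat \<Rightarrow> 'a \<times> 'a) set" where
  "residue_map f q X = (\<Union>z\<in>X. frac_class q (\<lambda>n. (f (fst (z n)), f (snd (z n)))))"

definition different_at ::
    "('b::comm_ring_1 \<Rightarrow> 'a::comm_ring_1) \<Rightarrow> ('a \<Rightarrow> real) \<Rightarrow> real" where
  "different_at f q = Sup (residue_norm q `
     kaehler_annihilator (residue_integers (q \<circ> f)) (residue_integers q) (residue_map f q))"


section \<open>Etale annular covers\<close>

text \<open>A morphism \<open>M(\<A>) \<rightarrow> M(\<B>)\<close> is a bounded \<open>k\<close>-algebra homomorphism \<open>f : \<B> \<rightarrow> \<A>\<close>, through which
  \<open>\<A>\<close> is a \<open>\<B>\<close>-module with the scaling below.\<close>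

definition module_scale :: "('b::comm_ring_1 \<Rightarrow> 'a::comm_ring_1) \<Rightarrow> 'b \<Rightarrow> 'a \<Rightarrow> 'a" where
  "module_scale f b a = f b * a"

definition finite_hom :: "('b::comm_ring_1 \<Rightarrow> 'a::comm_ring_1) \<Rightarrow> bool" where
  "finite_hom f \<longleftrightarrow> (\<exists>S. finite S \<and> Modules.module.span (module_scale f) S = UNIV)"

text \<open>The degree is the rank of the module: the maximal number of linearly independent elements
  (the ring of functions of an annulus is a domain).\<close>

definition has_degree :: "('b::comm_ring_1 \<Rightarrow> 'a::comm_ring_1) \<Rightarrow> nat \<Rightarrow> bool" where
  "has_degree f d \<longleftrightarrow>
     (\<exists>S. finite S \<and> card S = d \<and> \<not> Modules.module.dependent (module_scale f) S) \<and>
     (\<forall>S. \<not> Modules.module.dependent (module_scale f) S \<longrightarrow> finite S \<and> card S \<le> d)"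

definition annular_cover ::
    "('k::alg_closed_valued_field \<Rightarrow> 'b::nonarch_banach_ring) \<Rightarrow> real \<Rightarrow>
     ('k \<Rightarrow> 'a::nonarch_banach_ring) \<Rightarrow> real \<Rightarrow> ('b \<Rightarrow> 'a) \<Rightarrow> nat \<Rightarrow> bool" where
  "annular_cover \<iota>X rX \<iota>Y rY f p \<longleftrightarrow>
     closed_annulus \<iota>X rX \<and> closed_annulus \<iota>Y rY \<and> bounded_algebra_hom \<iota>X \<iota>Y f \<and>
     finite_hom f \<and> has_degree f p"

text \<open>Finite projective modules, by the existence of a dual basis. Over a Noetherian ring these are
  the finite flat ones.\<close>

definition finite_projective :: "('b::comm_ring_1 \<Rightarrow> 'a::comm_ring_1) \<Rightarrow> bool" where
  "finite_projective f \<longleftrightarrow>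
     (\<exists>(n::nat) (g :: nat \<Rightarrow> 'a) (l :: nat \<Rightarrow> 'a \<Rightarrow> 'b).
        (\<forall>i<n. module_hom (module_scale f) (*) (l i)) \<and>
        (\<forall>a. a = (\<Sum>i<n. module_scale f (l i a) (g i))))"

definition type_ring :: "'a::comm_ring_1 ring" where
  "type_ring = \<lparr>carrier = UNIV, mult = (*), one = 1, zero = 0, add = (+)\<rparr>"

definition unramified_hom :: "('b::comm_ring_1 \<Rightarrow> 'a::comm_ring_1) \<Rightarrow> bool" where
  "unramified_hom f \<longleftrightarrow>
     kaehler_free (type_ring :: 'a ring) \<subseteq>
       kaehler_relations (type_ring :: 'b ring) type_ring f"

definition finite_etale :: "('b::comm_ring_1 \<Rightarrow> 'a::comm_ring_1) \<Rightarrow> bool" where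
  "finite_etale f \<longleftrightarrow> finite_projective f \<and> unramified_hom f"


section \<open>Orientations, presentations and dominant tame terms\<close>

text \<open>An orientation is an ordering \<open>(u, v)\<close> of the boundary; a monic coordinate is compatible with
  it if its absolute value increases from \<open>r\<close> at \<open>u\<close> to \<open>1\<close> at \<open>v\<close>.\<close>

definition oriented_coordinate ::
    "('k::alg_closed_valued_field \<Rightarrow> 'a::nonarch_banach_ring) \<Rightarrow> real \<Rightarrow>
     ('a \<Rightarrow> real) \<Rightarrow> ('a \<Rightarrow> real) \<Rightarrow> 'a \<Rightarrow> bool" where
  "oriented_coordinate \<iota> r u v y \<longleftrightarrow>
     monic_coordinate \<iota> r y \<and> gauss_point \<iota> r y r = u \<and> gauss_point \<iota> r y 1 = v"

text \<open>The different is non-decreasing on the skeleton, traversed from \<open>u\<close> to \<open>v\<close>.\<close>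

definition different_orientation ::
    "('k::alg_closed_valued_field \<Rightarrow> 'a::nonarch_banach_ring) \<Rightarrow> real \<Rightarrow>
     ('b::nonarch_banach_ring \<Rightarrow> 'a) \<Rightarrow> ('a \<Rightarrow> real) \<Rightarrow> ('a \<Rightarrow> real) \<Rightarrow> bool" where
  "different_orientation \<iota> r f u v \<longleftrightarrow>
     (\<exists>y. oriented_coordinate \<iota> r u v y \<and>
        mono_on {r..1} (\<lambda>s. different_at f (gauss_point \<iota> r y s)))"

text \<open>\<open>x = \<phi>(y)\<close> in coordinates compatible with the orientation \<open>(u, v)\<close> of the source and its
  image in the target.\<close>

definition presentation ::
    "('k::alg_closed_valued_field \<Rightarrow> 'b::nonarch_banach_ring) \<Rightarrow> real \<Rightarrow>
     ('k \<Rightarrow> 'a::nonarch_banach_ring) \<Rightarrow> real \<Rightarrow> ('b \<Rightarrow> 'a) \<Rightarrow>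
     ('a \<Rightarrow> real) \<Rightarrow> ('a \<Rightarrow> real) \<Rightarrow> 'b \<Rightarrow> 'a \<Rightarrow> (int \<Rightarrow> 'k) \<Rightarrow> bool" where
  "presentation \<iota>X rX \<iota>Y rY f u v x y \<phi> \<longleftrightarrow>
     oriented_coordinate \<iota>X rX (u \<circ> f) (v \<circ> f) x \<and>
     oriented_coordinate \<iota>Y rY u v y \<and>
     \<phi> \<in> laurent_algebra rY \<and> f x = laurent_eval \<iota>Y y \<phi>"

definition dominant_index ::
    "('k::alg_closed_valued_field \<Rightarrow> 'a::nonarch_banach_ring) \<Rightarrow> 'a \<Rightarrow> (int \<Rightarrow> 'k) \<Rightarrow> int \<Rightarrow> bool" where
  "dominant_index \<iota> y c n \<longleftrightarrow>
     (\<forall>i. i \<noteq> n \<longrightarrow> strictly_dominates (\<iota> (c n) * unit_powi y n) (\<iota> (c i) * unit_powi y i))"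

definition lmonom :: "'k::zero \<Rightarrow> int \<Rightarrow> int \<Rightarrow> 'k" where
  "lmonom c n = (\<lambda>i. if i = n then c else 0)"

definition lderiv :: "(int \<Rightarrow> 'k::comm_ring_1) \<Rightarrow> int \<Rightarrow> 'k" where
  "lderiv c = (\<lambda>i. of_int (i + 1) * c (i + 1))"

definition monic_presentation ::
    "('k::alg_closed_valued_field \<Rightarrow> 'b::nonarch_banach_ring) \<Rightarrow> real \<Rightarrow>
     ('k \<Rightarrow> 'a::nonarch_banach_ring) \<Rightarrow> real \<Rightarrow> ('b \<Rightarrow> 'a) \<Rightarrow> nat \<Rightarrow>
     ('a \<Rightarrow> real) \<Rightarrow> ('a \<Rightarrow> real) \<Rightarrow> 'b \<Rightarrow> 'a \<Rightarrow> (int \<Rightarrow> 'k) \<Rightarrow> bool" where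
  "monic_presentation \<iota>X rX \<iota>Y rY f p u v x y \<phi> \<longleftrightarrow>
     presentation \<iota>X rX \<iota>Y rY f u v x y \<phi> \<and> dominant_index \<iota>Y y \<phi> (int p) \<and> \<phi> (int p) = 1"

text \<open>Monomials are formal, i.e. Laurent coefficient families. The two disjuncts are the cases
  \<open>n = p\<close> in mixed characteristic, and \<open>(n, p) = 1\<close> with \<open>1 > \<bar>c\<^sub>n y\<^sup>n\<^sup>-\<^sup>p\<bar> > \<bar>p\<bar>\<close> on the skeleton. That \<open>n \<ge> p\<close>
  when \<open>r < 1\<close> is a consequence of the orientation and not part of the definition.\<close>

definition dominant_tame_term_of ::
    "('k::alg_closed_valued_field \<Rightarrow> 'a::nonarch_banach_ring) \<Rightarrow> real \<Rightarrow> nat \<Rightarrow> 'a \<Rightarrow>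
     (int \<Rightarrow> 'k) \<Rightarrow> (int \<Rightarrow> 'k) \<Rightarrow> bool" where
  "dominant_tame_term_of \<iota> r p y \<phi> t \<longleftrightarrow>
     (\<exists>n. dominant_index \<iota> y (lderiv \<phi>) (n - 1) \<and>
        (n = int p \<and> CHAR('k) = 0 \<and> t = (\<lambda>_. 0) \<or>
         coprime n (int p) \<and>
         (\<forall>q\<in>skeleton \<iota> r y. q (\<iota> (\<phi> n) * unit_powi y (n - int p)) < 1 \<and>
            bnorm (of_nat p :: 'k) < q (\<iota> (\<phi> n) * unit_powi y (n - int p))) \<and>
         t = lmonom (\<phi> n) n))"

definition dominant_tame_term ::
    "('k::alg_closed_valued_field \<Rightarrow> 'b::nonarch_banach_ring) \<Rightarrow> real \<Rightarrow>
     ('k \<Rightarrow> 'a::nonarch_banach_ring) \<Rightarrow> real \<Rightarrow> ('b \<Rightarrow> 'a) \<Rightarrow> nat \<Rightarrow>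
     ('a \<Rightarrow> real) \<Rightarrow> ('a \<Rightarrow> real) \<Rightarrow> (int \<Rightarrow> 'k) \<Rightarrow> bool" where
  "dominant_tame_term \<iota>X rX \<iota>Y rY f p u v t \<longleftrightarrow>
     (\<exists>x y \<phi> t0 c. monic_presentation \<iota>X rX \<iota>Y rY f p u v x y \<phi> \<and>
        dominant_tame_term_of \<iota>Y rY p y \<phi> t0 \<and> bnorm c = 1 \<and> t = (\<lambda>i. c * t0 i))"

definition kummer_presentation ::
    "('k::alg_closed_valued_field \<Rightarrow> 'b::nonarch_banach_ring) \<Rightarrow> real \<Rightarrow>
     ('k \<Rightarrow> 'a::nonarch_banach_ring) \<Rightarrow> real \<Rightarrow> ('b \<Rightarrow> 'a) \<Rightarrow> nat \<Rightarrow>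
     ('a \<Rightarrow> real) \<Rightarrow> ('a \<Rightarrow> real) \<Rightarrow> 'b \<Rightarrow> 'a \<Rightarrow> (int \<Rightarrow> 'k) \<Rightarrow> bool" where
  "kummer_presentation \<iota>X rX \<iota>Y rY f p u v x y \<phi> \<longleftrightarrow>
     monic_presentation \<iota>X rX \<iota>Y rY f p u v x y \<phi> \<and> \<phi> = lmonom 1 (int p)"

text \<open>In \<open>x = y\<^sup>p + c\<^sub>n y\<^sup>n\<close> the exponent \<open>n\<close> is, as throughout, the one for which \<open>n c\<^sub>n y\<^sup>n\<^sup>-\<^sup>1\<close> is the
  dominant term of the derivative. Without this, in mixed characteristic \<open>y\<^sup>p + c y\<^sup>n\<close> with \<open>n > p\<close>
  and \<open>\<bar>c\<bar> < \<bar>p\<bar>\<close> would be allowed, whose dominant tame term is \<open>0\<close>.\<close>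

definition binomial_presentation ::
    "('k::alg_closed_valued_field \<Rightarrow> 'b::nonarch_banach_ring) \<Rightarrow> real \<Rightarrow>
     ('k \<Rightarrow> 'a::nonarch_banach_ring) \<Rightarrow> real \<Rightarrow> ('b \<Rightarrow> 'a) \<Rightarrow> nat \<Rightarrow>
     ('a \<Rightarrow> real) \<Rightarrow> ('a \<Rightarrow> real) \<Rightarrow> 'b \<Rightarrow> 'a \<Rightarrow> (int \<Rightarrow> 'k) \<Rightarrow> bool" where
  "binomial_presentation \<iota>X rX \<iota>Y rY f p u v x y \<phi> \<longleftrightarrow>
     monic_presentation \<iota>X rX \<iota>Y rY f p u v x y \<phi> \<and>
     (\<exists>n. n \<noteq> int p \<and> \<phi> = (\<lambda>i. lmonom 1 (int p) i + lmonom (\<phi> n) n i) \<and>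
        dominant_index \<iota>Y y (lderiv \<phi>) (n - 1))"

end

(*
  In coordinates x, y compatible with the orientation, f x = y^p (1 + small): a unit of an annulus
  has a dominant term, its exponent is the degree of f up to sign because (f x)^q y^j is close to
  y^(pq + j), and the sign can be changed by inverting x.  Let theta = y d/dy.  As f is etale,
  theta (f x) is a unit with a dominant term D = n c_n y^n.

  Let |.| be the Gauss norm at an end point and l = |D / y^p|.  On the image of f the operator theta
  shrinks norms by the factor l, while it preserves the norm of series in the y^i with i prime to p.
  Hence any w with |theta w| <= l |w| is within l |w| of the image of f; this applies to all p-th
  powers, as |p| <= l.  Put G(e) = y^p (1 + e)^p + c_n y^n (1 + e)^n (without the second summand
  if n = p).  Then G(e + d) = G(e) + D d + (y d)^p + smaller terms, and (y d)^p is absorbed by the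
  image of f.  So Newton's method finds e with |e| < 1 and G(e) = f x', and then x' and y (1 + e) are
  the required coordinates.
*)
theory Submission
  imports Defs
begin

section \<open>Ultrametric seminorms\<close>

locale ultra_seminorm =
  fixes G :: "'a::comm_ring_1 \<Rightarrow> real"
  assumes nonneg: "0 \<le> G a"
    and zero: "G 0 = 0"
    and minus: "G (- a) = G a"
    and add: "G (a + b) \<le> max (G a) (G b)"
    and mult: "G (a * b) \<le> G a * G b"
    and one: "G 1 = 1"
begin

lemma diff: "G (a - b) \<le> max (G a) (G b)"
  using add[of a "- b"] by (simp add: minus)

lemma diff_commute: "G (a - b) = G (b - a)"
  using minus[of "a - b"] by simp

lemma add_le: "G a \<le> M \<Longrightarrow> G b \<le> M \<Longrightarrow> G (a + b) \<le> M"
  using add[of a b] by simp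

lemma diff_le: "G a \<le> M \<Longrightarrow> G b \<le> M \<Longrightarrow> G (a - b) \<le> M"
  using diff[of a b] by simp

lemma add_less: "G a < M \<Longrightarrow> G b < M \<Longrightarrow> G (a + b) < M"
  using add[of a b] by simp

lemma diff_less: "G a < M \<Longrightarrow> G b < M \<Longrightarrow> G (a - b) < M"
  using diff[of a b] by simp

lemma mult_le: "G a \<le> M \<Longrightarrow> G b \<le> N \<Longrightarrow> G (a * b) \<le> M * N"
  by (meson mult mult_mono nonneg order_trans)

lemma mult_le1: "G a \<le> 1 \<Longrightarrow> G b \<le> N \<Longrightarrow> G (a * b) \<le> N"
  using mult_le[of a 1 b N] by simp

lemma add_eq: "G b < G a \<Longrightarrow> G (a + b) = G a"
  using add[of a b] diff[of "a + b" b] by simp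

lemma eq_of_diff_less: "G (a - b) < G b \<Longrightarrow> G a = G b"
  using add_eq[of "a - b" b] by simp

lemma sum_le: "(\<And>i. i \<in> F \<Longrightarrow> G (h i) \<le> M) \<Longrightarrow> 0 \<le> M \<Longrightarrow> G (sum h F) \<le> M"
  by (induction F rule: infinite_finite_induct) (auto simp: zero intro: add_le)

lemma sum_less: "(\<And>i. i \<in> F \<Longrightarrow> G (h i) < M) \<Longrightarrow> 0 < M \<Longrightarrow> G (sum h F) < M"
  by (induction F rule: infinite_finite_induct) (auto simp: zero intro: add_less)

lemma power_le: "G (a ^ n) \<le> G a ^ n"
proof (induction n)
  case (Suc n)
  then show ?case using mult_le[of a "G a" "a ^ n"] by simp
qed (simp add: one)

lemma power_le_power: "G a \<le> M \<Longrightarrow> G (a ^ n) \<le> M ^ n"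
  by (meson nonneg order_trans power_le power_mono)

lemma power_le1: "G a \<le> 1 \<Longrightarrow> G (a ^ n) \<le> 1"
  using power_le_power[of a 1 n] by simp

lemma of_nat_le1: "G (of_nat n) \<le> 1"
  by (induction n) (auto simp: zero one intro: add_le)

lemma of_int_le1: "G (of_int n) \<le> 1"
  by (cases n rule: int_cases2) (auto simp: minus of_nat_le1)

lemma close_one: "G (u - 1) \<le> \<eta> \<Longrightarrow> \<eta> \<le> 1 \<Longrightarrow> G u \<le> 1"
  using add_le[of "u - 1" 1 1] by (simp add: one)

lemma close_one_mult:
  assumes "G (u - 1) \<le> \<eta>" "G (v - 1) \<le> \<eta>" "\<eta> \<le> 1"
  shows "G (u * v - 1) \<le> \<eta>"
proof -
  have "G (u * (v - 1)) \<le> \<eta>"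
    using mult_le1[OF close_one[OF assms(1,3)] assms(2)] .
  moreover have "u * v - 1 = u * (v - 1) + (u - 1)" by (simp add: algebra_simps)
  ultimately show ?thesis using assms(1) add_le by metis
qed

lemma close_one_power:
  assumes "G (u - 1) \<le> \<eta>" "\<eta> \<le> 1"
  shows "G (u ^ n - 1) \<le> \<eta>"
proof (induction n)
  case 0
  show ?case using assms(1) nonneg[of "u - 1"] by (simp add: zero)
next
  case (Suc n)
  then show ?case using close_one_mult[OF assms(1) Suc assms(2)] by simp
qed

lemma close_one_inverse:
  assumes "u * v = 1" "G (u - 1) \<le> \<eta>" "\<eta> < 1"
  shows "G (v - 1) \<le> \<eta>"
proof -
  have v: "v - 1 = - (v * (u - 1))"
    using assms(1) by (simp add: algebra_simps)
  have 1: "G (v - 1) \<le> G v * \<eta>"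
    unfolding v minus using mult_le[OF order_refl assms(2)] .
  have "G v \<le> 1"
  proof (rule ccontr)
    assume "\<not> G v \<le> 1"
    then have "G (v - 1) < G v" using 1 assms(3)
      by (smt (verit) mult_less_cancel_left2)
    then have "G v < G v" using \<open>\<not> G v \<le> 1\<close> add_less[of "v - 1" "G v" 1] by (simp add: one)
    then show False by simp
  qed
  moreover have "0 \<le> \<eta>" using assms(2) nonneg order_trans by blast
  ultimately have "G v * \<eta> \<le> \<eta>" by (simp add: mult_left_le_one_le nonneg)
  then show ?thesis using 1 by simp
qed

lemma power_diff_linear:
  assumes "G (u - 1) \<le> \<eta>" "G d \<le> \<eta>" "\<eta> \<le> 1"
  shows "G ((u + d) ^ n - u ^ n - of_nat n * d) \<le> \<eta> * G d"
proof (induction n)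
  case 0
  have "0 \<le> \<eta>" using assms(2) nonneg order_trans by blast
  then show ?case by (simp add: zero nonneg)
next
  case (Suc n)
  let ?R = "(u + d) ^ n - u ^ n - of_nat n * d"
  have eq: "(u + d) ^ Suc n - u ^ Suc n - of_nat (Suc n) * d
      = (u + d) * ?R + ((u ^ n - 1) * d + of_nat n * ((u - 1 + d) * d))"
    by (simp add: algebra_simps)
  have "G (u + d) \<le> 1"
    using close_one[OF assms(1,3)] assms(2,3) by (intro add_le) auto
  then have 1: "G ((u + d) * ?R) \<le> \<eta> * G d" using Suc by (rule mult_le1)
  have 2: "G ((u ^ n - 1) * d) \<le> \<eta> * G d"
    using close_one_power[OF assms(1,3)] by (intro mult_le) auto
  have "G ((u - 1 + d) * d) \<le> \<eta> * G d"
    using assms by (intro mult_le add_le) auto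
  then have 3: "G (of_nat n * ((u - 1 + d) * d)) \<le> \<eta> * G d"
    by (rule mult_le1[OF of_nat_le1])
  show ?case unfolding eq using 1 2 3 by (intro add_le)
qed

lemma inverse_power_diff_linear:
  assumes "u * u' = 1" "(u + d) * v' = 1" "G (u - 1) \<le> \<eta>" "G d \<le> \<eta>" "\<eta> < 1"
  shows "G (v' ^ n - u' ^ n + of_nat n * d) \<le> \<eta> * G d"
proof -
  let ?R = "(u + d) ^ n - u ^ n - of_nat n * d"
  have R: "G ?R \<le> \<eta> * G d" using power_diff_linear[of u \<eta> d n] assms by simp
  have u': "G (u' - 1) \<le> \<eta>" using close_one_inverse[OF assms(1,3,5)] .
  have "G (u + d - 1) \<le> \<eta>" using assms add_le[of "u - 1" \<eta> d] by (simp add: algebra_simps)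
  then have v': "G (v' - 1) \<le> \<eta>" using close_one_inverse[OF assms(2) _ assms(5)] by simp
  have uv: "G (u' ^ n * v' ^ n - 1) \<le> \<eta>"
    using assms by (intro close_one_mult close_one_power u' v') auto
  have un: "u ^ n * u' ^ n = 1" "(u + d) ^ n * v' ^ n = 1"
    using assms(1,2) by (simp_all flip: power_mult_distrib)
  have "((u + d) ^ n - u ^ n) * (u' ^ n * v' ^ n)
      = ((u + d) ^ n * v' ^ n) * u' ^ n - (u ^ n * u' ^ n) * v' ^ n"
    by (simp add: algebra_simps)
  also have "\<dots> = u' ^ n - v' ^ n" unfolding un by simp
  finally have "v' ^ n - u' ^ n + of_nat n * d
      = - (?R * (u' ^ n * v' ^ n) + of_nat n * ((u' ^ n * v' ^ n - 1) * d))"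
    by (simp add: algebra_simps)
  moreover have "G (?R * (u' ^ n * v' ^ n)) \<le> \<eta> * G d"
  proof -
    have "G (u' ^ n * v' ^ n) \<le> 1" using close_one[OF uv] assms by simp
    then show ?thesis using mult_le[OF R] by fastforce
  qed
  moreover have "G (of_nat n * ((u' ^ n * v' ^ n - 1) * d)) \<le> \<eta> * G d"
    by (rule mult_le1[OF of_nat_le1 mult_le[OF uv order_refl]])
  ultimately show ?thesis by (metis add_le minus)
qed

lemma prime_power_diff:
  assumes "prime p" "G u \<le> 1" "G d \<le> 1"
  shows "G ((u + d) ^ p - u ^ p - d ^ p) \<le> G (of_nat p) * G d"
    and "G (u - 1) \<le> \<eta> \<Longrightarrow> G d \<le> \<eta> \<Longrightarrow>
      G ((u + d) ^ p - u ^ p - d ^ p - of_nat p * d) \<le> G (of_nat p) * (\<eta> * G d)"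
proof -
  have p: "p > 0" "p > 1" using assms(1) prime_gt_0_nat prime_gt_1_nat by auto
  have "(u + d) ^ p = (d + u) ^ p" by (simp add: add.commute)
  also have "\<dots> = (\<Sum>k\<le>p. of_nat (p choose k) * d ^ k * u ^ (p - k))"
    by (rule binomial_ring)
  also have "{..p} = insert 0 (insert p {1..<p})" using p by auto
  also have "(\<Sum>k\<in>insert 0 (insert p {1..<p}). of_nat (p choose k) * d ^ k * u ^ (p - k))
      = u ^ p + (d ^ p + (\<Sum>k=1..<p. of_nat (p choose k) * d ^ k * u ^ (p - k)))"
    using p by simp
  finally have eq: "(u + d) ^ p - u ^ p - d ^ p
      = (\<Sum>k=1..<p. of_nat (p choose k) * d ^ k * u ^ (p - k))" by simp
  define c where "c k = (p choose k) div p" for k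
  have c: "p choose k = p * c k" if "k \<in> {1..<p}" for k
    unfolding c_def using dvd_choose_prime[of k p] that assms(1) p by (intro dvd_mult_div_cancel[symmetric]) auto
  have eq2: "(u + d) ^ p - u ^ p - d ^ p
      = of_nat p * (\<Sum>k=1..<p. of_nat (c k) * (d ^ (k - 1) * u ^ (p - k)) * d)"
    unfolding eq sum_distrib_left
  proof (rule sum.cong[OF refl])
    fix k assume k: "k \<in> {1..<p}"
    then have "d ^ k = d * d ^ (k - 1)" by (simp flip: power_Suc)
    then show "of_nat (p choose k) * d ^ k * u ^ (p - k)
        = of_nat p * (of_nat (c k) * (d ^ (k - 1) * u ^ (p - k)) * d)"
      by (simp add: c[OF k] algebra_simps)
  qed
  have "G (\<Sum>k=1..<p. of_nat (c k) * (d ^ (k - 1) * u ^ (p - k)) * d) \<le> G d"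
    using assms(2,3)
    by (intro sum_le nonneg mult_le1 of_nat_le1 power_le1 order_refl)
  then show "G ((u + d) ^ p - u ^ p - d ^ p) \<le> G (of_nat p) * G d"
    unfolding eq2 by (rule mult_le[OF order_refl])
  assume \<eta>: "G (u - 1) \<le> \<eta>" "G d \<le> \<eta>"
  then have \<eta>0: "0 \<le> \<eta>" using nonneg order_trans by blast
  show "G ((u + d) ^ p - u ^ p - d ^ p - of_nat p * d) \<le> G (of_nat p) * (\<eta> * G d)"
  proof (cases "\<eta> \<le> 1")
    case True
    have c1: "c 1 = 1" using p by (simp add: c_def)
    have "{1..<p} = insert 1 {2..<p}" using p by auto
    then have eq3: "(\<Sum>k=1..<p. of_nat (c k) * (d ^ (k - 1) * u ^ (p - k)) * d) - d
        = (u ^ (p - 1) - 1) * d + (\<Sum>k=2..<p. of_nat (c k) * (d ^ (k - 1) * u ^ (p - k)) * d)"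
      using c1 by (simp add: algebra_simps)
    have "G ((u ^ (p - 1) - 1) * d) \<le> \<eta> * G d"
      using close_one_power[OF \<eta>(1) True] by (intro mult_le) auto
    moreover have "G (\<Sum>k=2..<p. of_nat (c k) * (d ^ (k - 1) * u ^ (p - k)) * d) \<le> \<eta> * G d"
    proof (intro sum_le mult_le)
      fix k assume "k \<in> {2..<p}"
      then have "2 \<le> k" by simp
      then obtain j where "k = 2 + j" unfolding le_iff_add by blast
      then have j: "k - 1 = Suc j" by simp
      have "G (d ^ (k - 1)) \<le> \<eta>"
        unfolding j power_Suc mult.commute[of d]
        using assms(3) \<eta>(2) by (intro mult_le1 power_le1)
      moreover have "G (u ^ (p - k)) \<le> 1" using assms(2) by (rule power_le1)
      ultimately have "G (d ^ (k - 1) * u ^ (p - k)) \<le> \<eta>"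
        by (metis mult_le1 mult.commute)
      then show "G (of_nat (c k) * (d ^ (k - 1) * u ^ (p - k))) \<le> \<eta>"
        by (rule mult_le1[OF of_nat_le1])
    qed (use \<eta>0 nonneg in auto)
    ultimately have "G ((\<Sum>k=1..<p. of_nat (c k) * (d ^ (k - 1) * u ^ (p - k)) * d) - d) \<le> \<eta> * G d"
      unfolding eq3 by (rule add_le)
    then show ?thesis unfolding eq2 right_diff_distrib[symmetric] by (rule mult_le[OF order_refl])
  next
    case False
    have "G (of_nat p * ((\<Sum>k=1..<p. of_nat (c k) * (d ^ (k - 1) * u ^ (p - k)) * d) - d)) \<le> G (of_nat p) * G d"
      using \<open>G (\<Sum>k=1..<p. of_nat (c k) * (d ^ (k - 1) * u ^ (p - k)) * d) \<le> G d\<close>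
      by (intro mult_le diff_le) auto
    also have "G d \<le> \<eta> * G d" using False mult_right_mono[of 1 \<eta> "G d"] nonneg by simp
    then have "G (of_nat p) * G d \<le> G (of_nat p) * (\<eta> * G d)" by (intro mult_left_mono nonneg)
    finally show ?thesis unfolding eq2 right_diff_distrib[symmetric] .
  qed
qed

end

lemma bnorm_0 [simp]: "bnorm (0::'a::nonarch_banach_ring) = 0"
  using dist_bnorm[of "0::'a" 0] by simp

interpretation bn: ultra_seminorm "bnorm :: 'a::nonarch_banach_ring \<Rightarrow> real"
proof
  fix a b :: 'a
  show "0 \<le> bnorm a" using dist_bnorm[of a 0] zero_le_dist[of a 0] by simp
  show "bnorm (- a) = bnorm a"
    using dist_bnorm[of 0 a] dist_bnorm[of a 0] by (simp add: dist_commute)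
qed (simp_all add: bnorm_add_le_max bnorm_mult_le bnorm_one)

lemma bnorm_eq_0_iff: "bnorm (a::'a::nonarch_banach_ring) = 0 \<longleftrightarrow> a = 0"
  using dist_bnorm[of a 0] by auto

lemma bnorm_pos_iff: "0 < bnorm (a::'a::nonarch_banach_ring) \<longleftrightarrow> a \<noteq> 0"
  using bnorm_eq_0_iff[of a] bn.nonneg[of a] by auto

lemma bnorm_eq_0I:
  fixes a :: "'a::nonarch_banach_ring"
  assumes "\<And>e. e > 0 \<Longrightarrow> bnorm a \<le> e"
  shows "a = 0"
proof -
  have "bnorm a \<le> 0" using assms field_le_epsilon[of "bnorm a" 0] by simp
  then show ?thesis using bn.nonneg[of a] bnorm_eq_0_iff by force
qed

lemma bnorm_power: "bnorm (c ^ n :: 'k::alg_closed_valued_field) = bnorm c ^ n"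
  by (induction n) (simp_all add: bnorm_one bnorm_mult)

lemma bnorm_inverse: "bnorm (inverse c :: 'k::alg_closed_valued_field) = inverse (bnorm c)"
proof (cases "c = 0")
  case False
  then have "bnorm c * bnorm (inverse c) = 1" by (simp flip: bnorm_mult add: bnorm_one)
  then show ?thesis by (metis inverse_unique)
qed simp

lemma bnorm_power_int: "bnorm (c powi i :: 'k::alg_closed_valued_field) = bnorm c powi i"
  by (auto simp: power_int_def bnorm_power bnorm_inverse)


section \<open>Null families\<close>

definition null_family :: "('i \<Rightarrow> 'a::nonarch_banach_ring) \<Rightarrow> bool" where
  "null_family g \<longleftrightarrow> (\<forall>e>0. finite {i. e \<le> bnorm (g i)})"

lemma has_sum_bnorm_iff:
  "(g has_sum S) UNIV \<longleftrightarrow>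
    (\<forall>e>0. \<exists>F. finite F \<and> (\<forall>F'. finite F' \<and> F \<subseteq> F' \<longrightarrow> bnorm (S - sum g F') < e))"
  for S :: "'a::nonarch_banach_ring"
  unfolding has_sum_def tendsto_iff eventually_finite_subsets_at_top dist_bnorm
    bn.diff_commute[of _ S]
  by auto

lemma sum_diff_sum:
  fixes g :: "'i \<Rightarrow> 'a::ab_group_add"
  assumes "finite A" "finite B"
  shows "sum g A - sum g B = sum g (A - B) - sum g (B - A)"
  using sum.Int_Diff[OF assms(1), of g B] sum.Int_Diff[OF assms(2), of g A]
  by (simp add: Int_commute)

lemma null_family_has_sum:
  fixes g :: "'i \<Rightarrow> 'a::nonarch_banach_ring"
  assumes "null_family g"
  shows "(g has_sum infsum g UNIV) UNIV"
proof -
  define F where "F n = {i. inverse (real (Suc n)) \<le> bnorm (g i)}" for n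
  define T where "T n = sum g (F n)" for n
  have fin: "finite (F n)" for n using assms by (simp add: F_def null_family_def)
  have close: "bnorm (sum g A - sum g B) < inverse (real (Suc N))"
    if "finite A" "finite B" "F N \<subseteq> A" "F N \<subseteq> B" for A B N
  proof -
    have "bnorm (g i) < inverse (real (Suc N))" if "i \<notin> F N" for i
      using that unfolding F_def mem_Collect_eq not_le .
    then show ?thesis
      unfolding sum_diff_sum[OF that(1,2)]
      using that(3,4) by (intro bn.diff_less bn.sum_less) auto
  qed
  have mono: "F N \<subseteq> F n" if "N \<le> n" for N n
  proof -
    have "inverse (real (Suc n)) \<le> inverse (real (Suc N))" using that by (simp add: field_simps)
    from order_trans[OF this] show ?thesis unfolding F_def by blast
  qed
  have "Cauchy T"
  proof (rule metric_CauchyI)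
    fix e :: real assume "0 < e"
    then obtain N where N: "inverse (real (Suc N)) < e" using reals_Archimedean by blast
    have "dist (T m) (T n) < e" if "m \<ge> N" "n \<ge> N" for m n
      using close[of "F m" "F n" N] fin mono that N by (simp add: dist_bnorm T_def)
    then show "\<exists>N. \<forall>m\<ge>N. \<forall>n\<ge>N. dist (T m) (T n) < e" by blast
  qed
  then obtain S where S: "T \<longlonglongrightarrow> S" using Cauchy_convergent_iff convergent_def by blast
  have "(g has_sum S) UNIV"
    unfolding has_sum_bnorm_iff
  proof (intro allI impI)
    fix e :: real assume "0 < e"
    then obtain N where N: "inverse (real (Suc N)) < e" using reals_Archimedean by blast
    obtain M where M: "\<And>n. n \<ge> M \<Longrightarrow> dist (T n) S < e"
      using S \<open>0 < e\<close> by (metis lim_sequentially)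
    let ?n = "max M N"
    have "bnorm (S - sum g F') < e" if "finite F'" "F N \<subseteq> F'" for F'
    proof -
      have "bnorm (T ?n - sum g F') < e"
        using close[of "F ?n" F' N] fin that mono[of N ?n] N by (simp add: T_def)
      moreover have "bnorm (S - T ?n) < e" using M[of ?n] by (simp add: dist_bnorm bn.diff_commute)
      ultimately show ?thesis using bn.add_less[of "S - T ?n" e "T ?n - sum g F'"] by simp
    qed
    then show "\<exists>F. finite F \<and> (\<forall>F'. finite F' \<and> F \<subseteq> F' \<longrightarrow> bnorm (S - sum g F') < e)"
      using fin by blast
  qed
  then show ?thesis by (metis infsumI)
qed

lemma null_family_approx:
  assumes "null_family g" "e > 0"
  obtains F where "finite F" "\<And>F'. finite F' \<Longrightarrow> F \<subseteq> F' \<Longrightarrow> bnorm (infsum g UNIV - sum g F') < e"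
  using null_family_has_sum[OF assms(1)] assms(2) unfolding has_sum_bnorm_iff by metis

lemma null_family_bounded_additive:
  fixes f :: "'a::nonarch_banach_ring \<Rightarrow> 'c::nonarch_banach_ring"
  assumes g: "null_family g" and add: "\<And>a b. f (a + b) = f a + f b"
    and C: "\<And>a. bnorm (f a) \<le> C * bnorm a"
  shows "null_family (\<lambda>i. f (g i))" "infsum (\<lambda>i. f (g i)) UNIV = f (infsum g UNIV)"
proof -
  interpret f: additive f by standard (rule add)
  define K where "K = \<bar>C\<bar> + 1"
  have K: "K > 0" by (simp add: K_def)
  have fK: "bnorm (f a) \<le> K * bnorm a" for a
  proof -
    have "C * bnorm a \<le> K * bnorm a" by (intro mult_right_mono) (auto simp: K_def bn.nonneg)
    then show ?thesis using C[of a] by linarith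
  qed
  show "null_family (\<lambda>i. f (g i))"
    unfolding null_family_def
  proof (intro allI impI)
    fix e :: real assume "e > 0"
    have "{i. e \<le> bnorm (f (g i))} \<subseteq> {i. e / K \<le> bnorm (g i)}"
      using K fK by (auto simp: field_simps mult.commute intro: order_trans)
    moreover have "finite {i. e / K \<le> bnorm (g i)}"
      using g K \<open>e > 0\<close> by (simp add: null_family_def)
    ultimately show "finite {i. e \<le> bnorm (f (g i))}" by (rule finite_subset)
  qed
  have "((\<lambda>i. f (g i)) has_sum f (infsum g UNIV)) UNIV"
    unfolding has_sum_bnorm_iff
  proof (intro allI impI)
    fix e :: real assume "e > 0"
    then have "e / K > 0" using K by simp
    then obtain F where F: "finite F"
      "\<And>F'. finite F' \<Longrightarrow> F \<subseteq> F' \<Longrightarrow> bnorm (infsum g UNIV - sum g F') < e / K"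
      using null_family_approx[OF g] by metis
    have "bnorm (f (infsum g UNIV) - (\<Sum>i\<in>F'. f (g i))) < e" if "finite F'" "F \<subseteq> F'" for F'
    proof -
      have "f (infsum g UNIV) - (\<Sum>i\<in>F'. f (g i)) = f (infsum g UNIV - sum g F')"
        by (simp add: f.diff f.sum)
      also have "bnorm \<dots> \<le> K * bnorm (infsum g UNIV - sum g F')" by (rule fK)
      also have "\<dots> < e" using F(2)[OF that] K by (simp add: field_simps)
      finally show ?thesis .
    qed
    then show "\<exists>F. finite F \<and> (\<forall>F'. finite F' \<and> F \<subseteq> F' \<longrightarrow>
        bnorm (f (infsum g UNIV) - (\<Sum>i\<in>F'. f (g i))) < e)" using F(1) by blast
  qed
  then show "infsum (\<lambda>i. f (g i)) UNIV = f (infsum g UNIV)" by (rule infsumI)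
qed

lemma null_family_add:
  assumes "null_family g" "null_family h"
  shows "null_family (\<lambda>i. g i + h i)"
    "infsum (\<lambda>i. g i + h i) UNIV = infsum g UNIV + infsum h UNIV"
proof -
  show "null_family (\<lambda>i. g i + h i)"
    unfolding null_family_def
  proof (intro allI impI)
    fix e :: real assume "e > 0"
    have "{i. e \<le> bnorm (g i + h i)} \<subseteq> {i. e \<le> bnorm (g i)} \<union> {i. e \<le> bnorm (h i)}"
      using bn.add_less by (auto simp flip: not_le)
    then show "finite {i. e \<le> bnorm (g i + h i)}"
      by (rule finite_subset) (use assms \<open>e > 0\<close> in \<open>simp add: null_family_def\<close>)
  qed
  have "((\<lambda>i. g i + h i) has_sum (infsum g UNIV + infsum h UNIV)) UNIV"
    unfolding has_sum_bnorm_iff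
  proof (intro allI impI)
    fix e :: real assume "e > 0"
    obtain F where F: "finite F"
      "\<And>F'. finite F' \<Longrightarrow> F \<subseteq> F' \<Longrightarrow> bnorm (infsum g UNIV - sum g F') < e"
      using null_family_approx[OF assms(1) \<open>e > 0\<close>] by metis
    obtain H where H: "finite H"
      "\<And>F'. finite F' \<Longrightarrow> H \<subseteq> F' \<Longrightarrow> bnorm (infsum h UNIV - sum h F') < e"
      using null_family_approx[OF assms(2) \<open>e > 0\<close>] by metis
    have "bnorm (infsum g UNIV + infsum h UNIV - (\<Sum>i\<in>F'. g i + h i)) < e"
      if "finite F'" "F \<union> H \<subseteq> F'" for F'
    proof -
      have "infsum g UNIV + infsum h UNIV - (\<Sum>i\<in>F'. g i + h i)
        = (infsum g UNIV - sum g F') + (infsum h UNIV - sum h F')" by (simp add: sum.distrib)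
      then show ?thesis using F(2)[of F'] H(2)[of F'] that by (metis bn.add_less le_sup_iff)
    qed
    then show "\<exists>F. finite F \<and> (\<forall>F'. finite F' \<and> F \<subseteq> F' \<longrightarrow>
        bnorm (infsum g UNIV + infsum h UNIV - (\<Sum>i\<in>F'. g i + h i)) < e)"
      using F(1) H(1) by (meson finite_UnI)
  qed
  then show "infsum (\<lambda>i. g i + h i) UNIV = infsum g UNIV + infsum h UNIV" by (rule infsumI)
qed

lemma infsum_mult:
  fixes b :: "'a::nonarch_banach_ring"
  assumes "null_family g"
  shows "infsum (\<lambda>i. b * g i) UNIV = b * infsum g UNIV"
  by (rule null_family_bounded_additive(2)[where C = "bnorm b", OF assms])
    (simp_all add: distrib_left bnorm_mult_le)

lemma null_family_infsum_le:
  fixes g :: "'i \<Rightarrow> 'a::nonarch_banach_ring"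
  assumes g: "null_family g" and H: "ultra_seminorm H"
    and C: "\<And>a. H a \<le> C * bnorm a" and M: "\<And>i. H (g i) \<le> M" and "M \<ge> 0"
  shows "H (infsum g UNIV) \<le> M"
proof (rule field_le_epsilon)
  interpret H: ultra_seminorm H by (rule H)
  fix e :: real assume "e > 0"
  define K where "K = \<bar>C\<bar> + 1"
  have K: "K > 0" by (simp add: K_def)
  obtain F where F: "finite F"
    "\<And>F'. finite F' \<Longrightarrow> F \<subseteq> F' \<Longrightarrow> bnorm (infsum g UNIV - sum g F') < e / K"
    using null_family_approx[OF g, of "e / K"] \<open>e > 0\<close> K by auto
  let ?d = "infsum g UNIV - sum g F"
  have "C * bnorm ?d \<le> K * bnorm ?d" by (intro mult_right_mono) (auto simp: K_def bn.nonneg)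
  then have "H ?d \<le> K * bnorm ?d" using C[of ?d] by linarith
  also have "\<dots> \<le> e" using F(2)[of F] F(1) K by (simp add: field_simps)
  finally have "H ?d \<le> M + e" using \<open>M \<ge> 0\<close> by simp
  moreover have "H (sum g F) \<le> M + e"
    using H.sum_le[of F g M] M \<open>M \<ge> 0\<close> \<open>e > 0\<close> by fastforce
  ultimately show "H (infsum g UNIV) \<le> M + e" using H.add_le[of ?d "M + e" "sum g F"] by simp
qed

lemma infsum_finite_support:
  assumes "finite F" "\<And>i. i \<notin> F \<Longrightarrow> g i = 0"
  shows "infsum g UNIV = sum g F"
  using infsum_cong_neutral[of F UNIV g g] assms by (auto simp: infsum_finite)


section \<open>Integral powers of units\<close>

lemma ring_inverse_eq: "u * w = 1 \<Longrightarrow> ring_inverse u = w"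
  unfolding ring_inverse_def
proof (rule the_equality)
  fix z assume "u * w = 1" "u * z = 1"
  then show "z = w" by (metis mult.assoc mult.commute mult_1_right)
qed

lemma ring_inverse_mult: "u dvd 1 \<Longrightarrow> u * ring_inverse u = 1"
  by (metis dvdE ring_inverse_eq)

lemma unit_powi_0 [simp]: "unit_powi u 0 = 1"
  and unit_powi_1 [simp]: "unit_powi u 1 = u"
  by (simp_all add: unit_powi_def)

lemma unit_powi_of_nat: "unit_powi u (int n) = u ^ n"
  by (simp add: unit_powi_def)

lemma unit_powi_Suc:
  assumes "u dvd 1"
  shows "unit_powi u (i + 1) = unit_powi u i * u"
proof (cases "0 \<le> i")
  case True
  then have "nat (i + 1) = Suc (nat i)" by simp
  with True show ?thesis by (simp add: unit_powi_def mult.commute)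
next
  case False
  then have "nat (- i) = Suc (nat (- i - 1))" by simp
  then have "unit_powi u i * u = u * ring_inverse u * ring_inverse u ^ nat (- i - 1)"
    using False by (simp add: unit_powi_def algebra_simps)
  with False show ?thesis
    by (cases "i = - 1") (auto simp: unit_powi_def ring_inverse_mult[OF assms])
qed

lemma unit_powi_add:
  assumes "u dvd 1"
  shows "unit_powi u (i + j) = unit_powi u i * unit_powi u j"
proof (induction j rule: int_induct[where k = 0])
  case (step1 j)
  have "unit_powi u (i + (j + 1)) = unit_powi u (i + j) * u"
    using unit_powi_Suc[OF assms, of "i + j"] by (simp add: add.assoc)
  then show ?case using step1 unit_powi_Suc[OF assms, of j] by (simp add: mult.assoc)
next
  case (step2 j)
  have "unit_powi u (i + (j - 1)) * u = unit_powi u i * unit_powi u (j - 1) * u"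
    using step2 unit_powi_Suc[OF assms, of "i + j - 1"] unit_powi_Suc[OF assms, of "j - 1"]
    by (simp add: algebra_simps)
  then have "unit_powi u (i + (j - 1)) * (u * ring_inverse u)
      = unit_powi u i * unit_powi u (j - 1) * (u * ring_inverse u)"
    by (simp flip: mult.assoc)
  then show ?case by (simp add: ring_inverse_mult[OF assms])
qed simp

lemma unit_powi_inverse: "u dvd 1 \<Longrightarrow> unit_powi u i * unit_powi u (- i) = 1"
  using unit_powi_add[of u i "- i"] by simp

lemma unit_powi_dvd: "u dvd 1 \<Longrightarrow> unit_powi u i dvd 1"
  using unit_powi_inverse[of u i] by (metis dvd_triv_left)

lemma unit_powi_unique:
  assumes u: "u dvd 1" and "h 0 = 1" and h: "\<And>i. h (i + 1) = h i * u"
  shows "h (i::int) = unit_powi u i"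
proof (induction i rule: int_induct[where k = 0])
  case (step1 i)
  then show ?case by (simp add: h unit_powi_Suc[OF u])
next
  case (step2 i)
  have "h (i - 1) * u = unit_powi u (i - 1) * u"
    using step2 h[of "i - 1"] unit_powi_Suc[OF u, of "i - 1"] by simp
  then have "h (i - 1) * (u * ring_inverse u) = unit_powi u (i - 1) * (u * ring_inverse u)"
    by (simp flip: mult.assoc)
  then show ?case by (simp add: ring_inverse_mult[OF u])
qed (simp add: assms)

lemma unit_powi_mult_distrib:
  assumes "u dvd 1" "w dvd 1"
  shows "unit_powi (u * w) i = unit_powi u i * unit_powi w i"
proof -
  have "u * w dvd 1" using mult_dvd_mono[OF assms] by simp
  from unit_powi_unique[OF this, of "\<lambda>i. unit_powi u i * unit_powi w i"] show ?thesis
    by (simp add: unit_powi_Suc assms algebra_simps)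
qed

lemma ring_hom_type_diff:
  assumes "ring_hom_type h"
  shows "h 0 = 0" "h (a - b) = h a - h b" "h (- a) = - h a"
proof -
  interpret additive h using assms by (auto intro!: additive.intro simp: ring_hom_type_def)
  show "h 0 = 0" "h (a - b) = h a - h b" "h (- a) = - h a" by (simp_all add: zero diff minus)
qed

lemma ring_hom_type_dvd: "ring_hom_type h \<Longrightarrow> u dvd 1 \<Longrightarrow> h u dvd 1"
  unfolding ring_hom_type_def by (metis dvdE dvdI)

lemma ring_hom_type_unit_powi:
  assumes "ring_hom_type h" "u dvd 1"
  shows "h (unit_powi u i) = unit_powi (h u) i"
  using unit_powi_unique[OF ring_hom_type_dvd[OF assms], of "\<lambda>i. h (unit_powi u i)"]
    assms unfolding ring_hom_type_def by (simp add: unit_powi_Suc)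

lemma ring_hom_type_of_nat: "ring_hom_type h \<Longrightarrow> h (of_nat n) = of_nat n"
  by (induction n) (simp_all add: ring_hom_type_diff ring_hom_type_def)

lemma ring_hom_type_of_int: "ring_hom_type h \<Longrightarrow> h (of_int n) = of_int n"
  by (cases n rule: int_cases2) (simp_all add: ring_hom_type_of_nat ring_hom_type_diff)

lemma ring_hom_type_sum: "ring_hom_type h \<Longrightarrow> h (sum g A) = (\<Sum>i\<in>A. h (g i))"
  by (induction A rule: infinite_finite_induct) (simp_all add: ring_hom_type_diff ring_hom_type_def)

lemma (in ultra_seminorm) unit_powi_diff_linear:
  assumes u: "u dvd 1" "(u + d) dvd 1" and \<eta>: "G (u - 1) \<le> \<eta>" "G d \<le> \<eta>" "\<eta> < 1"
  shows "G (unit_powi (u + d) n - unit_powi u n - of_int n * d) \<le> \<eta> * G d"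
proof (cases "0 \<le> n")
  case True
  then show ?thesis
    using power_diff_linear[of u \<eta> d "nat n"] \<eta> by (simp add: unit_powi_def)
next
  case False
  have n: "of_int n = - (of_nat (nat (- n)) :: 'a)" using False by simp
  have "unit_powi (u + d) n - unit_powi u n - of_int n * d
      = ring_inverse (u + d) ^ nat (- n) - ring_inverse u ^ nat (- n) + of_nat (nat (- n)) * d"
    unfolding n using False by (simp add: unit_powi_def)
  then show ?thesis
    using inverse_power_diff_linear[OF ring_inverse_mult[OF u(1)] ring_inverse_mult[OF u(2)] \<eta>]
    by simp
qed


section \<open>Gauss norms of Laurent families\<close>

definition gauss_norm :: "real \<Rightarrow> (int \<Rightarrow> 'k::alg_closed_valued_field) \<Rightarrow> real" where
  "gauss_norm s c = (SUP i. bnorm (c i) * s powi i)"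

lemma laurent_algebra_iff:
  assumes "0 < r"
  shows "c \<in> laurent_algebra r \<longleftrightarrow> (\<forall>e>0. finite {i. e \<le> bnorm (c i) * max 1 (r powi i)})"
proof -
  have "dist (bnorm (c i) * max 1 (r powi i)) 0 = bnorm (c i) * max 1 (r powi i)" for i
    by (simp add: bn.nonneg)
  then show ?thesis
    by (simp add: laurent_algebra_def tendsto_iff eventually_cofinite not_less)
qed

lemma powi_le_max:
  fixes r s :: real
  assumes "0 < r" "r \<le> s" "s \<le> 1"
  shows "s powi i \<le> max 1 (r powi i)"
proof (cases "0 \<le> i")
  case True
  then show ?thesis using assms by (simp add: power_int_def power_le_one le_max_iff_disj)
next
  case False
  have "inverse s ^ nat (- i) \<le> inverse r ^ nat (- i)"
    using assms by (intro power_mono le_imp_inverse_le) auto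
  with False show ?thesis by (simp add: power_int_def le_max_iff_disj power_inverse)
qed

lemma laurent_finite:
  assumes "c \<in> laurent_algebra r" "0 < r" "s \<in> {r..1}" "0 < e"
  shows "finite {i. e \<le> bnorm (c i) * s powi i}"
proof (rule finite_subset)
  show "{i. e \<le> bnorm (c i) * s powi i} \<subseteq> {i. e \<le> bnorm (c i) * max 1 (r powi i)}"
  proof
    fix i assume i: "i \<in> {i. e \<le> bnorm (c i) * s powi i}"
    have "bnorm (c i) * s powi i \<le> bnorm (c i) * max 1 (r powi i)"
      using assms by (intro mult_left_mono powi_le_max bn.nonneg) auto
    with i show "i \<in> {i. e \<le> bnorm (c i) * max 1 (r powi i)}" by simp
  qed
  show "finite {i. e \<le> bnorm (c i) * max 1 (r powi i)}"
    using assms laurent_algebra_iff by blast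
qed

lemma gauss_attained:
  assumes "c \<in> laurent_algebra r" "0 < r" "s \<in> {r..1}"
  shows "\<exists>i. \<forall>j. bnorm (c j) * s powi j \<le> bnorm (c i) * s powi i"
proof (cases "\<exists>i. 0 < bnorm (c i) * s powi i")
  case True
  define h where "h i = bnorm (c i) * s powi i" for i
  from True obtain i0 where i0: "0 < h i0" by (auto simp: h_def)
  define F where "F = {i. h i0 \<le> h i}"
  have "finite F" using laurent_finite[OF assms] i0 by (simp add: F_def h_def)
  moreover have "i0 \<in> F" by (simp add: F_def)
  ultimately have "Max (h ` F) \<in> h ` F" by (intro Max_in) auto
  then obtain i where i: "i \<in> F" "h i = Max (h ` F)" by auto
  have "h j \<le> h i" for j
  proof (cases "j \<in> F")
    case True
    then show ?thesis using i \<open>finite F\<close> by simp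
  next
    case False
    then show ?thesis using i by (simp add: F_def)
  qed
  then show ?thesis by (auto simp: h_def)
next
  case False
  then have "bnorm (c j) * s powi j \<le> bnorm (c 0) * s powi 0" for j
    using order_trans[of "bnorm (c j) * s powi j" 0] by (simp add: not_less bn.nonneg)
  then show ?thesis by blast
qed

lemma gauss_norm_eqI:
  "(\<And>j. bnorm (c j) * s powi j \<le> bnorm (c i) * s powi i) \<Longrightarrow> gauss_norm s c = bnorm (c i) * s powi i"
  unfolding gauss_norm_def by (rule cSup_eq_maximum) auto

lemma gauss_norm_attained:
  assumes "c \<in> laurent_algebra r" "0 < r" "s \<in> {r..1}"
  obtains i where "gauss_norm s c = bnorm (c i) * s powi i"
    "\<And>j. bnorm (c j) * s powi j \<le> bnorm (c i) * s powi i"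
  using gauss_attained[OF assms] gauss_norm_eqI by metis

lemma laurent_norm_eq:
  assumes c: "c \<in> laurent_algebra r" and r: "0 < r" "r \<le> 1"
  shows "laurent_norm r c = max (gauss_norm r c) (gauss_norm 1 c)"
proof -
  obtain i where i: "gauss_norm r c = bnorm (c i) * r powi i"
    "\<And>j. bnorm (c j) * r powi j \<le> bnorm (c i) * r powi i"
    using gauss_norm_attained[OF c r(1), of r] r by auto
  obtain i' where i': "gauss_norm 1 c = bnorm (c i')" "\<And>j. bnorm (c j) \<le> bnorm (c i')"
    using gauss_norm_attained[OF c r(1), of 1] r by auto
  let ?h = "\<lambda>j. bnorm (c j) * max 1 (r powi j)"
  have h: "?h j = max (bnorm (c j)) (bnorm (c j) * r powi j)" for j
    by (simp add: max_mult_distrib_left bn.nonneg)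
  define k where "k = (if bnorm (c i') \<le> bnorm (c i) * r powi i then i else i')"
  have "?h j \<le> ?h k" for j
    using i(2)[of j] i'(2)[of j] i(2)[of k] i'(2)[of k] by (auto simp: h k_def)
  then have "laurent_norm r c = ?h k" unfolding laurent_norm_def by (intro cSup_eq_maximum) auto
  also have "?h k = max (gauss_norm r c) (gauss_norm 1 c)"
    using i(2)[of k] i'(2)[of k] by (auto simp: h k_def i(1) i'(1))
  finally show ?thesis .
qed

lemma laurent_algebra_dominated:
  assumes "c \<in> laurent_algebra r" "0 < r" "\<And>i. bnorm (d i) \<le> K * bnorm (c i)"
  shows "d \<in> laurent_algebra r"
  unfolding laurent_algebra_iff[OF assms(2)]
proof (intro allI impI)
  fix e :: real assume "e > 0"
  define L where "L = \<bar>K\<bar> + 1"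
  have L: "L > 0" by (simp add: L_def)
  have "bnorm (d i) \<le> L * bnorm (c i)" for i
    using assms(3)[of i] mult_right_mono[OF _ bn.nonneg, of K L "c i"] order_trans
    by (fastforce simp: L_def)
  then have "bnorm (d i) * max 1 (r powi i) \<le> L * (bnorm (c i) * max 1 (r powi i))" for i
    unfolding mult.assoc[symmetric] by (rule mult_right_mono) simp
  then have "{i. e \<le> bnorm (d i) * max 1 (r powi i)} \<subseteq> {i. e / L \<le> bnorm (c i) * max 1 (r powi i)}"
    using L by (auto simp: pos_divide_le_eq mult.commute intro: order_trans)
  then show "finite {i. e \<le> bnorm (d i) * max 1 (r powi i)}"
    by (rule finite_subset)
      (use assms(1) L \<open>e > 0\<close> in \<open>simp add: laurent_algebra_iff[OF assms(2)]\<close>)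
qed

lemma laurent_algebra_add:
  assumes "c \<in> laurent_algebra r" "d \<in> laurent_algebra r" "0 < r"
  shows "(\<lambda>i. c i + d i) \<in> laurent_algebra r"
  unfolding laurent_algebra_iff[OF assms(3)]
proof (intro allI impI)
  fix e :: real assume "e > 0"
  let ?m = "\<lambda>i. max 1 (r powi i)"
  have "bnorm (c i + d i) * ?m i \<le> max (bnorm (c i) * ?m i) (bnorm (d i) * ?m i)" for i
    using mult_right_mono[OF bn.add[of "c i" "d i"], of "?m i"] by (simp add: max_mult_distrib_right)
  then have "{i. e \<le> bnorm (c i + d i) * ?m i} \<subseteq>
      {i. e \<le> bnorm (c i) * ?m i} \<union> {i. e \<le> bnorm (d i) * ?m i}"
    by (smt (verit, best) Un_iff mem_Collect_eq subsetI)
  then show "finite {i. e \<le> bnorm (c i + d i) * ?m i}"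
    by (rule finite_subset) (use assms laurent_algebra_iff \<open>e > 0\<close> in auto)
qed

lemma laurent_algebra_finite_support:
  assumes "0 < r" "finite F" "\<And>i. i \<notin> F \<Longrightarrow> c i = 0"
  shows "c \<in> laurent_algebra r"
  unfolding laurent_algebra_iff[OF assms(1)]
proof (intro allI impI)
  fix e :: real assume "e > 0"
  then have "{i. e \<le> bnorm (c i) * max 1 (r powi i)} \<subseteq> F" using assms(3) by force
  then show "finite {i. e \<le> bnorm (c i) * max 1 (r powi i)}" using assms(2) finite_subset by blast
qed

lemma laurent_algebra_shift:
  assumes "c \<in> laurent_algebra r" "0 < r"
  shows "(\<lambda>i. c (i - m)) \<in> laurent_algebra r"
  unfolding laurent_algebra_iff[OF assms(2)]
proof (intro allI impI)
  fix e :: real assume "e > 0"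
  define M where "M = max 1 (r powi m)"
  have M: "M > 0" by (simp add: M_def)
  have "max 1 (r powi i) \<le> M * max 1 (r powi (i - m))" for i
  proof -
    have "r powi i = r powi m * r powi (i - m)" using assms(2) by (simp flip: power_int_add)
    also have "\<dots> \<le> M * max 1 (r powi (i - m))"
      using assms(2) by (intro mult_mono) (auto simp: M_def)
    moreover have "1 * 1 \<le> M * max 1 (r powi (i - m))" by (intro mult_mono) (auto simp: M_def)
    ultimately show ?thesis by simp
  qed
  then have "bnorm (c (i - m)) * max 1 (r powi i) \<le> M * (bnorm (c (i - m)) * max 1 (r powi (i - m)))" for i
    using mult_left_mono[of _ _ "bnorm (c (i - m))"] bn.nonneg by (metis mult.left_commute)
  then have "{i. e \<le> bnorm (c (i - m)) * max 1 (r powi i)}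
      \<subseteq> (\<lambda>i. i + m) ` {i. e / M \<le> bnorm (c i) * max 1 (r powi i)}" (is "_ \<subseteq> ?f ` ?A")
  proof (intro subsetI)
    fix i assume "\<And>i. bnorm (c (i - m)) * max 1 (r powi i) \<le> M * (bnorm (c (i - m)) * max 1 (r powi (i - m)))"
      "i \<in> {i. e \<le> bnorm (c (i - m)) * max 1 (r powi i)}"
    then have "e \<le> M * (bnorm (c (i - m)) * max 1 (r powi (i - m)))" using order_trans by blast
    then have "i - m \<in> ?A" using M by (simp add: pos_divide_le_eq mult.commute)
    then show "i \<in> ?f ` ?A" by (intro image_eqI[of _ _ "i - m"]) auto
  qed
  moreover have "finite ?A" using assms laurent_algebra_iff M \<open>e > 0\<close> by (metis divide_pos_pos)
  ultimately show "finite {i. e \<le> bnorm (c (i - m)) * max 1 (r powi i)}"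
    using finite_subset by blast
qed

lemma laurent_algebra_lmonom: "0 < r \<Longrightarrow> lmonom c n \<in> laurent_algebra r"
  by (rule laurent_algebra_finite_support[of _ "{n}"]) (auto simp: lmonom_def)

lemma gauss_norm_lmonom: "0 < s \<Longrightarrow> gauss_norm s (lmonom c n) = bnorm c * s powi n"
  using gauss_norm_eqI[of "lmonom c n" s n] by (simp add: lmonom_def bn.nonneg)


section \<open>Closed annuli\<close>

locale annulus =
  fixes \<iota> :: "'k::alg_closed_valued_field \<Rightarrow> 'a::nonarch_banach_ring" and r :: real and y :: 'a
  assumes algebra: "banach_algebra \<iota>" and coordinate: "monic_coordinate \<iota> r y"
    and r_pos: "0 < r" and r_le: "r \<le> 1"
begin

abbreviation "lcoeff \<equiv> laurent_coeffs \<iota> r y"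

abbreviation "ev \<equiv> laurent_eval \<iota> y"

abbreviation "G \<equiv> gauss_point \<iota> r y"

definition ymon :: "'k \<Rightarrow> int \<Rightarrow> 'a" where
  "ymon c i = \<iota> c * unit_powi y i"

lemma hom: "ring_hom_type \<iota>" using algebra by (simp add: banach_algebra_def)

lemma iota_simps [simp]:
  "\<iota> 0 = 0" "\<iota> 1 = 1" "\<iota> (a + b) = \<iota> a + \<iota> b" "\<iota> (a - b) = \<iota> a - \<iota> b"
  "\<iota> (- a) = - \<iota> a" "\<iota> (a * b) = \<iota> a * \<iota> b" "bnorm (\<iota> a) = bnorm a"
  using algebra ring_hom_type_diff[OF hom] by (auto simp: banach_algebra_def ring_hom_type_def)

lemma unit_y: "y dvd 1" using coordinate by (simp add: monic_coordinate_def)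

lemma ymon_simps [simp]: "ymon 0 i = 0" "ymon 1 0 = 1" "ymon 1 1 = y"
  by (simp_all add: ymon_def)

lemma ymon_add: "ymon (a + b) i = ymon a i + ymon b i"
  by (simp add: ymon_def algebra_simps)

lemma ymon_mult: "ymon a i * ymon b j = ymon (a * b) (i + j)"
  by (simp add: ymon_def unit_powi_add[OF unit_y])

lemma ymon_power: "ymon a i ^ n = ymon (a ^ n) (i * int n)"
  by (induction n) (simp_all add: ymon_mult algebra_simps)

lemma ymon_dvd: "a \<noteq> 0 \<Longrightarrow> ymon a i dvd 1"
  using ymon_mult[of a i "inverse a" "- i"] by (metis add.right_inverse dvd_triv_left ymon_simps(2) right_inverse)

lemma ymon_inverse: "a \<noteq> 0 \<Longrightarrow> ymon a i * ymon (inverse a) (- i) = 1"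
  by (simp add: ymon_mult)

lemma ev_lmonom: "ev (lmonom c n) = ymon c n"
proof -
  have "ev (lmonom c n) = (\<Sum>i\<in>{n}. \<iota> (lmonom c n i) * unit_powi y i)"
    unfolding laurent_eval_def by (rule infsum_finite_support) (auto simp: lmonom_def)
  then show ?thesis by (simp add: lmonom_def ymon_def)
qed

lemma lcoeff_in: "lcoeff a \<in> laurent_algebra r"
  and ev_coeff: "ev (lcoeff a) = a"
proof -
  have "a \<in> ev ` laurent_algebra r"
    using coordinate by (auto simp: monic_coordinate_def bij_betw_def)
  then show "lcoeff a \<in> laurent_algebra r" "ev (lcoeff a) = a"
    unfolding laurent_coeffs_def by (fact inv_into_into, fact f_inv_into_f)
qed

lemma lcoeff_eqI: "c \<in> laurent_algebra r \<Longrightarrow> ev c = a \<Longrightarrow> lcoeff a = c"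
  using coordinate unfolding laurent_coeffs_def monic_coordinate_def bij_betw_def by auto

lemma gauss_point_eq: "G s a = gauss_norm s (lcoeff a)"
  by (simp add: gauss_point_def gauss_norm_def)

lemma comparison:
  "\<exists>C>0. \<forall>a. bnorm a \<le> C * max (G r a) (G 1 a) \<and> max (G r a) (G 1 a) \<le> C * bnorm a"
proof -
  obtain C where C: "\<And>c. c \<in> laurent_algebra r \<Longrightarrow>
      bnorm (ev c) \<le> C * laurent_norm r c \<and> laurent_norm r c \<le> C * bnorm (ev c)"
    using coordinate unfolding monic_coordinate_def by blast
  have *: "bnorm a \<le> C * max (G r a) (G 1 a) \<and> max (G r a) (G 1 a) \<le> C * bnorm a" for a
    using C[OF lcoeff_in[of a]] laurent_norm_eq[OF lcoeff_in r_pos r_le, of a]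
    by (simp add: ev_coeff gauss_point_eq)
  have "lmonom 1 0 \<in> laurent_algebra r" using r_pos by (rule laurent_algebra_lmonom)
  then have "lcoeff 1 = lmonom 1 0" by (rule lcoeff_eqI) (simp add: ev_lmonom)
  then have "G s 1 = 1" if "s > 0" for s
    using gauss_norm_lmonom[OF that, of "1::'k" 0] by (simp add: gauss_point_eq bnorm_one)
  then have "C > 0" using *[of 1] r_pos by (simp add: bnorm_one)
  with * show ?thesis by blast
qed

definition CC :: real where
  "CC = (SOME C. C > 0 \<and>
     (\<forall>a. bnorm a \<le> C * max (G r a) (G 1 a) \<and> max (G r a) (G 1 a) \<le> C * bnorm a))"

lemma CC_pos: "CC > 0" and bnorm_le_CC: "bnorm a \<le> CC * max (G r a) (G 1 a)"
  and max_le_CC: "max (G r a) (G 1 a) \<le> CC * bnorm a"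
  using someI_ex[OF comparison, folded CC_def] by auto

lemma G_attained:
  assumes "s \<in> {r..1}"
  obtains i where "G s a = bnorm (lcoeff a i) * s powi i"
    "\<And>j. bnorm (lcoeff a j) * s powi j \<le> G s a"
  using gauss_norm_attained[OF lcoeff_in r_pos assms, of a] by (metis gauss_point_eq)

lemma lcoeff_le: "s \<in> {r..1} \<Longrightarrow> bnorm (lcoeff a j) * s powi j \<le> G s a"
  using G_attained by metis

lemma s_pos: "s \<in> {r..1} \<Longrightarrow> s > 0"
  using r_pos by auto

lemma powi_pos: "s \<in> {r..1} \<Longrightarrow> 0 < s powi i"
  using s_pos by simp

lemma end_points: "r \<in> {r..1}" "1 \<in> {r..1}"
  using r_le by auto

lemma G_le: "s \<in> {r..1} \<Longrightarrow> (\<And>j. bnorm (lcoeff a j) * s powi j \<le> M) \<Longrightarrow> G s a \<le> M"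
  using G_attained by metis

lemma G_less: "s \<in> {r..1} \<Longrightarrow> (\<And>j. bnorm (lcoeff a j) * s powi j < M) \<Longrightarrow> G s a < M"
  using G_attained by metis

lemma G_nonneg: "s \<in> {r..1} \<Longrightarrow> 0 \<le> G s a"
  using G_attained[of s a] by (metis bn.nonneg powi_pos less_imp_le mult_nonneg_nonneg)

lemma G_le_max:
  assumes "s \<in> {r..1}"
  shows "G s a \<le> max (G r a) (G 1 a)"
proof (rule G_le[OF assms])
  fix j
  have "bnorm (lcoeff a j) * s powi j \<le> bnorm (lcoeff a j) * max 1 (r powi j)"
    using assms r_pos by (intro mult_left_mono powi_le_max bn.nonneg) auto
  also have "\<dots> \<le> max (G r a) (G 1 a)"
    using lcoeff_le[OF end_points(1), of a j] lcoeff_le[OF end_points(2), of a j]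
    by (auto simp: max_mult_distrib_left bn.nonneg)
  finally show "bnorm (lcoeff a j) * s powi j \<le> max (G r a) (G 1 a)" .
qed

lemma G_le_bnorm: "s \<in> {r..1} \<Longrightarrow> G s a \<le> CC * bnorm a"
  using G_le_max max_le_CC order_trans by blast

lemma bnorm_ymon_le: "bnorm (ymon c i) \<le> CC * (bnorm c * max 1 (r powi i))"
proof -
  have "lcoeff (ymon c i) = lmonom c i"
    using r_pos by (intro lcoeff_eqI laurent_algebra_lmonom) (auto simp: ev_lmonom)
  then show ?thesis
    using bnorm_le_CC[of "ymon c i"] r_pos
    by (simp add: gauss_point_eq gauss_norm_lmonom max_mult_distrib_left bn.nonneg max.commute)
qed

lemma null_family_ymon:
  assumes "c \<in> laurent_algebra r"
  shows "null_family (\<lambda>i. ymon (c i) i)"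
  unfolding null_family_def
proof (intro allI impI)
  fix e :: real assume "e > 0"
  have "{i. e \<le> bnorm (ymon (c i) i)} \<subseteq> {i. e / CC \<le> bnorm (c i) * max 1 (r powi i)}"
  proof
    fix i assume "i \<in> {i. e \<le> bnorm (ymon (c i) i)}"
    then have "e \<le> CC * (bnorm (c i) * max 1 (r powi i))"
      using bnorm_ymon_le[of "c i" i] by simp
    then show "i \<in> {i. e / CC \<le> bnorm (c i) * max 1 (r powi i)}"
      using CC_pos by (simp add: pos_divide_le_eq mult.commute)
  qed
  then show "finite {i. e \<le> bnorm (ymon (c i) i)}"
    by (rule finite_subset) (use assms CC_pos \<open>e > 0\<close> in \<open>simp add: laurent_algebra_iff[OF r_pos]\<close>)
qed

lemma ev_eq: "ev c = infsum (\<lambda>i. ymon (c i) i) UNIV"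
  by (simp add: laurent_eval_def ymon_def)

lemma lcoeff_add: "lcoeff (a + b) i = lcoeff a i + lcoeff b i"
proof -
  have "ev (\<lambda>i. lcoeff a i + lcoeff b i) = a + b"
    using null_family_add(2)[OF null_family_ymon[OF lcoeff_in[of a]] null_family_ymon[OF lcoeff_in[of b]]]
    by (simp add: ev_eq[symmetric] ev_coeff ymon_add[symmetric])
  then show ?thesis
    using lcoeff_eqI[OF laurent_algebra_add[OF lcoeff_in lcoeff_in r_pos]] by metis
qed

lemma lcoeff_scale: "lcoeff (\<iota> k * a) i = k * lcoeff a i"
proof -
  have 1: "(\<lambda>i. k * lcoeff a i) \<in> laurent_algebra r"
    by (rule laurent_algebra_dominated[OF lcoeff_in[of a] r_pos, of _ "bnorm k"]) (simp add: bnorm_mult)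
  have 2: "ev (\<lambda>i. k * lcoeff a i) = \<iota> k * a"
    using infsum_mult[OF null_family_ymon[OF lcoeff_in[of a]], of "\<iota> k"]
    by (simp add: ev_eq[symmetric] ev_coeff) (simp add: ev_eq ymon_def mult.assoc)
  show ?thesis using lcoeff_eqI[OF 1 2] by metis
qed

lemma lcoeff_shift: "lcoeff (unit_powi y m * a) i = lcoeff a (i - m)"
proof -
  have "ev (\<lambda>i. lcoeff a (i - m)) = infsum (\<lambda>i. ymon (lcoeff a (i - m)) i) UNIV"
    by (rule ev_eq)
  also have "\<dots> = infsum (\<lambda>j. ymon (lcoeff a j) (j + m)) UNIV"
    using infsum_reindex_bij_betw[of "\<lambda>j. j + m" UNIV UNIV "\<lambda>i. ymon (lcoeff a (i - m)) i"]
    by (simp add: bij_plus_right)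
  also have "\<dots> = infsum (\<lambda>j. unit_powi y m * ymon (lcoeff a j) j) UNIV"
    by (simp add: ymon_def unit_powi_add[OF unit_y] algebra_simps)
  also have "\<dots> = unit_powi y m * a"
    using infsum_mult[OF null_family_ymon[OF lcoeff_in[of a]], of "unit_powi y m"]
    by (simp add: ev_eq[symmetric] ev_coeff)
  finally show ?thesis using lcoeff_eqI[OF laurent_algebra_shift[OF lcoeff_in r_pos]] by metis
qed

lemma lcoeff_ymon_mult: "lcoeff (ymon c m * a) i = c * lcoeff a (i - m)"
  by (simp add: ymon_def mult.assoc lcoeff_scale lcoeff_shift)

lemma lcoeff_ymon: "lcoeff (ymon c m) i = (if i = m then c else 0)"
  using lcoeff_eqI[OF laurent_algebra_lmonom[OF r_pos] ev_lmonom] by (simp add: lmonom_def)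

lemma lcoeff_0 [simp]: "lcoeff 0 i = 0"
  using lcoeff_scale[of 0 0 i] by simp

lemma lcoeff_minus: "lcoeff (- a) i = - lcoeff a i"
  using lcoeff_scale[of "- 1" a i] by simp

lemma lcoeff_diff: "lcoeff (a - b) i = lcoeff a i - lcoeff b i"
  using lcoeff_add[of a "- b" i] by (simp add: lcoeff_minus)

lemma lcoeff_sum: "lcoeff (sum h F) i = (\<Sum>j\<in>F. lcoeff (h j) i)"
  by (induction F rule: infinite_finite_induct) (simp_all add: lcoeff_add)

lemma lcoeff_inject: "(\<And>i. lcoeff a i = lcoeff b i) \<Longrightarrow> a = b"
  by (metis ev_coeff ext)

lemma lcoeff_one: "lcoeff 1 i = (if i = 0 then 1 else 0)"
  using lcoeff_ymon[of 1 0 i] by simp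

lemma G_ymon_mult:
  assumes s: "s \<in> {r..1}"
  shows "G s (ymon c m * a) = bnorm c * s powi m * G s a"
proof -
  have eq: "bnorm (lcoeff (ymon c m * a) j) * s powi j
      = bnorm c * s powi m * (bnorm (lcoeff a (j - m)) * s powi (j - m))" for j
    using s_pos[OF s] power_int_add[of s m "j - m"] by (simp add: lcoeff_ymon_mult bnorm_mult)
  obtain i where i: "G s a = bnorm (lcoeff a i) * s powi i" using G_attained[OF s] .
  show ?thesis
  proof (rule antisym)
    show "G s (ymon c m * a) \<le> bnorm c * s powi m * G s a"
      using lcoeff_le[OF s] powi_pos[OF s, of m]
      by (intro G_le[OF s]) (simp add: eq mult_left_mono bn.nonneg)
    show "bnorm c * s powi m * G s a \<le> G s (ymon c m * a)"
      using lcoeff_le[OF s, of "ymon c m * a" "i + m"] by (simp add: eq i)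
  qed
qed

lemma G_one: "s \<in> {r..1} \<Longrightarrow> G s 1 = 1"
  using lcoeff_ymon[of 1 0] s_pos
  by (simp add: gauss_point_eq gauss_norm_eqI[of _ s 0] bnorm_one lcoeff_one if_distrib)

lemma G_ymon: "s \<in> {r..1} \<Longrightarrow> G s (ymon c m) = bnorm c * s powi m"
  using G_ymon_mult[of s c m 1] by (simp add: G_one)

definition trunc :: "int set \<Rightarrow> 'a \<Rightarrow> 'a" where
  "trunc F a = (\<Sum>i\<in>F. ymon (lcoeff a i) i)"

lemma lcoeff_trunc: "finite F \<Longrightarrow> lcoeff (trunc F a) i = (if i \<in> F then lcoeff a i else 0)"
  by (simp add: trunc_def lcoeff_sum lcoeff_ymon)

lemma trunc_approx:
  assumes "e > 0"
  obtains F where "finite F" "\<And>F' s. finite F' \<Longrightarrow> F \<subseteq> F' \<Longrightarrow> s \<in> {r..1} \<Longrightarrow> G s (a - trunc F' a) < e"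
    "\<And>F'. finite F' \<Longrightarrow> F \<subseteq> F' \<Longrightarrow> bnorm (a - trunc F' a) < e"
proof -
  define e' where "e' = min e (e / CC) / 2"
  have e': "e' > 0" "e' < e" "CC * e' < e"
    using assms CC_pos by (auto simp: e'_def min_def field_simps)
  define F where "F = {i. e' \<le> bnorm (lcoeff a i) * max 1 (r powi i)}"
  have F: "finite F" using lcoeff_in[of a] e' by (simp add: F_def laurent_algebra_iff[OF r_pos])
  have 1: "G s (a - trunc F' a) \<le> e'" if "finite F'" "F \<subseteq> F'" "s \<in> {r..1}" for F' s
  proof (rule G_le[OF that(3)])
    fix j
    have "bnorm (lcoeff a j) * s powi j \<le> bnorm (lcoeff a j) * max 1 (r powi j)"
      using that r_pos by (intro mult_left_mono powi_le_max bn.nonneg) auto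
    also have "\<dots> \<le> e'" if "j \<notin> F" using that by (simp add: F_def)
    finally show "bnorm (lcoeff (a - trunc F' a) j) * s powi j \<le> e'"
      using that e' by (auto simp: lcoeff_diff lcoeff_trunc)
  qed
  show thesis
  proof (rule that[OF F])
    fix F' s assume "finite F'" "F \<subseteq> F'" "s \<in> {r..1}"
    then show "G s (a - trunc F' a) < e" using 1[of F' s] e'(2) by linarith
  next
    fix F' assume F': "finite F'" "F \<subseteq> F'"
    have "CC * max (G r (a - trunc F' a)) (G 1 (a - trunc F' a)) \<le> CC * e'"
      using 1[OF F' end_points(1)] 1[OF F' end_points(2)] CC_pos by simp
    then show "bnorm (a - trunc F' a) < e"
      using bnorm_le_CC[of "a - trunc F' a"] e'(3) by linarith
  qed
qed

lemma G_add_le: "s \<in> {r..1} \<Longrightarrow> G s (a + b) \<le> max (G s a) (G s b)"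
proof (rule G_le)
  fix j assume s: "s \<in> {r..1}"
  have "bnorm (lcoeff (a + b) j) * s powi j \<le> max (bnorm (lcoeff a j)) (bnorm (lcoeff b j)) * s powi j"
    unfolding lcoeff_add using powi_pos[OF s, of j] by (intro mult_right_mono bn.add) simp
  also have "\<dots> = max (bnorm (lcoeff a j) * s powi j) (bnorm (lcoeff b j) * s powi j)"
    using powi_pos[OF s, of j] by (simp add: max_mult_distrib_right)
  also have "\<dots> \<le> max (G s a) (G s b)"
    using lcoeff_le[OF s, of a j] lcoeff_le[OF s, of b j] by (intro max.mono)
  finally show "bnorm (lcoeff (a + b) j) * s powi j \<le> max (G s a) (G s b)" .
qed

lemma G_zero: "s \<in> {r..1} \<Longrightarrow> G s 0 = 0"
  using G_ymon[of s 0 0] by simp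

lemma G_sum_le:
  assumes "s \<in> {r..1}" "\<And>i. i \<in> F \<Longrightarrow> G s (h i) \<le> M" "0 \<le> M"
  shows "G s (sum h F) \<le> M"
  using assms(2)
proof (induction F rule: infinite_finite_induct)
  case (insert x F)
  then show ?case using G_add_le[OF assms(1), of "h x" "sum h F"] by fastforce
qed (use assms in \<open>auto simp: G_zero\<close>)

lemma G_mult_le:
  assumes s: "s \<in> {r..1}"
  shows "G s (a * b) \<le> G s a * G s b"
proof (rule field_le_epsilon)
  fix e :: real assume e: "e > 0"
  define e' where "e' = e / (CC * (bnorm b + 1))"
  have "e' > 0" using e CC_pos bn.nonneg[of b] by (simp add: e'_def add_nonneg_pos)
  obtain F where F: "finite F" "bnorm (a - trunc F a) < e'"
    by (rule trunc_approx[OF \<open>e' > 0\<close>, of a]) simp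
  have "G s (trunc F a * b) \<le> G s a * G s b"
    unfolding trunc_def sum_distrib_right
    using lcoeff_le[OF s] G_nonneg[OF s]
    by (intro G_sum_le[OF s]) (auto simp: G_ymon_mult[OF s] intro!: mult_right_mono)
  moreover have "G s ((a - trunc F a) * b) \<le> e"
  proof -
    have "bnorm ((a - trunc F a) * b) \<le> e' * bnorm b"
      using F(2) bn.mult_le[of "a - trunc F a" e' b "bnorm b"] by simp
    then have "CC * bnorm ((a - trunc F a) * b) \<le> CC * (e' * bnorm b)"
      using CC_pos by (intro mult_left_mono) auto
    also have "\<dots> = e * (bnorm b / (bnorm b + 1))" using CC_pos by (simp add: e'_def)
    also have "\<dots> \<le> e * 1"
      using e bn.nonneg[of b] by (intro mult_left_mono) auto
    finally show ?thesis
      using G_le_bnorm[OF s, of "(a - trunc F a) * b"] by linarith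
  qed
  moreover have "a * b = trunc F a * b + (a - trunc F a) * b" by (simp add: algebra_simps)
  ultimately have "G s (a * b) \<le> max (G s a * G s b) e"
    using G_add_le[OF s, of "trunc F a * b" "(a - trunc F a) * b"] by simp
  moreover have "0 \<le> G s a * G s b" using G_nonneg[OF s] by simp
  ultimately show "G s (a * b) \<le> G s a * G s b + e" using e by simp
qed

lemma G_ultra: "s \<in> {r..1} \<Longrightarrow> ultra_seminorm (G s)"
proof
  fix a assume s: "s \<in> {r..1}"
  have "G s (ymon (-1) 0 * a) = G s a"
    by (simp add: G_ymon_mult[OF s] bn.minus bnorm_one)
  then show "G s (- a) = G s a" by (simp add: ymon_def)
qed (simp_all add: G_nonneg G_zero G_add_le G_mult_le G_one)

lemma G_eq_0_iff:
  assumes "s \<in> {r..1}"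
  shows "G s a = 0 \<longleftrightarrow> a = 0"
proof
  assume "G s a = 0"
  then have "bnorm (lcoeff a i) * s powi i \<le> 0" for i using lcoeff_le[OF assms, of a i] by simp
  then have "bnorm (lcoeff a i) \<le> 0" for i
    using powi_pos[OF assms, of i] by (metis linorder_not_le mult_pos_pos)
  then have "lcoeff a i = 0" for i by (metis bn.nonneg bnorm_eq_0_iff order_antisym)
  then show "a = 0" by (intro lcoeff_inject) simp
qed (use assms G_zero in blast)

lemma G_pos_iff: "s \<in> {r..1} \<Longrightarrow> 0 < G s a \<longleftrightarrow> a \<noteq> 0"
  using G_eq_0_iff[of s a] G_nonneg[of s a] by auto

lemma bnorm_le_of_G_le:
  assumes "\<And>s. s \<in> {r, 1} \<Longrightarrow> G s a \<le> M"
  shows "bnorm a \<le> CC * M"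
proof -
  have "CC * max (G r a) (G 1 a) \<le> CC * M" using assms CC_pos by (intro mult_left_mono) auto
  then show ?thesis using bnorm_le_CC[of a] by linarith
qed

lemma in_end_points: "s \<in> {r, 1} \<Longrightarrow> s \<in> {r..1}"
  using end_points by auto

lemma bnorm_le_of_G_le_G:
  assumes "\<And>s. s \<in> {r, 1} \<Longrightarrow> G s a \<le> \<kappa> * G s b" "0 \<le> \<kappa>"
  shows "bnorm a \<le> CC * (\<kappa> * (CC * bnorm b))"
proof (rule bnorm_le_of_G_le)
  fix s assume s: "s \<in> {r, 1}"
  have "\<kappa> * G s b \<le> \<kappa> * (CC * bnorm b)"
    using assms(2) G_le_bnorm[OF in_end_points[OF s]] by (rule mult_left_mono[rotated])
  with assms(1)[OF s] show "G s a \<le> \<kappa> * (CC * bnorm b)" by linarith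
qed

lemma contraction:
  assumes diff: "\<And>a b. E (a - b) = E a - E b" and \<kappa>: "0 \<le> \<kappa>" "\<kappa> < 1"
    and E: "\<And>a s. s \<in> {r, 1} \<Longrightarrow> G s (E a) \<le> \<kappa> * G s a"
  shows "\<exists>z. z - E z = a"
proof -
  have E0: "E 0 = 0" using diff[of 0 0] by simp
  have Em: "E (- b) = - E b" for b using diff[of 0 b] E0 by simp
  have Ea: "E (b + c) = E b + E c" for b c using diff[of b "- c"] Em by simp
  have Es: "E (sum h F) = (\<Sum>i\<in>F. E (h i))" for h :: "nat \<Rightarrow> 'a" and F
    by (induction F rule: infinite_finite_induct) (simp_all add: E0 Ea)
  define g where "g n = (E ^^ n) a" for n
  have gs: "G s (g n) \<le> \<kappa> ^ n * G s a" if "s \<in> {r, 1}" for s n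
  proof (induction n)
    case (Suc n)
    have "G s (g (Suc n)) \<le> \<kappa> * G s (g n)" using E[OF that] by (simp add: g_def)
    also have "\<dots> \<le> \<kappa> * (\<kappa> ^ n * G s a)" using Suc \<kappa> by (intro mult_left_mono)
    finally show ?case by simp
  qed (simp add: g_def)
  then have gn: "bnorm (g n) \<le> CC * (\<kappa> ^ n * (CC * bnorm a))" for n
    using \<kappa> by (intro bnorm_le_of_G_le_G) auto
  have lim: "(\<lambda>n. CC * (\<kappa> ^ n * (CC * bnorm a))) \<longlonglongrightarrow> CC * (0 * (CC * bnorm a))"
    using \<kappa> by (intro tendsto_intros LIMSEQ_realpow_zero)
  have small: "\<exists>N. \<forall>n\<ge>N. bnorm (g n) < e" if "e > 0" for e
  proof -
    have "eventually (\<lambda>n. CC * (\<kappa> ^ n * (CC * bnorm a)) < e) sequentially"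
      using order_tendstoD(2)[OF lim, of e] that by simp
    then show ?thesis unfolding eventually_sequentially using gn le_less_trans by blast
  qed
  have null: "null_family g"
    unfolding null_family_def
  proof (intro allI impI)
    fix e :: real assume "e > 0"
    then obtain N where "\<forall>n\<ge>N. bnorm (g n) < e" using small by blast
    then have "{n. e \<le> bnorm (g n)} \<subseteq> {..<N}" by (auto simp: not_le[symmetric])
    then show "finite {n. e \<le> bnorm (g n)}" using finite_subset by blast
  qed
  define z where "z = infsum g UNIV"
  define K where "K = CC * (\<kappa> * CC) + 1"
  have K: "K \<ge> 1" using CC_pos \<kappa> by (simp add: K_def)
  have EK: "bnorm (E b) \<le> K * bnorm b" for b
  proof -
    have "bnorm (E b) \<le> CC * (\<kappa> * (CC * bnorm b))" using E \<kappa> by (intro bnorm_le_of_G_le_G) auto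
    also have "\<dots> \<le> K * bnorm b" using bn.nonneg[of b] by (simp add: K_def algebra_simps)
    finally show ?thesis .
  qed
  have "z - E z - a = 0"
  proof (rule bnorm_eq_0I)
    fix e :: real assume e: "e > 0"
    then obtain F where F: "finite F"
      "\<And>F'. finite F' \<Longrightarrow> F \<subseteq> F' \<Longrightarrow> bnorm (z - sum g F') < e / K"
      using null_family_approx[OF null, of "e / K"] K unfolding z_def by auto
    obtain N where N: "\<forall>n\<ge>N. bnorm (g n) < e" using small[OF e] by blast
    define n where "n = max N (Suc (Max (insert 0 F)))"
    define S where "S = sum g {..<n}"
    have "k \<le> Max (insert 0 F)" if "k \<in> F" for k using that F(1) by simp
    then have "F \<subseteq> {..<n}" by (fastforce simp: n_def)
    then have zS: "bnorm (z - S) < e / K" using F(2) by (simp add: S_def)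
    have "S - E S = (\<Sum>k<n. g k - g (Suc k))" by (simp add: S_def Es sum_subtractf g_def)
    also have "\<dots> = g 0 - g n" by (rule sum_lessThan_telescope')
    finally have S: "S - E S - a = - g n" by (simp add: g_def)
    have eq: "z - E z - a = (z - S) - E (z - S) + (S - E S - a)" by (simp add: diff)
    have "bnorm (z - S) \<le> e"
    proof -
      have "e / K \<le> e" using e K by (simp add: field_simps)
      then show ?thesis using zS by linarith
    qed
    moreover have "bnorm (E (z - S)) \<le> e"
    proof -
      have "K * bnorm (z - S) \<le> K * (e / K)" using zS K by (intro mult_left_mono) auto
      then show ?thesis using EK[of "z - S"] K by simp
    qed
    moreover have "bnorm (S - E S - a) \<le> e"
      unfolding S bn.minus using N by (simp add: n_def less_imp_le)
    ultimately show "bnorm (z - E z - a) \<le> e" unfolding eq by (rule bn.add_le[OF bn.diff_le])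
  qed
  then show ?thesis by (intro exI[of _ z]) (simp add: algebra_simps)
qed

lemma one_plus_dvd:
  assumes "\<And>s. s \<in> {r, 1} \<Longrightarrow> G s w < 1"
  shows "(1 + w) dvd 1"
proof -
  define \<kappa> where "\<kappa> = max (G r w) (G 1 w)"
  have "\<exists>z. z - - (w * z) = 1"
  proof (rule contraction)
    show "0 \<le> \<kappa>" "\<kappa> < 1" using assms G_nonneg[OF end_points(1)] by (auto simp: \<kappa>_def le_max_iff_disj)
    fix a s assume s: "s \<in> {r, 1}"
    interpret g: ultra_seminorm "G s" by (rule G_ultra[OF in_end_points[OF s]])
    show "G s (- (w * a)) \<le> \<kappa> * G s a"
      unfolding g.minus by (rule g.mult_le) (use s in \<open>auto simp: \<kappa>_def\<close>)
  qed (simp add: algebra_simps)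
  then obtain z where "z + w * z = 1" by auto
  then have "(1 + w) * z = 1" by (simp add: algebra_simps)
  then show ?thesis by (metis dvd_triv_left)
qed

lemma lcoeff_mult_extremal:
  assumes s: "s \<in> {r..1}"
    and a: "bnorm (lcoeff a i) * s powi i = G s a" and b: "bnorm (lcoeff b j) * s powi j = G s b"
    and strict: "\<And>k. k \<noteq> i \<Longrightarrow> (bnorm (lcoeff a k) * s powi k) *
       (bnorm (lcoeff b (i + j - k)) * s powi (i + j - k)) < G s a * G s b"
  shows "bnorm (lcoeff (a * b) (i + j)) * s powi (i + j) = G s a * G s b"
proof -
  interpret g: ultra_seminorm "G s" by (rule G_ultra[OF s])
  define P where "P = s powi (i + j)"
  have P: "P > 0" using powi_pos[OF s] by (simp add: P_def)
  have Pk: "s powi k * s powi (i + j - k) = P" for k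
    using s_pos[OF s] by (simp add: P_def flip: power_int_add)
  have "0 \<le> (bnorm (lcoeff a k) * s powi k) * (bnorm (lcoeff b l) * s powi l)" for k l
    using powi_pos[OF s, of k] powi_pos[OF s, of l] by (simp add: bn.nonneg)
  from order.strict_trans1[OF this strict, of "i + 1"]
  have "0 < G s a * G s b" by linarith
  then have pos: "0 < G s a" "0 < G s b"
    using g.nonneg[of a] g.nonneg[of b] by (auto simp: zero_less_mult_iff)
  obtain F where F: "finite F"
    "\<And>F'. finite F' \<Longrightarrow> F \<subseteq> F' \<Longrightarrow> G s (a - trunc F' a) < G s a"
    by (rule trunc_approx[OF pos(1), of a]) (use s in blast)
  define H where "H = insert i F"
  have H: "finite H" "G s (a - trunc H a) < G s a" using F by (auto simp: H_def)
  define R where "R = (\<Sum>k\<in>H - {i}. lcoeff a k * lcoeff b (i + j - k))"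
  define Q where "Q = lcoeff ((a - trunc H a) * b) (i + j)"
  have "lcoeff (trunc H a * b) (i + j) = (\<Sum>k\<in>H. lcoeff a k * lcoeff b (i + j - k))"
    by (simp add: trunc_def sum_distrib_right lcoeff_sum lcoeff_ymon_mult)
  also have "\<dots> = lcoeff a i * lcoeff b j + R"
    using H(1) by (subst sum.remove[of _ i]) (auto simp: H_def R_def)
  finally have "lcoeff (a * b) (i + j) = lcoeff a i * lcoeff b j + (R + Q)"
    using lcoeff_add[of "trunc H a * b" "(a - trunc H a) * b" "i + j"]
    by (simp add: Q_def algebra_simps)
  moreover have lead: "bnorm (lcoeff a i * lcoeff b j) * P = G s a * G s b"
    using Pk[of i] by (simp add: bnorm_mult a[symmetric] b[symmetric] algebra_simps)
  have "bnorm R < G s a * G s b / P"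
    unfolding R_def
  proof (rule bn.sum_less)
    fix k assume "k \<in> H - {i}"
    then have "bnorm (lcoeff a k * lcoeff b (i + j - k)) * P < G s a * G s b"
      using strict[of k] unfolding Pk[of k, symmetric] by (simp add: bnorm_mult mult_ac)
    then show "bnorm (lcoeff a k * lcoeff b (i + j - k)) < G s a * G s b / P"
      using P by (simp add: pos_less_divide_eq)
  qed (use pos P in simp)
  moreover have "bnorm Q < G s a * G s b / P"
  proof -
    have "bnorm Q * P \<le> G s ((a - trunc H a) * b)"
      unfolding Q_def P_def by (rule lcoeff_le[OF s])
    also have "\<dots> \<le> G s (a - trunc H a) * G s b" by (rule g.mult)
    also have "\<dots> < G s a * G s b" using H(2) pos by simp
    finally show ?thesis using P by (simp add: pos_less_divide_eq)
  qed
  ultimately have "bnorm (lcoeff (a * b) (i + j)) = bnorm (lcoeff a i * lcoeff b j)"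
    using bn.add_eq[OF bn.add_less] lead P by (metis nonzero_eq_divide_eq less_irrefl)
  then show ?thesis using lead by (simp add: P_def)
qed

lemma maximal_indices:
  assumes s: "s \<in> {r..1}" and "a \<noteq> 0"
  obtains i j where "bnorm (lcoeff a i) * s powi i = G s a"
    "\<And>k. i < k \<Longrightarrow> bnorm (lcoeff a k) * s powi k < G s a"
    "bnorm (lcoeff a j) * s powi j = G s a"
    "\<And>k. k < j \<Longrightarrow> bnorm (lcoeff a k) * s powi k < G s a" "j \<le> i"
proof -
  define A where "A = {i. G s a \<le> bnorm (lcoeff a i) * s powi i}"
  have fin: "finite A"
    unfolding A_def using laurent_finite[OF lcoeff_in r_pos s] G_pos_iff[OF s] assms(2) by blast
  obtain i where "G s a = bnorm (lcoeff a i) * s powi i" using G_attained[OF s] .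
  then have ne: "A \<noteq> {}" by (auto simp: A_def)
  have A: "bnorm (lcoeff a k) * s powi k = G s a" if "k \<in> A" for k
    using that lcoeff_le[OF s, of a k] by (simp add: A_def)
  have notA: "bnorm (lcoeff a k) * s powi k < G s a" if "k \<notin> A" for k
    using that by (simp add: A_def)
  show thesis
  proof (rule that)
    show "bnorm (lcoeff a (Max A)) * s powi Max A = G s a" using A fin ne by simp
    show "bnorm (lcoeff a (Min A)) * s powi Min A = G s a" using A fin ne by simp
    show "bnorm (lcoeff a k) * s powi k < G s a" if "Max A < k" for k
      using notA that fin by (meson Max_ge not_le)
    show "bnorm (lcoeff a k) * s powi k < G s a" if "k < Min A" for k
      using notA that fin by (meson Min_le not_le)
    show "Min A \<le> Max A" using fin ne by simp
  qed
qed

lemma lcoeff_mult_top: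
  assumes s: "s \<in> {r..1}" and nz: "a \<noteq> 0" "b \<noteq> 0"
    and a: "bnorm (lcoeff a i) * s powi i = G s a" and b: "bnorm (lcoeff b j) * s powi j = G s b"
    and "(\<forall>k>i. bnorm (lcoeff a k) * s powi k < G s a) \<and>
      (\<forall>k>j. bnorm (lcoeff b k) * s powi k < G s b) \<or>
      (\<forall>k<i. bnorm (lcoeff a k) * s powi k < G s a) \<and>
      (\<forall>k<j. bnorm (lcoeff b k) * s powi k < G s b)"
  shows "lcoeff (a * b) (i + j) \<noteq> 0"
    and "bnorm (lcoeff (a * b) (i + j)) * s powi (i + j) = G s a * G s b"
proof -
  have pos: "0 < G s a" "0 < G s b" using nz G_pos_iff[OF s] by auto
  show eq: "bnorm (lcoeff (a * b) (i + j)) * s powi (i + j) = G s a * G s b"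
  proof (rule lcoeff_mult_extremal[OF s a b])
    fix k assume "k \<noteq> i"
    let ?x = "bnorm (lcoeff a k) * s powi k"
    let ?y = "bnorm (lcoeff b (i + j - k)) * s powi (i + j - k)"
    have "?x < G s a \<or> ?y < G s b"
      using assms(6) \<open>k \<noteq> i\<close> by (cases "i < k") auto
    moreover have "?x \<le> G s a" "?y \<le> G s b" by (rule lcoeff_le[OF s])+
    moreover have "0 \<le> ?x" "0 \<le> ?y"
      using powi_pos[OF s, of k] powi_pos[OF s, of "i + j - k"] by (simp_all add: bn.nonneg)
    ultimately consider "?x < G s a" "?y \<le> G s b" "0 \<le> ?x" "0 \<le> ?y"
      | "?x \<le> G s a" "?y < G s b" "0 \<le> ?x" "0 \<le> ?y" by blast
    then show "?x * ?y < G s a * G s b"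
    proof cases
      case 1
      then have "?x * ?y \<le> ?x * G s b" by (intro mult_left_mono)
      also have "\<dots> < G s a * G s b" using 1 pos by simp
      finally show ?thesis .
    next
      case 2
      then have "?x * ?y \<le> G s a * ?y" by (intro mult_right_mono)
      also have "\<dots> < G s a * G s b" using 2 pos by simp
      finally show ?thesis .
    qed
  qed
  show "lcoeff (a * b) (i + j) \<noteq> 0" using eq pos by force
qed

lemma mult_eq_0_iff:
  fixes a b :: 'a
  shows "a * b = 0 \<longleftrightarrow> a = 0 \<or> b = 0"
proof -
  have "a * b \<noteq> 0" if nz: "a \<noteq> 0" "b \<noteq> 0"
  proof -
    obtain i where i: "bnorm (lcoeff a i) * 1 powi i = G 1 a"
      "\<And>k. i < k \<Longrightarrow> bnorm (lcoeff a k) * 1 powi k < G 1 a"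
      using maximal_indices[OF end_points(2) nz(1)] by metis
    obtain j where j: "bnorm (lcoeff b j) * 1 powi j = G 1 b"
      "\<And>k. j < k \<Longrightarrow> bnorm (lcoeff b k) * 1 powi k < G 1 b"
      using maximal_indices[OF end_points(2) nz(2)] by metis
    have "lcoeff (a * b) (i + j) \<noteq> 0"
      using i j by (intro lcoeff_mult_top(1)[OF end_points(2) nz i(1) j(1)]) auto
    then show ?thesis by auto
  qed
  then show ?thesis by auto
qed

lemma unit_dominant:
  assumes uv: "u * v = 1"
  obtains n where "\<And>s i. s \<in> {r..1} \<Longrightarrow> i \<noteq> n \<Longrightarrow>
    bnorm (lcoeff u i) * s powi i < bnorm (lcoeff u n) * s powi n"
proof -
  have "(1::'a) \<noteq> 0" by simp
  then have nz: "u \<noteq> 0" "v \<noteq> 0" using uv by auto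
  have loc: "\<exists>n. (\<forall>i. i \<noteq> n \<longrightarrow> bnorm (lcoeff u i) * s powi i < bnorm (lcoeff u n) * s powi n) \<and>
      (\<forall>i. i \<noteq> - n \<longrightarrow> bnorm (lcoeff v i) * s powi i < bnorm (lcoeff v (- n)) * s powi (- n)) \<and>
      bnorm (lcoeff u n) * bnorm (lcoeff v (- n)) = 1" if s: "s \<in> {r..1}" for s
  proof -
    obtain i1 i0 where i: "bnorm (lcoeff u i1) * s powi i1 = G s u"
      "\<And>k. i1 < k \<Longrightarrow> bnorm (lcoeff u k) * s powi k < G s u"
      "bnorm (lcoeff u i0) * s powi i0 = G s u"
      "\<And>k. k < i0 \<Longrightarrow> bnorm (lcoeff u k) * s powi k < G s u" "i0 \<le> i1"
      using maximal_indices[OF s nz(1)] by metis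
    obtain j1 j0 where j: "bnorm (lcoeff v j1) * s powi j1 = G s v"
      "\<And>k. j1 < k \<Longrightarrow> bnorm (lcoeff v k) * s powi k < G s v"
      "bnorm (lcoeff v j0) * s powi j0 = G s v"
      "\<And>k. k < j0 \<Longrightarrow> bnorm (lcoeff v k) * s powi k < G s v" "j0 \<le> j1"
      using maximal_indices[OF s nz(2)] by metis
    have 1: "i1 + j1 = 0"
      using lcoeff_mult_top(1)[OF s nz i(1) j(1)] i(2) j(2) by (simp add: uv lcoeff_one split: if_splits)
    have 2: "i0 + j0 = 0"
      using lcoeff_mult_top(1)[OF s nz i(3) j(3)] i(4) j(4) by (simp add: uv lcoeff_one split: if_splits)
    have eq: "i0 = i1" "j1 = - i1" "j0 = - i1" using 1 2 i(5) j(5) by auto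
    have "bnorm (lcoeff u i1) * bnorm (lcoeff v (- i1)) * (s powi i1 * s powi (- i1)) = G s u * G s v"
      using i(1) j(1) by (simp add: eq mult_ac)
    moreover have "bnorm (lcoeff (u * v) (i1 + j1)) * s powi (i1 + j1) = G s u * G s v"
      using lcoeff_mult_top(2)[OF s nz i(1) j(1)] i(2) j(2) by blast
    then have "G s u * G s v = 1" by (simp add: uv 1 lcoeff_one bnorm_one)
    moreover have "s powi i1 * s powi (- i1) = 1" using s_pos[OF s] by (simp flip: power_int_add)
    ultimately have "bnorm (lcoeff u i1) * bnorm (lcoeff v (- i1)) = 1" by simp
    moreover have "bnorm (lcoeff u k) * s powi k < bnorm (lcoeff u i1) * s powi i1" if "k \<noteq> i1" for k
      using i that eq by (cases "k < i1") auto
    moreover have "bnorm (lcoeff v k) * s powi k < bnorm (lcoeff v (- i1)) * s powi (- i1)" if "k \<noteq> - i1" for k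
      using j that eq by (cases "k < - i1") auto
    ultimately show ?thesis by blast
  qed
  obtain n where n: "\<And>i. i \<noteq> n \<Longrightarrow> bnorm (lcoeff u i) < bnorm (lcoeff u n)"
    "\<And>i. i \<noteq> - n \<Longrightarrow> bnorm (lcoeff v i) < bnorm (lcoeff v (- n))"
    "bnorm (lcoeff u n) * bnorm (lcoeff v (- n)) = 1"
    using loc[OF end_points(2)] by auto
  show thesis
  proof (rule that)
    fix s i assume s: "s \<in> {r..1}" and "i \<noteq> n"
    obtain m where m: "\<And>i. i \<noteq> m \<Longrightarrow> bnorm (lcoeff u i) * s powi i < bnorm (lcoeff u m) * s powi m"
      "bnorm (lcoeff u m) * bnorm (lcoeff v (- m)) = 1"
      using loc[OF s] by blast
    have "m = n"
    proof (rule ccontr)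
      assume "m \<noteq> n"
      then have "bnorm (lcoeff u m) * bnorm (lcoeff v (- m))
          < bnorm (lcoeff u n) * bnorm (lcoeff v (- n))"
        using n by (intro mult_strict_mono') (auto simp: bn.nonneg)
      then show False using n(3) m(2) by simp
    qed
    then show "bnorm (lcoeff u i) * s powi i < bnorm (lcoeff u n) * s powi n"
      using m(1) \<open>i \<noteq> n\<close> by blast
  qed
qed

lemma dominant_factor:
  assumes "\<And>i. i \<noteq> n \<Longrightarrow> bnorm (lcoeff u i) * s powi i < bnorm (lcoeff u n) * s powi n"
    and s: "s \<in> {r..1}"
  shows "lcoeff u n \<noteq> 0" "G s u = bnorm (lcoeff u n) * s powi n"
    "G s (ymon (inverse (lcoeff u n)) (- n) * u - 1) < 1"
proof -
  have nn: "0 \<le> bnorm (lcoeff u (n + 1)) * s powi (n + 1)"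
    using powi_pos[OF s, of "n + 1"] by (simp add: bn.nonneg)
  then have "0 < bnorm (lcoeff u n) * s powi n" using assms(1)[of "n + 1"] by linarith
  then have bpos: "0 < bnorm (lcoeff u n)"
    using powi_pos[OF s, of n] by (simp add: zero_less_mult_iff)
  then show nz: "lcoeff u n \<noteq> 0" by auto
  show Gu: "G s u = bnorm (lcoeff u n) * s powi n"
    unfolding gauss_point_eq by (rule gauss_norm_eqI) (metis assms(1) less_imp_le order_refl)
  let ?w = "ymon (inverse (lcoeff u n)) (- n) * u - 1"
  show "G s ?w < 1"
  proof (rule G_less[OF s])
    fix j
    show "bnorm (lcoeff ?w j) * s powi j < 1"
    proof (cases "j = 0")
      case True
      then show ?thesis using nz by (simp add: lcoeff_diff lcoeff_ymon_mult lcoeff_one)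
    next
      case False
      have "lcoeff ?w j = inverse (lcoeff u n) * lcoeff u (j + n)"
        using False by (simp add: lcoeff_diff lcoeff_ymon_mult lcoeff_one)
      then have "bnorm (lcoeff ?w j) * s powi j
          = bnorm (lcoeff u (j + n)) * s powi (j + n) / (bnorm (lcoeff u n) * s powi n)"
        using s_pos[OF s] by (simp add: bnorm_mult bnorm_inverse power_int_add divide_inverse)
      also have "\<dots> < 1"
        using assms(1)[of "j + n"] False \<open>0 < bnorm (lcoeff u n) * s powi n\<close> by simp
      finally show ?thesis .
    qed
  qed
qed

definition theta :: "'a \<Rightarrow> 'a" where
  "theta a = ev (\<lambda>i. of_int i * lcoeff a i)"

lemma lcoeff_theta: "lcoeff (theta a) i = of_int i * lcoeff a i"
proof -
  have "(\<lambda>i. of_int i * lcoeff a i) \<in> laurent_algebra r"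
    by (rule laurent_algebra_dominated[OF lcoeff_in[of a] r_pos, of _ 1])
      (simp add: bn.mult_le1 bn.of_int_le1)
  then show ?thesis using lcoeff_eqI[OF _ refl] unfolding theta_def by metis
qed

lemma G_theta_le: "s \<in> {r..1} \<Longrightarrow> G s (theta a) \<le> G s a"
proof (rule G_le)
  fix j assume s: "s \<in> {r..1}"
  have "bnorm (lcoeff (theta a) j) * s powi j \<le> bnorm (lcoeff a j) * s powi j"
    using powi_pos[OF s, of j] by (simp add: lcoeff_theta mult_right_mono bn.mult_le1 bn.of_int_le1)
  then show "bnorm (lcoeff (theta a) j) * s powi j \<le> G s a"
    using lcoeff_le[OF s, of a j] by linarith
qed

lemma theta_add: "theta (a + b) = theta a + theta b"
  by (rule lcoeff_inject) (simp add: lcoeff_theta lcoeff_add algebra_simps)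

lemma theta_diff: "theta (a - b) = theta a - theta b"
  by (rule lcoeff_inject) (simp add: lcoeff_theta lcoeff_diff algebra_simps)

lemma theta_0 [simp]: "theta 0 = 0"
  using theta_diff[of 0 0] by simp

lemma lcoeff_of_int_mult: "lcoeff (of_int n * a) i = of_int n * lcoeff a i"
  using lcoeff_scale[of "of_int n" a i] by (simp add: ring_hom_type_of_int[OF hom])

lemma theta_ymon: "theta (ymon c i) = of_int i * ymon c i"
  by (rule lcoeff_inject) (simp add: lcoeff_theta lcoeff_ymon lcoeff_of_int_mult)

lemma bnorm_theta_le: "bnorm (theta a) \<le> CC * CC * bnorm a"
  using bnorm_le_of_G_le_G[of "theta a" 1 a] G_theta_le[OF in_end_points] by (simp add: mult.assoc)

lemma bounded_additive_eq_0:
  fixes D :: "'a \<Rightarrow> 'c::nonarch_banach_ring"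
  assumes add: "\<And>a b. D (a + b) = D a + D b" and K: "\<And>a. bnorm (D a) \<le> K * bnorm a"
    and ymon: "\<And>c i. D (ymon c i) = 0"
  shows "D a = 0"
proof (rule bnorm_eq_0I)
  fix e :: real assume e: "e > 0"
  interpret D: additive D by standard (rule add)
  define L where "L = \<bar>K\<bar> + 1"
  have L: "L > 0" by (simp add: L_def)
  obtain F where F: "finite F" "bnorm (a - trunc F a) < e / L"
    by (rule trunc_approx[of "e / L" a]) (use e L in auto)
  have "D (trunc F a) = 0" by (simp add: trunc_def D.sum ymon)
  then have "D a = D (a - trunc F a)" by (simp add: D.diff)
  also have "bnorm \<dots> \<le> K * bnorm (a - trunc F a)" by (rule K)
  also have "\<dots> \<le> L * bnorm (a - trunc F a)" by (intro mult_right_mono) (auto simp: L_def bn.nonneg)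
  also have "\<dots> \<le> e" using F(2) L by (simp add: field_simps)
  finally show "bnorm (D a) \<le> e" .
qed

lemma theta_mult: "theta (a * b) = theta a * b + a * theta b"
proof -
  define D where "D a b = theta (a * b) - theta a * b - a * theta b" for a b
  have bound: "bnorm (D a b) \<le> (CC * CC + CC * CC + CC * CC) * (bnorm a * bnorm b)" for a b
  proof -
    have "bnorm (theta (a * b)) \<le> CC * CC * (bnorm a * bnorm b)"
      using bnorm_theta_le[of "a * b"] mult_left_mono[OF bnorm_mult_le, of "CC * CC" a b] by simp
    moreover have "bnorm (theta a * b) \<le> CC * CC * (bnorm a * bnorm b)"
      using bn.mult_le[OF bnorm_theta_le[of a] order_refl[of "bnorm b"]] by (simp add: mult.assoc)
    moreover have "bnorm (a * theta b) \<le> CC * CC * (bnorm a * bnorm b)"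
      using bn.mult_le[OF order_refl[of "bnorm a"] bnorm_theta_le[of b]] by (simp add: mult_ac)
    ultimately have "bnorm (D a b) \<le> CC * CC * (bnorm a * bnorm b)"
      unfolding D_def by (intro bn.diff_le)
    also have "\<dots> \<le> (CC * CC + CC * CC + CC * CC) * (bnorm a * bnorm b)"
      using bn.nonneg[of a] bn.nonneg[of b] by (intro mult_right_mono) auto
    finally show ?thesis .
  qed
  have 1: "D (ymon c i) (ymon d j) = 0" for c d i j
    by (simp add: D_def theta_ymon ymon_mult algebra_simps)
  have 2: "D (ymon c i) b = 0" for c i b
  proof (rule bounded_additive_eq_0[of "D (ymon c i)"])
    show "bnorm (D (ymon c i) b) \<le> (CC * CC + CC * CC + CC * CC) * bnorm (ymon c i) * bnorm b" for b
      using bound[of "ymon c i" b] by (simp add: mult.assoc)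
  qed (simp_all add: 1, simp add: D_def theta_add algebra_simps)
  have "D a b = 0"
  proof (rule bounded_additive_eq_0[of "\<lambda>a. D a b"])
    show "bnorm (D a b) \<le> (CC * CC + CC * CC + CC * CC) * bnorm b * bnorm a" for a
      using bound[of a b] by (simp add: mult_ac)
  qed (simp_all add: 2, simp add: D_def theta_add algebra_simps)
  then show ?thesis by (simp add: D_def algebra_simps)
qed

lemma theta_1 [simp]: "theta 1 = 0"
  using theta_ymon[of 1 0] by simp

lemma theta_y: "theta y = y"
  using theta_ymon[of 1 1] by simp

lemma theta_power: "theta (a ^ n) = of_nat n * a ^ (n - 1) * theta a"
proof (induction n)
  case (Suc n)
  then show ?case by (cases n) (simp_all add: theta_mult algebra_simps)
qed simp

lemma theta_unit_powi:
  assumes u: "u dvd 1"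
  shows "u * theta (unit_powi u i) = of_int i * unit_powi u i * theta u"
proof (induction i rule: int_induct[where k = 0])
  case (step1 i)
  have "u * theta (unit_powi u (i + 1)) = (u * theta (unit_powi u i)) * u + u * unit_powi u i * theta u"
    unfolding unit_powi_Suc[OF u] by (simp add: theta_mult algebra_simps)
  then show ?case unfolding step1(2) unit_powi_Suc[OF u] by (simp add: algebra_simps)
next
  case (step2 i)
  have pi: "unit_powi u i = unit_powi u (i - 1) * u" using unit_powi_Suc[OF u, of "i - 1"] by simp
  have "u * theta (unit_powi u (i - 1)) * u = u * theta (unit_powi u i) - u * unit_powi u (i - 1) * theta u"
    unfolding pi by (simp add: theta_mult algebra_simps)
  also have "\<dots> = of_int (i - 1) * unit_powi u (i - 1) * theta u * u"
    unfolding step2(2) by (simp add: pi algebra_simps)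
  finally have "u * theta (unit_powi u (i - 1)) * (u * ring_inverse u)
      = of_int (i - 1) * unit_powi u (i - 1) * theta u * (u * ring_inverse u)"
    by (simp flip: mult.assoc)
  then show ?case by (simp add: ring_inverse_mult[OF u])
qed simp

lemma null_family_dominated:
  assumes "c \<in> laurent_algebra r"
    and "\<And>i s. s \<in> {r, 1} \<Longrightarrow> G s (h i) \<le> bnorm (c i) * s powi i"
  shows "null_family h"
  unfolding null_family_def
proof (intro allI impI)
  fix e :: real assume "e > 0"
  have "bnorm (h i) \<le> CC * (bnorm (c i) * max 1 (r powi i))" for i
  proof (rule bnorm_le_of_G_le)
    fix s assume s: "s \<in> {r, 1}"
    have "bnorm (c i) * s powi i \<le> bnorm (c i) * max 1 (r powi i)"
      using s by (intro mult_left_mono bn.nonneg) auto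
    then show "G s (h i) \<le> bnorm (c i) * max 1 (r powi i)" using assms(2)[OF s, of i] by linarith
  qed
  then have "{i. e \<le> bnorm (h i)} \<subseteq> {i. e / CC \<le> bnorm (c i) * max 1 (r powi i)}"
    using CC_pos by (auto simp: pos_divide_le_eq mult.commute intro: order_trans)
  then show "finite {i. e \<le> bnorm (h i)}"
    by (rule finite_subset) (use assms CC_pos \<open>e > 0\<close> in \<open>simp add: laurent_algebra_iff[OF r_pos]\<close>)
qed

lemma infsum_G_le:
  assumes "null_family h" "s \<in> {r..1}" "\<And>i. G s (h i) \<le> M"
  shows "G s (infsum h UNIV) \<le> M"
  using null_family_infsum_le[OF assms(1) G_ultra[OF assms(2)] G_le_bnorm[OF assms(2)] assms(3)]
    assms(3) G_nonneg[OF assms(2)] order_trans by blast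

text \<open>A family \<open>e\<^sub>i\<close> that is uniformly close to the monomials \<open>y\<^sup>i\<close> is again an orthogonal topological
  basis for the Gauss norms at the end points.\<close>

definition perturbed :: "(int \<Rightarrow> 'a) \<Rightarrow> 'a \<Rightarrow> 'a" where
  "perturbed e a = infsum (\<lambda>i. \<iota> (lcoeff a i) * e i) UNIV"

lemma
  assumes \<kappa>: "0 \<le> \<kappa>" "\<kappa> < 1"
    and e: "\<And>i s. s \<in> {r, 1} \<Longrightarrow> G s (e i - ymon 1 i) \<le> \<kappa> * s powi i"
  shows null_family_perturbed: "null_family (\<lambda>i. \<iota> (lcoeff a i) * e i)"
    and perturbed_add: "perturbed e (a + b) = perturbed e a + perturbed e b"
    and perturbed_close: "s \<in> {r, 1} \<Longrightarrow> G s (perturbed e a - a) \<le> \<kappa> * G s a"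
    and G_perturbed: "s \<in> {r, 1} \<Longrightarrow> G s (perturbed e a) = G s a"
    and perturbed_surj: "\<exists>z. perturbed e z = b"
proof -
  define d where "d a i = \<iota> (lcoeff a i) * (e i - ymon 1 i)" for a i
  have iota: "\<iota> c * b = ymon c 0 * b" for c b by (simp add: ymon_def)
  have d: "G s (d a i) \<le> \<kappa> * (bnorm (lcoeff a i) * s powi i)" if "s \<in> {r, 1}" for a i s
    using e[OF that, of i] mult_left_mono[OF e[OF that, of i] bn.nonneg[of "lcoeff a i"]]
    unfolding d_def iota G_ymon_mult[OF in_end_points[OF that]] by (simp add: mult_ac)
  have null_d: "null_family (d a)" for a
  proof (rule null_family_dominated[OF lcoeff_in[of a]])
    fix i s assume s: "s \<in> {r, 1}"
    have "\<kappa> * (bnorm (lcoeff a i) * s powi i) \<le> 1 * (bnorm (lcoeff a i) * s powi i)"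
      using \<kappa> powi_pos[OF in_end_points[OF s], of i] by (intro mult_right_mono) (auto simp: bn.nonneg)
    then show "G s (d a i) \<le> bnorm (lcoeff a i) * s powi i" using d[OF s, of a i] by simp
  qed
  have sum: "\<iota> (lcoeff a i) * e i = ymon (lcoeff a i) i + d a i" for a i
    by (simp add: d_def ymon_def algebra_simps)
  show null: "null_family (\<lambda>i. \<iota> (lcoeff a i) * e i)" for a
    unfolding sum by (rule null_family_add(1)[OF null_family_ymon[OF lcoeff_in] null_d])
  have P: "perturbed e a = a + infsum (d a) UNIV" for a
    using null_family_add(2)[OF null_family_ymon[OF lcoeff_in[of a]] null_d[of a]]
    by (simp add: perturbed_def sum ev_eq[symmetric] ev_coeff)
  show add: "perturbed e (a + b) = perturbed e a + perturbed e b" for a b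
    using null_family_add(2)[OF null[of a] null[of b]]
    by (simp add: perturbed_def lcoeff_add algebra_simps)
  show close: "G s (perturbed e a - a) \<le> \<kappa> * G s a" if s: "s \<in> {r, 1}" for a s
  proof -
    have "G s (infsum (d a) UNIV) \<le> \<kappa> * G s a"
    proof (rule infsum_G_le[OF null_d in_end_points[OF s]])
      fix i
      have "\<kappa> * (bnorm (lcoeff a i) * s powi i) \<le> \<kappa> * G s a"
        using \<kappa>(1) lcoeff_le[OF in_end_points[OF s], of a i] by (rule mult_left_mono[rotated])
      then show "G s (d a i) \<le> \<kappa> * G s a" using d[OF s, of a i] by linarith
    qed
    then show ?thesis by (simp add: P)
  qed
  show "G s (perturbed e a) = G s a" if s: "s \<in> {r, 1}" for s
  proof -
    note s' = in_end_points[OF s]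
    interpret g: ultra_seminorm "G s" by (rule G_ultra[OF s'])
    show ?thesis
    proof (cases "a = 0")
      case True
      then show ?thesis using close[OF s, of a] g.nonneg[of "perturbed e a"] by (simp add: g.zero)
    next
      case False
      then have "\<kappa> * G s a < G s a" using \<kappa>(2) G_pos_iff[OF s'] by simp
      then show ?thesis using close[OF s, of a] by (intro g.eq_of_diff_less) linarith
    qed
  qed
  interpret P: additive "perturbed e" by standard (rule add)
  have "\<exists>z. z - (z - perturbed e z) = b"
  proof (rule contraction[OF _ \<kappa>])
    fix a s assume s: "s \<in> {r, 1}"
    interpret g: ultra_seminorm "G s" by (rule G_ultra[OF in_end_points[OF s]])
    show "G s (a - perturbed e a) \<le> \<kappa> * G s a" using close[OF s, of a] g.diff_commute by simp
  qed (simp add: P.diff)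
  then show "\<exists>z. perturbed e z = b" by simp
qed

end

lemma (in annulus) geometric_limit:
  assumes \<rho>: "0 \<le> \<rho>" "\<rho> < 1"
    and step: "\<And>s k. s \<in> {r, 1} \<Longrightarrow> G s (h (Suc k) - h k) \<le> \<rho> ^ Suc k"
  obtains l where "\<And>s k. s \<in> {r, 1} \<Longrightarrow> G s (l - h k) \<le> \<rho> ^ Suc k"
proof -
  have diff: "G s (h (k + m) - h k) \<le> \<rho> ^ Suc k" if s: "s \<in> {r, 1}" for s k m
  proof -
    interpret g: ultra_seminorm "G s" by (rule G_ultra[OF in_end_points[OF s]])
    show ?thesis
    proof (induction m)
      case 0
      show ?case using \<rho> by (simp add: g.zero)
    next
      case (Suc m)
      have "\<rho> ^ Suc (k + m) \<le> \<rho> ^ Suc k" using \<rho> by (intro power_decreasing) auto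
      then have "G s (h (Suc (k + m)) - h (k + m)) \<le> \<rho> ^ Suc k" using step[OF s, of "k + m"] by linarith
      from g.add_le[OF this Suc] show ?case by simp
    qed
  qed
  have "Cauchy h"
  proof (rule metric_CauchyI)
    fix e :: real assume e: "e > 0"
    have "(\<lambda>k. CC * \<rho> ^ k) \<longlonglongrightarrow> CC * 0" using \<rho> by (intro tendsto_intros LIMSEQ_realpow_zero)
    then have "eventually (\<lambda>k. CC * \<rho> ^ k < e) sequentially" using order_tendstoD(2) e by fastforce
    then obtain N where N: "CC * \<rho> ^ N < e" by (auto simp: eventually_sequentially)
    have close: "bnorm (h n - h N) < e" if "n \<ge> N" for n
    proof -
      have "bnorm (h (N + (n - N)) - h N) \<le> CC * \<rho> ^ Suc N"
        using diff by (rule bnorm_le_of_G_le)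
      also have "\<dots> \<le> CC * \<rho> ^ N" using \<rho> CC_pos by (intro mult_left_mono power_decreasing) auto
      finally show ?thesis using that N by simp
    qed
    have "dist (h m) (h n) < e" if "m \<ge> N" "n \<ge> N" for m n
      using bn.diff_less[OF close[OF that(1)] close[OF that(2)]] by (simp add: dist_bnorm)
    then show "\<exists>N. \<forall>m\<ge>N. \<forall>n\<ge>N. dist (h m) (h n) < e" by blast
  qed
  then obtain l where l: "h \<longlonglongrightarrow> l" using Cauchy_convergent_iff convergent_def by blast
  show thesis
  proof (rule that[of l])
    fix s k assume s: "s \<in> {r, 1}"
    interpret g: ultra_seminorm "G s" by (rule G_ultra[OF in_end_points[OF s]])
    show "G s (l - h k) \<le> \<rho> ^ Suc k"
    proof (rule field_le_epsilon)
      fix e :: real assume e: "e > 0"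
      then obtain N where N: "\<And>n. n \<ge> N \<Longrightarrow> dist (h n) l < e / CC"
        using l CC_pos unfolding lim_sequentially by (metis divide_pos_pos)
      let ?n = "k + N"
      have "CC * bnorm (l - h ?n) \<le> e"
        using N[of ?n] CC_pos by (simp add: dist_bnorm bn.diff_commute[of l] field_simps)
      then have "G s (l - h ?n) \<le> \<rho> ^ Suc k + e"
        using G_le_bnorm[OF in_end_points[OF s], of "l - h ?n"] \<rho> by (smt (verit) zero_le_power)
      moreover have "G s (h ?n - h k) \<le> \<rho> ^ Suc k + e" using diff[OF s, of k N] e by linarith
      ultimately show "G s (l - h k) \<le> \<rho> ^ Suc k + e" using g.add_le[of "l - h ?n" _ "h ?n - h k"] by simp
    qed
  qed
qed

lemma (in annulus) G_of_int_mult: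
  assumes "s \<in> {r..1}"
  shows "G s (of_int k * a) = bnorm (of_int k :: 'k) * G s a"
  using G_ymon_mult[OF assms, of "of_int k" 0 a] by (simp add: ymon_def ring_hom_type_of_int[OF hom])

lemma (in annulus) G_of_nat_mult: "s \<in> {r..1} \<Longrightarrow> G s (of_nat k * a) = bnorm (of_nat k :: 'k) * G s a"
  using G_of_int_mult[of s "int k" a] by simp

lemma (in annulus) G_of_nat: "s \<in> {r..1} \<Longrightarrow> G s (of_nat k) = bnorm (of_nat k :: 'k)"
  using G_of_nat_mult[of s k 1] by (simp add: G_one)

lemma (in annulus) unit_factor:
  assumes "u dvd 1"
  obtains m c t \<kappa> where "c \<noteq> 0" "u = ymon c m * t" "t dvd 1" "\<kappa> < 1"
    "\<And>s. s \<in> {r, 1} \<Longrightarrow> G s (t - 1) \<le> \<kappa>"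
proof -
  obtain v where "u * v = 1" using assms by (metis dvdE)
  then obtain m where m: "\<And>s i. s \<in> {r..1} \<Longrightarrow> i \<noteq> m \<Longrightarrow>
    bnorm (lcoeff u i) * s powi i < bnorm (lcoeff u m) * s powi m" using unit_dominant by blast
  define c where "c = lcoeff u m"
  define t where "t = ymon (inverse c) (- m) * u"
  have c: "c \<noteq> 0" using dominant_factor(1)[OF m end_points(2)] end_points(2) by (simp add: c_def)
  have t1: "G s (t - 1) < 1" if "s \<in> {r..1}" for s
    using dominant_factor(3)[OF m that] that by (simp add: t_def c_def)
  show thesis
  proof (rule that[OF c])
    show "u = ymon c m * t" using ymon_inverse[OF c, of m] by (simp add: t_def flip: mult.assoc)
    show "t dvd 1" using one_plus_dvd[of "t - 1"] t1 in_end_points by simp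
    show "max (G r (t - 1)) (G 1 (t - 1)) < 1" using t1 end_points by simp
  qed auto
qed


section \<open>Change of coordinate\<close>

context annulus
begin

lemma close_powi:
  assumes t: "t dvd 1" "\<And>s. s \<in> {r, 1} \<Longrightarrow> G s (t - 1) \<le> \<kappa>" "\<kappa> < 1" and s: "s \<in> {r, 1}"
  shows "G s (unit_powi t i - 1) \<le> \<kappa>"
proof -
  interpret g: ultra_seminorm "G s" by (rule G_ultra[OF in_end_points[OF s]])
  have inv: "G s (ring_inverse t - 1) \<le> \<kappa>"
    using g.close_one_inverse[OF ring_inverse_mult[OF t(1)] t(2)[OF s] t(3)] .
  show ?thesis
    unfolding unit_powi_def using g.close_one_power[OF t(2)[OF s]] g.close_one_power[OF inv] t(3)
    by simp
qed

lemma unit_powi_ymon: "c \<noteq> 0 \<Longrightarrow> unit_powi (ymon c m) i = ymon (c powi i) (m * i)"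
  by (rule unit_powi_unique[OF ymon_dvd, symmetric])
    (simp_all add: ymon_mult power_int_add_1 algebra_simps)

lemma G_close_mult:
  assumes "s \<in> {r..1}" "G s (t - 1) < 1"
  shows "G s (ymon c m * t) = bnorm c * s powi m"
proof -
  interpret g: ultra_seminorm "G s" by (rule G_ultra[OF assms(1)])
  have "G s t = 1" using g.eq_of_diff_less[of t 1] assms(2) by (simp add: g.one)
  then show ?thesis by (simp add: G_ymon_mult[OF assms(1)])
qed

lemma coordinate_change:
  assumes \<gamma>: "bnorm \<gamma> = 1" and t: "t dvd 1" "\<And>s. s \<in> {r, 1} \<Longrightarrow> G s (t - 1) \<le> \<kappa>" "\<kappa> < 1"
    and z: "z = ymon \<gamma> 1 * t"
  shows "annulus \<iota> r z" and "s \<in> {r, 1} \<Longrightarrow> gauss_point \<iota> r z s a = G s a"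
proof -
  have \<gamma>0: "\<gamma> \<noteq> 0" using \<gamma> by auto
  have \<kappa>0: "0 \<le> \<kappa>" using t(2)[of 1] G_nonneg[OF end_points(2), of "t - 1"] by simp
  have z_unit: "z dvd 1" using mult_dvd_mono[OF ymon_dvd[OF \<gamma>0, of 1] t(1)] by (simp add: z)
  define e where "e i = ymon 1 i * unit_powi t i" for i
  have powi: "unit_powi z i = \<iota> (\<gamma> powi i) * e i" for i
    unfolding z unit_powi_mult_distrib[OF ymon_dvd[OF \<gamma>0] t(1)] unit_powi_ymon[OF \<gamma>0]
    by (simp add: e_def ymon_def mult.assoc)
  have e: "G s (e i - ymon 1 i) \<le> \<kappa> * s powi i" if s: "s \<in> {r, 1}" for i s
  proof -
    have "e i - ymon 1 i = ymon 1 i * (unit_powi t i - 1)" by (simp add: e_def algebra_simps)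
    then have "G s (e i - ymon 1 i) = s powi i * G s (unit_powi t i - 1)"
      by (simp only: G_ymon_mult[OF in_end_points[OF s]] bnorm_one mult_1)
    then show ?thesis
      using close_powi[OF t s, of i] powi_pos[OF in_end_points[OF s], of i] by (simp add: mult.commute)
  qed
  have pert_add: "perturbed e (a + b) = perturbed e a + perturbed e b" for a b
    using perturbed_add[OF \<kappa>0 t(3) e] by blast
  have pert_G: "G s (perturbed e a) = G s a" if "s \<in> {r, 1}" for a s
    using G_perturbed[OF \<kappa>0 t(3) e that] by blast
  have pert_surj: "\<exists>a. perturbed e a = b" for b
    using perturbed_surj[OF \<kappa>0 t(3) e] by blast
  have bc: "bnorm (c i * \<gamma> powi i) = bnorm (c i)" "bnorm (c i * \<gamma> powi (- i)) = bnorm (c i)" for c i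
    by (simp_all add: bnorm_mult bnorm_power_int \<gamma>)
  define tw where "tw c = (\<lambda>i. c i * \<gamma> powi i)" for c :: "int \<Rightarrow> 'k"
  have tw: "tw c \<in> laurent_algebra r" if "c \<in> laurent_algebra r" for c
    unfolding tw_def by (rule laurent_algebra_dominated[OF that r_pos, of _ 1]) (simp add: bc)
  have tw_norm: "gauss_norm s (tw c) = gauss_norm s c" "laurent_norm r (tw c) = laurent_norm r c" for s c
    by (simp_all add: gauss_norm_def laurent_norm_def tw_def bc)
  have eval: "laurent_eval \<iota> z c = perturbed e (ev (tw c))" if "c \<in> laurent_algebra r" for c
    using lcoeff_eqI[OF tw[OF that] refl]
    by (simp add: laurent_eval_def perturbed_def powi tw_def mult.assoc)
  have G_eval: "G s (laurent_eval \<iota> z c) = gauss_norm s c" if "c \<in> laurent_algebra r" "s \<in> {r, 1}" for c s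
    using pert_G[OF that(2), of "ev (tw c)"] lcoeff_eqI[OF tw[OF that(1)] refl]
    by (simp add: eval[OF that(1)] gauss_point_eq tw_norm)
  have inj: "inj_on (laurent_eval \<iota> z) (laurent_algebra r)"
  proof (rule inj_onI)
    fix c d assume cd: "c \<in> laurent_algebra r" "d \<in> laurent_algebra r" "laurent_eval \<iota> z c = laurent_eval \<iota> z d"
    interpret P: additive "perturbed e" by standard (rule pert_add)
    have "perturbed e (ev (tw c) - ev (tw d)) = 0" using cd by (simp add: eval P.diff)
    then have "G 1 (ev (tw c) - ev (tw d)) = 0"
      using pert_G[of 1 "ev (tw c) - ev (tw d)"] G_zero[OF end_points(2)] by simp
    then have "ev (tw c) = ev (tw d)" using G_eq_0_iff[OF end_points(2)] by simp
    then have "tw c = tw d" using lcoeff_eqI[OF tw[OF cd(1)] refl] lcoeff_eqI[OF tw[OF cd(2)] refl] by metis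
    then have "c i * \<gamma> powi i = d i * \<gamma> powi i" for i unfolding tw_def by metis
    then show "c = d" using \<gamma>0 by auto
  qed
  have surj: "laurent_eval \<iota> z ` laurent_algebra r = UNIV"
  proof -
    have "\<exists>c\<in>laurent_algebra r. a = laurent_eval \<iota> z c" for a
    proof -
      obtain b where b: "perturbed e b = a" using pert_surj by blast
      define c where "c i = lcoeff b i * \<gamma> powi (- i)" for i
      have c: "c \<in> laurent_algebra r"
        by (rule laurent_algebra_dominated[OF lcoeff_in[of b] r_pos, of _ 1]) (simp add: c_def bc)
      have "tw c = lcoeff b" using \<gamma>0 by (simp add: tw_def c_def power_int_minus fun_eq_iff)
      then have "laurent_eval \<iota> z c = a" using b by (simp add: eval[OF c] ev_coeff)
      with c show ?thesis by blast
    qed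
    then show ?thesis by blast
  qed
  have "bnorm (laurent_eval \<iota> z c) \<le> CC * laurent_norm r c \<and> laurent_norm r c \<le> CC * bnorm (laurent_eval \<iota> z c)"
    if c: "c \<in> laurent_algebra r" for c
    using bnorm_le_CC[of "laurent_eval \<iota> z c"] max_le_CC[of "laurent_eval \<iota> z c"]
    by (simp add: G_eval[OF c] laurent_norm_eq[OF c r_pos r_le])
  then have mc: "monic_coordinate \<iota> r z"
    using z_unit inj surj unfolding monic_coordinate_def bij_betw_def by blast
  then show "annulus \<iota> r z" using algebra r_pos r_le by unfold_locales
  then interpret Z: annulus \<iota> r z .
  show "gauss_point \<iota> r z s a = G s a" if "s \<in> {r, 1}"
    using G_eval[OF Z.lcoeff_in that, of a] by (simp add: Z.gauss_point_eq Z.ev_coeff)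
qed

lemma coordinate_inversion:
  assumes \<gamma>: "bnorm \<gamma> = r"
  shows "annulus \<iota> r (ymon \<gamma> (- 1))"
proof -
  let ?z = "ymon \<gamma> (- 1)"
  have \<gamma>0: "\<gamma> \<noteq> 0" using \<gamma> r_pos by auto
  define tw where "tw c = (\<lambda>i. c (- i) * \<gamma> powi (- i))" for c :: "int \<Rightarrow> 'k"
  have tw_term: "bnorm (tw c i) * max 1 (r powi i) = bnorm (c (- i)) * max 1 (r powi (- i))" for c i
  proof -
    have pos: "0 < r powi (- i)" using r_pos by simp
    have "r powi (- i) * max 1 (r powi i) = max (r powi (- i)) (r powi (- i) * r powi i)"
      using pos by (simp add: max_mult_distrib_left)
    also have "r powi (- i) * r powi i = 1" using r_pos by (simp flip: power_int_add)
    finally show ?thesis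
      by (simp only: tw_def bnorm_mult bnorm_power_int \<gamma> mult.assoc max.commute)
  qed
  have tw_tw: "tw (\<lambda>i. c (- i) * \<gamma> powi (- i)) = c" for c
    using \<gamma>0 by (simp add: tw_def fun_eq_iff power_int_minus)
  have tw: "tw c \<in> laurent_algebra r" if "c \<in> laurent_algebra r" for c
    unfolding laurent_algebra_iff[OF r_pos]
  proof (intro allI impI)
    fix e :: real assume "e > 0"
    have "{i. e \<le> bnorm (tw c i) * max 1 (r powi i)} = uminus ` {i. e \<le> bnorm (c i) * max 1 (r powi i)}"
      unfolding tw_term by (auto intro!: image_eqI[of _ uminus "- _"])
    then show "finite {i. e \<le> bnorm (tw c i) * max 1 (r powi i)}"
      using that \<open>e > 0\<close> by (simp add: laurent_algebra_iff[OF r_pos])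
  qed
  have tw_norm: "laurent_norm r (tw c) = laurent_norm r c" for c
  proof -
    have "range (\<lambda>i. bnorm (c (- i)) * max 1 (r powi (- i))) = range (\<lambda>i. bnorm (c i) * max 1 (r powi i))"
      by (auto intro: image_eqI[of _ _ "- _"])
    then show ?thesis by (simp add: laurent_norm_def tw_term)
  qed
  have eval: "laurent_eval \<iota> ?z c = ev (tw c)" for c
  proof -
    have "laurent_eval \<iota> ?z c = infsum (\<lambda>i. ymon (c i * \<gamma> powi i) (- i)) UNIV"
      unfolding laurent_eval_def unit_powi_ymon[OF \<gamma>0] by (simp add: ymon_def mult.assoc)
    also have "\<dots> = infsum (\<lambda>j. ymon (tw c j) j) UNIV"
      using infsum_reindex_bij_betw[of uminus UNIV UNIV "\<lambda>i. ymon (c i * \<gamma> powi i) (- i)"]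
      by (simp add: tw_def bij_uminus)
    finally show ?thesis by (simp add: ev_eq)
  qed
  have ev: "bij_betw ev (laurent_algebra r) UNIV" using coordinate by (simp add: monic_coordinate_def)
  have "bij_betw tw (laurent_algebra r) (laurent_algebra r)"
    by (rule bij_betw_byWitness[of _ tw]) (use tw_tw tw in \<open>auto simp: tw_def\<close>)
  from bij_betw_trans[OF this ev] have "bij_betw (laurent_eval \<iota> ?z) (laurent_algebra r) UNIV"
    by (simp add: comp_def eval[abs_def])
  moreover have "bnorm (laurent_eval \<iota> ?z c) \<le> CC * laurent_norm r c \<and> laurent_norm r c \<le> CC * bnorm (laurent_eval \<iota> ?z c)"
    if c: "c \<in> laurent_algebra r" for c
    using bnorm_le_CC[of "laurent_eval \<iota> ?z c"] max_le_CC[of "laurent_eval \<iota> ?z c"]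
      laurent_norm_eq[OF tw[OF c] r_pos r_le]
    by (simp add: eval gauss_point_eq lcoeff_eqI[OF tw[OF c] refl] tw_norm)
  ultimately have "monic_coordinate \<iota> r ?z"
    using ymon_dvd[OF \<gamma>0] unfolding monic_coordinate_def by blast
  then show ?thesis using algebra r_pos r_le by unfold_locales
qed

lemma coordinate_minus_const_not_unit:
  assumes "r \<le> bnorm \<alpha>" "bnorm \<alpha> \<le> 1"
  shows "\<not> (y - \<iota> \<alpha>) dvd 1"
proof
  assume "(y - \<iota> \<alpha>) dvd 1"
  then obtain v where "(y - \<iota> \<alpha>) * v = 1" by (metis dvdE)
  then obtain n where n: "\<And>s i. s \<in> {r..1} \<Longrightarrow> i \<noteq> n \<Longrightarrow>
    bnorm (lcoeff (y - \<iota> \<alpha>) i) * s powi i < bnorm (lcoeff (y - \<iota> \<alpha>) n) * s powi n"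
    using unit_dominant by metis
  have c: "lcoeff (y - \<iota> \<alpha>) i = (if i = 1 then 1 else if i = 0 then - \<alpha> else 0)" for i
  proof -
    have "y - \<iota> \<alpha> = ymon 1 1 - ymon \<alpha> 0" by (simp add: ymon_def)
    then show ?thesis by (simp only: lcoeff_diff lcoeff_ymon) simp
  qed
  have s: "bnorm \<alpha> \<in> {r..1}" using assms by simp
  show False
    using n[OF s, of 0] n[OF s, of 1] s_pos[OF s]
    by (cases "n = 0"; cases "n = 1") (auto simp: c bn.minus bnorm_one)
qed

end


section \<open>Finite modules\<close>

lemma nakayama_aux:
  fixes f :: "'b::comm_ring_1 \<Rightarrow> 'a::comm_ring_1" and g :: "nat \<Rightarrow> 'a"
  assumes hom: "ring_hom_type f"
    and "\<And>i. i < n \<Longrightarrow> \<exists>c. g i = f b * (\<Sum>j<n. f (c j) * g j)"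
  shows "\<exists>d. \<forall>i<n. f (1 + b * d) * g i = 0"
  using assms(2)
proof (induction n)
  case (Suc n)
  have f: "f (a + c) = f a + f c" "f (a * c) = f a * f c" "f 1 = 1" "f (a - c) = f a - f c" for a c
    using hom ring_hom_type_diff[OF hom] by (auto simp: ring_hom_type_def)
  obtain c where c: "g n = f b * (\<Sum>j<Suc n. f (c j) * g j)" using Suc.prems[of n] by auto
  define e where "e = 1 - b * c n"
  have e: "f e * g n = f b * (\<Sum>j<n. f (c j) * g j)"
    using c by (simp add: e_def f algebra_simps)
  have "\<exists>c. g i = f b * (\<Sum>j<n. f (c j) * g j)" if i: "i < n" for i
  proof -
    obtain c' where c': "g i = f b * (\<Sum>j<Suc n. f (c' j) * g j)" using Suc.prems[OF less_SucI[OF i]] by blast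
    define k where "k j = e * c' j + c' n * b * c j + c n * (if j = i then 1 else 0)" for j
    have "f e * g i = f e * (f b * ((\<Sum>j<n. f (c' j) * g j) + f (c' n) * g n))"
      using c' by simp
    also have "\<dots> = f b * (f e * (\<Sum>j<n. f (c' j) * g j) + f (c' n) * (f e * g n))"
      by (simp only: distrib_left mult_ac)
    also have "\<dots> = f b * (f e * (\<Sum>j<n. f (c' j) * g j) + f (c' n) * (f b * (\<Sum>j<n. f (c j) * g j)))"
      by (simp only: e)
    also have "f e * (\<Sum>j<n. f (c' j) * g j) + f (c' n) * (f b * (\<Sum>j<n. f (c j) * g j))
        = (\<Sum>j<n. f (e * c' j + c' n * b * c j) * g j)"
      by (simp only: f(1,2) sum_distrib_left sum.distrib distrib_right mult.assoc)
    finally have *: "f e * g i = f b * (\<Sum>j<n. f (e * c' j + c' n * b * c j) * g j)" .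
    have "g i = f e * g i + f b * (f (c n) * g i)" by (simp add: e_def f algebra_simps)
    then have "g i = f b * (\<Sum>j<n. f (e * c' j + c' n * b * c j) * g j) + f b * (f (c n) * g i)"
      unfolding * .
    also have "f (c n) * g i = (\<Sum>j<n. f (c n * (if j = i then 1 else 0)) * g j)"
    proof -
      have "(\<Sum>j<n. f (c n * (if j = i then 1 else 0)) * g j) = (\<Sum>j<n. if j = i then f (c n) * g i else 0)"
        using ring_hom_type_diff(1)[OF hom] by (intro sum.cong) auto
      then show ?thesis using i by simp
    qed
    finally have "g i = f b * (\<Sum>j<n. f (k j) * g j)"
      by (simp only: k_def f(1)[of "e * c' _ + c' n * b * c _"] sum.distrib distrib_right distrib_left)
    then show ?thesis by blast
  qed
  then obtain d where d: "\<And>i. i < n \<Longrightarrow> f (1 + b * d) * g i = 0" using Suc.IH by blast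
  define d' where "d' = d - c n - b * d * c n"
  have d': "1 + b * d' = (1 + b * d) * e" by (simp add: d'_def e_def algebra_simps)
  have "f (1 + b * d') * g i = 0" if "i < Suc n" for i
  proof (cases "i = n")
    case True
    have "f (1 + b * d') * g n = f (1 + b * d) * (f e * g n)" by (simp add: d' f mult.assoc)
    also have "\<dots> = f b * (\<Sum>j<n. f (c j) * (f (1 + b * d) * g j))"
      unfolding e by (simp only: sum_distrib_left mult_ac)
    finally show ?thesis using d True by simp
  next
    case False
    then have "f (1 + b * d) * g i = 0" using d that by simp
    moreover have "f (1 + b * d') * g i = f e * (f (1 + b * d) * g i)" by (simp only: d' f(2) mult_ac)
    ultimately show ?thesis by simp
  qed
  then show ?case by blast
qed simp

lemma module_scale_module: "ring_hom_type f \<Longrightarrow> module (module_scale f)"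
  by standard (auto simp: module_scale_def ring_hom_type_def algebra_simps)

lemma finite_hom_reflects_units:
  fixes f :: "'b::comm_ring_1 \<Rightarrow> 'a::comm_ring_1"
  assumes hom: "ring_hom_type f" and fin: "finite_hom f" and inj: "\<And>b. f b = 0 \<Longrightarrow> b = 0"
    and unit: "f b dvd 1"
  shows "b dvd 1"
proof -
  interpret module "module_scale f" using hom by (rule module_scale_module)
  obtain S where S: "finite S" "span S = UNIV" using fin by (auto simp: finite_hom_def)
  obtain n and g :: "nat \<Rightarrow> 'a" where g: "S = g ` {i. i < n}" "inj_on g {i. i < n}"
    using finite_imp_nat_seg_image_inj_on[OF S(1)] by metis
  have gen: "\<exists>c. a = (\<Sum>j<n. f (c j) * g j)" for a
  proof -
    have "a \<in> range (\<lambda>u. \<Sum>v\<in>S. module_scale f (u v) v)" using S span_finite by blast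
    then obtain u where "a = (\<Sum>v\<in>S. f (u v) * v)" by (auto simp: module_scale_def)
    also have "\<dots> = (\<Sum>j<n. f (u (g j)) * g j)"
      unfolding g(1) lessThan_def by (subst sum.reindex[OF g(2)]) simp
    finally show ?thesis by (intro exI[of _ "\<lambda>j. u (g j)"])
  qed
  obtain w where w: "f b * w = 1" using unit by (metis dvdE)
  have "\<exists>c. g i = f b * (\<Sum>j<n. f (c j) * g j)" for i
    using gen[of "w * g i"] w by (metis mult.assoc mult_1)
  then obtain d where d: "\<And>i. i < n \<Longrightarrow> f (1 + b * d) * g i = 0"
    using nakayama_aux[OF hom, of n g b] by blast
  obtain c where c: "1 = (\<Sum>j<n. f (c j) * g j)" using gen by blast
  have "f (1 + b * d) = f (1 + b * d) * (\<Sum>j<n. f (c j) * g j)" by (simp flip: c)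
  also have "\<dots> = (\<Sum>j<n. f (c j) * (f (1 + b * d) * g j))" by (simp add: sum_distrib_left mult_ac)
  also have "\<dots> = 0" using d by simp
  finally have "1 + b * d = 0" by (rule inj)
  then have "b * (- d) = 1" by (simp add: add_eq_0_iff)
  then show ?thesis by (metis dvd_triv_left)
qed

lemma homogeneous_system_solvable:
  fixes A :: "nat \<Rightarrow> 'j \<Rightarrow> 'b::comm_ring_1"
  assumes dom: "\<And>a b::'b. a * b = 0 \<Longrightarrow> a = 0 \<or> b = 0"
    and "finite S" "m < card S"
  shows "\<exists>u. (\<exists>v\<in>S. u v \<noteq> 0) \<and> (\<forall>i<m. (\<Sum>v\<in>S. u v * A i v) = 0)"
  using assms(2,3)
proof (induction m arbitrary: S A)
  case 0
  then obtain v where "v \<in> S" by fastforce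
  then show ?case by (intro exI[of _ "\<lambda>_. 1"]) auto
next
  case (Suc m)
  show ?case
  proof (cases "\<forall>v\<in>S. A m v = 0")
    case True
    obtain u where u: "\<exists>v\<in>S. u v \<noteq> 0" "\<And>i. i < m \<Longrightarrow> (\<Sum>v\<in>S. u v * A i v) = 0"
      using Suc.IH[OF Suc.prems(1), of A] Suc.prems(2) by auto
    have "(\<Sum>v\<in>S. u v * A i v) = 0" if "i < Suc m" for i
      using u(2)[of i] that True by (cases "i = m") auto
    then show ?thesis using u(1) by blast
  next
    case False
    then obtain w where w: "w \<in> S" "A m w \<noteq> 0" by auto
    define T where "T = S - {w}"
    have T: "finite T" "m < card T" "w \<notin> T" "S = insert w T" using Suc.prems w by (auto simp: T_def)
    define B where "B i v = A m w * A i v - A m v * A i w" for i v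
    obtain u where u: "\<exists>v\<in>T. u v \<noteq> 0" "\<And>i. i < m \<Longrightarrow> (\<Sum>v\<in>T. u v * B i v) = 0"
      using Suc.IH[OF T(1,2), of B] by blast
    define u' where "u' v = (if v = w then - (\<Sum>v\<in>T. u v * A m v) else A m w * u v)" for v
    have sum: "(\<Sum>v\<in>S. u' v * A i v) = (\<Sum>v\<in>T. u v * B i v)" for i
    proof -
      have "(\<Sum>v\<in>T. u' v * A i v) = (\<Sum>v\<in>T. A m w * u v * A i v)"
        using T(3) by (intro sum.cong) (auto simp: u'_def)
      then have "(\<Sum>v\<in>S. u' v * A i v)
          = - (\<Sum>v\<in>T. u v * A m v) * A i w + (\<Sum>v\<in>T. A m w * u v * A i v)"
        using T(1,3,4) by (simp add: u'_def)
      then show ?thesis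
        by (simp add: B_def algebra_simps sum_distrib_left sum_distrib_right sum_subtractf)
    qed
    have "(\<Sum>v\<in>S. u' v * A i v) = 0" if "i < Suc m" for i
      using u(2)[of i] that by (cases "i = m") (auto simp: sum B_def)
    moreover obtain v where "v \<in> T" "u v \<noteq> 0" using u(1) by blast
    then have "v \<in> S" "u' v \<noteq> 0" using T(3,4) dom[of "A m w" "u v"] w(2) by (auto simp: u'_def)
    ultimately show ?thesis by blast
  qed
qed


section \<open>Maps of annuli\<close>

lemma unit_away_from_one: "\<exists>\<beta>::'k::alg_closed_valued_field. bnorm \<beta> = 1 \<and> bnorm (\<beta> - 1) = 1"
proof -
  have "degree [:- 1, - 1, 1 :: 'k:] > 0" by simp
  then obtain \<beta> :: 'k where "poly [:- 1, - 1, 1:] \<beta> = 0" using alg_closed_imp_poly_has_root by blast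
  then have \<beta>: "\<beta> * (\<beta> - 1) = 1" by (simp add: algebra_simps)
  then have sq: "\<beta> * \<beta> = \<beta> + 1" by (simp add: algebra_simps)
  have prod: "bnorm \<beta> * bnorm (\<beta> - 1) = 1" using \<beta> by (simp flip: bnorm_mult add: bnorm_one)
  have le: "bnorm \<beta> \<le> 1"
  proof (rule ccontr)
    assume *: "\<not> bnorm \<beta> \<le> 1"
    then have "bnorm (\<beta> + 1) = bnorm \<beta>" by (intro bn.add_eq) (simp add: bnorm_one)
    then have "bnorm \<beta> * bnorm \<beta> = bnorm \<beta>" using sq by (simp flip: bnorm_mult)
    with * show False by auto
  qed
  then have "bnorm (\<beta> - 1) \<le> 1" by (intro bn.diff_le) (simp_all add: bnorm_one)
  have "bnorm \<beta> = 1"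
  proof (rule ccontr)
    assume "bnorm \<beta> \<noteq> 1"
    then have "bnorm \<beta> * bnorm (\<beta> - 1) < 1"
      using le \<open>bnorm (\<beta> - 1) \<le> 1\<close> bn.nonneg[of "\<beta> - 1"]
      by (smt (verit) bn.nonneg mult_left_le)
    with prod show False by simp
  qed
  with prod show ?thesis by auto
qed

lemma powers_bounded_imp_le_1:
  fixes a K :: real
  assumes "\<And>n. a ^ n \<le> K"
  shows "a \<le> 1"
  using assms real_arch_pow[of a K] by (meson not_le)

locale annulus_map = X: annulus \<iota>X rX x + Y: annulus \<iota>Y rY y
  for \<iota>X :: "'k::alg_closed_valued_field \<Rightarrow> 'b::nonarch_banach_ring" and rX :: real and x :: 'b
    and \<iota>Y :: "'k \<Rightarrow> 'a::nonarch_banach_ring" and rY :: real and y :: 'a +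
  fixes f :: "'b \<Rightarrow> 'a"
  assumes bounded_hom: "bounded_algebra_hom \<iota>X \<iota>Y f"
begin

lemma f_hom: "ring_hom_type f"
  using bounded_hom by (simp add: bounded_algebra_hom_def)

lemma f_simps: "f (a + b) = f a + f b" "f (a * b) = f a * f b" "f 1 = 1" "f 0 = 0"
  "f (a - b) = f a - f b" "f (- a) = - f a" "f (\<iota>X c) = \<iota>Y c"
  using bounded_hom ring_hom_type_diff[OF f_hom]
  by (auto simp: bounded_algebra_hom_def ring_hom_type_def)

lemma f_bound: "\<exists>C>0. \<forall>b. bnorm (f b) \<le> C * bnorm b"
proof -
  obtain C where C: "\<And>b. bnorm (f b) \<le> C * bnorm b" using bounded_hom by (auto simp: bounded_algebra_hom_def)
  have "bnorm (f b) \<le> (\<bar>C\<bar> + 1) * bnorm b" for b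
    using C[of b] mult_right_mono[OF _ bn.nonneg, of C "\<bar>C\<bar> + 1" b] by linarith
  then show ?thesis by (intro exI[of _ "\<bar>C\<bar> + 1"]) auto
qed

lemma f_x_unit: "f x dvd 1"
  by (rule ring_hom_type_dvd[OF f_hom X.unit_y])

lemma f_ymon: "f (X.ymon c i) = \<iota>Y c * unit_powi (f x) i"
  by (simp add: X.ymon_def f_simps ring_hom_type_unit_powi[OF f_hom X.unit_y])

lemma f_eq_infsum: "f b = infsum (\<lambda>q. \<iota>Y (X.lcoeff b q) * unit_powi (f x) q) UNIV"
proof -
  obtain C where "\<And>b. bnorm (f b) \<le> C * bnorm b" using f_bound by blast
  from null_family_bounded_additive(2)[OF X.null_family_ymon[OF X.lcoeff_in[of b]] f_simps(1) this]
  show ?thesis by (simp add: f_ymon X.ev_eq[symmetric] X.ev_coeff)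
qed

context
  fixes m :: int and c :: 'k and t :: 'a and \<kappa> :: real
  assumes c: "c \<noteq> 0" and fx: "f x = Y.ymon c m * t" and t: "t dvd 1" and \<kappa>: "\<kappa> < 1"
    and t1: "\<And>s. s \<in> {rY, 1} \<Longrightarrow> Y.G s (t - 1) \<le> \<kappa>"
begin

lemma powi_fx: "unit_powi (f x) i = Y.ymon (c powi i) (m * i) * unit_powi t i"
  unfolding fx unit_powi_mult_distrib[OF Y.ymon_dvd[OF c] t] Y.unit_powi_ymon[OF c] ..

lemma G_powi_fx: "s \<in> {rY, 1} \<Longrightarrow> Y.G s (unit_powi (f x) i) = (bnorm c * s powi m) powi i"
  using Y.G_close_mult[OF Y.in_end_points, of s "unit_powi t i" "c powi i" "m * i"]
    Y.close_powi[OF t t1 \<kappa>, of s i] \<kappa>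
  by (simp add: powi_fx bnorm_power_int power_int_mult_distrib power_int_mult)

lemma radius_bounds:
  assumes s: "s \<in> {rY, 1}"
  shows "rX \<le> bnorm c * s powi m" "bnorm c * s powi m \<le> 1"
proof -
  let ?\<sigma> = "bnorm c * s powi m"
  have \<sigma>: "?\<sigma> > 0" using c Y.powi_pos[OF Y.in_end_points[OF s]] by (simp add: bnorm_pos_iff)
  obtain C where C: "C > 0" "\<And>b. bnorm (f b) \<le> C * bnorm b" using f_bound by blast
  define K where "K = Y.CC * (C * X.CC)"
  have K: "?\<sigma> powi i \<le> K * max 1 (rX powi i)" for i
  proof -
    have "?\<sigma> powi i = Y.G s (f (X.ymon 1 i))" by (simp add: G_powi_fx[OF s] f_ymon)
    also have "\<dots> \<le> Y.CC * bnorm (f (X.ymon 1 i))" by (rule Y.G_le_bnorm[OF Y.in_end_points[OF s]])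
    also have "\<dots> \<le> Y.CC * (C * bnorm (X.ymon 1 i))" using C Y.CC_pos by (intro mult_left_mono) auto
    also have "\<dots> \<le> Y.CC * (C * (X.CC * (bnorm (1::'k) * max 1 (rX powi i))))"
      using C Y.CC_pos X.bnorm_ymon_le by (intro mult_left_mono) auto
    finally show ?thesis by (simp add: K_def bnorm_one mult.assoc)
  qed
  show "?\<sigma> \<le> 1"
  proof (rule powers_bounded_imp_le_1)
    fix n
    have "rX ^ n \<le> 1" using X.r_pos X.r_le by (simp add: power_le_one)
    then have "max 1 (rX ^ n) = 1" by simp
    then show "?\<sigma> ^ n \<le> K" using K[of "int n"] by simp
  qed
  have "rX / ?\<sigma> \<le> 1"
  proof (rule powers_bounded_imp_le_1)
    fix n
    have "1 \<le> inverse (rX ^ n)" using X.r_pos X.r_le by (simp add: one_le_inverse_iff power_le_one)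
    then have "inverse (?\<sigma> ^ n) \<le> K * inverse (rX ^ n)"
      using K[of "- int n"] X.r_pos by (simp add: power_int_minus max_def)
    then have "rX ^ n * inverse (?\<sigma> ^ n) \<le> rX ^ n * (K * inverse (rX ^ n))"
      using X.r_pos by (intro mult_left_mono) auto
    also have "\<dots> = K" using X.r_pos by simp
    finally show "(rX / ?\<sigma>) ^ n \<le> K" by (simp only: power_divide divide_inverse[of "_ ^ _"])
  qed
  then show "rX \<le> ?\<sigma>" using \<sigma> by (simp add: pos_divide_le_eq)
qed

lemma winding:
  assumes refl: "\<And>b. f b dvd 1 \<Longrightarrow> b dvd 1" and \<gamma>: "bnorm (\<gamma>::'k) = rX"
  shows "m \<noteq> 0" and "{bnorm c * rY powi m, bnorm c} = {rX, 1}"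
proof -
  have no: False if "(f x - \<iota>Y \<alpha>) dvd 1" "rX \<le> bnorm \<alpha>" "bnorm \<alpha> \<le> 1" for \<alpha>
    using refl[of "x - \<iota>X \<alpha>"] that X.coordinate_minus_const_not_unit by (simp add: f_simps)
  show "m \<noteq> 0"
  proof
    assume m: "m = 0"
    obtain \<beta> :: 'k where \<beta>: "bnorm \<beta> = 1" "bnorm (\<beta> - 1) = 1" using unit_away_from_one by blast
    have \<beta>1: "1 - \<beta> \<noteq> 0" "bnorm (1 - \<beta>) = 1" using \<beta>(2) bn.minus[of "1 - \<beta>"] by auto
    let ?w = "Y.ymon (inverse (1 - \<beta>)) 0 * (t - 1)"
    have "Y.G s ?w < 1" if "s \<in> {rY, 1}" for s
      using t1[OF that] \<kappa> unfolding Y.G_ymon_mult[OF Y.in_end_points[OF that]]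
      by (simp add: bnorm_inverse \<beta>1(2))
    then have "(1 + ?w) dvd 1" by (rule Y.one_plus_dvd)
    moreover have "Y.ymon (c * (1 - \<beta>)) 0 dvd 1" using c \<beta>1 by (intro Y.ymon_dvd) simp
    ultimately have "Y.ymon (c * (1 - \<beta>)) 0 * (1 + ?w) dvd 1 * 1" by (intro mult_dvd_mono)
    also have "Y.ymon (c * (1 - \<beta>)) 0 * (1 + ?w)
        = Y.ymon (c * (1 - \<beta>)) 0 + Y.ymon (c * (1 - \<beta>) * inverse (1 - \<beta>)) 0 * (t - 1)"
      by (simp only: distrib_left mult_1_right mult.assoc[symmetric] Y.ymon_mult add_0)
    also have "c * (1 - \<beta>) * inverse (1 - \<beta>) = c" using \<beta>1(1) by simp
    also have "Y.ymon (c * (1 - \<beta>)) 0 + Y.ymon c 0 * (t - 1) = f x - \<iota>Y (c * \<beta>)"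
      by (simp add: fx m Y.ymon_def algebra_simps)
    finally have "(f x - \<iota>Y (c * \<beta>)) dvd 1" by simp
    then show False
      using no[of "c * \<beta>"] radius_bounds[of 1] by (simp add: bnorm_mult \<beta> m)
  qed
  have Gfx: "Y.G s (f x) = bnorm c * s powi m" if "s \<in> {rY, 1}" for s
    using G_powi_fx[OF that, of 1] by simp
  have "bnorm c * rY powi m = 1 \<or> bnorm c = 1"
  proof (rule ccontr)
    assume "\<not> ?thesis"
    then have "Y.G s (- f x) < 1" if "s \<in> {rY, 1}" for s
    proof -
      interpret g: ultra_seminorm "Y.G s" by (rule Y.G_ultra[OF Y.in_end_points[OF that]])
      show ?thesis
        using \<open>\<not> (bnorm c * rY powi m = 1 \<or> bnorm c = 1)\<close> radius_bounds(2)[OF that] that Gfx[OF that]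
        by (auto simp: g.minus)
    qed
    then have "(1 + - f x) dvd 1" by (rule Y.one_plus_dvd)
    then have "(f x - \<iota>Y 1) dvd 1" using minus_dvd_iff[of "1 - f x" 1] by simp
    then show False using no[of 1] X.r_le by (simp add: bnorm_one)
  qed
  moreover have "bnorm c * rY powi m = rX \<or> bnorm c = rX"
  proof (rule ccontr)
    assume *: "\<not> ?thesis"
    let ?w = "- (\<iota>Y \<gamma> * unit_powi (f x) (- 1))"
    have "Y.G s ?w < 1" if "s \<in> {rY, 1}" for s
    proof -
      interpret g: ultra_seminorm "Y.G s" by (rule Y.G_ultra[OF Y.in_end_points[OF that]])
      have "rX < bnorm c * s powi m" using * radius_bounds(1)[OF that] that by auto
      then have "rX * inverse (bnorm c * s powi m) < 1" using X.r_pos by (simp add: field_simps)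
      moreover have "Y.G s (\<iota>Y \<gamma> * unit_powi (f x) (- 1)) = rX * inverse (bnorm c * s powi m)"
        using Y.G_ymon_mult[OF Y.in_end_points[OF that], of \<gamma> 0 "unit_powi (f x) (- 1)"]
        by (simp add: Y.ymon_def \<gamma> G_powi_fx[OF that] power_int_minus)
      ultimately show ?thesis by (simp add: g.minus)
    qed
    then have "(1 + ?w) dvd 1" by (rule Y.one_plus_dvd)
    then have "f x * (1 + ?w) dvd 1 * 1" by (intro mult_dvd_mono f_x_unit)
    also have "f x * (1 + ?w) = f x - \<iota>Y \<gamma> * (unit_powi (f x) 1 * unit_powi (f x) (- 1))"
      by (simp add: algebra_simps)
    also have "\<dots> = f x - \<iota>Y \<gamma>" using unit_powi_inverse[OF f_x_unit, of 1] by simp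
    finally have "(f x - \<iota>Y \<gamma>) dvd 1" by simp
    then show False using no[of \<gamma>] \<gamma> X.r_le by simp
  qed
  ultimately show "{bnorm c * rY powi m, bnorm c} = {rX, 1}"
    using radius_bounds[of 1] radius_bounds[of rY] by auto
qed

end

end

locale monic_map = annulus_map \<iota>X rX x \<iota>Y rY y f
  for \<iota>X :: "'k::alg_closed_valued_field \<Rightarrow> 'b::nonarch_banach_ring" and rX :: real and x :: 'b
    and \<iota>Y :: "'k \<Rightarrow> 'a::nonarch_banach_ring" and rY :: real and y :: 'a and f :: "'b \<Rightarrow> 'a" +
  fixes M :: nat and t :: 'a and \<kappa> :: real
  assumes fx: "f x = Y.ymon 1 (int M) * t" and t: "t dvd 1" and \<kappa>: "\<kappa> < 1"
    and t1: "\<And>s. s \<in> {rY, 1} \<Longrightarrow> Y.G s (t - 1) \<le> \<kappa>"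
    and M: "M > 0" and rX_eq: "rX = rY ^ M"

lemma (in annulus_map) monic_map_exists:
  assumes refl: "\<And>b. f b dvd 1 \<Longrightarrow> b dvd 1" and \<gamma>: "bnorm (\<gamma>::'k) = rX"
  shows "\<exists>x M t \<kappa>. monic_map \<iota>X rX x \<iota>Y rY y f M t \<kappa>"
proof -
  obtain m c t \<kappa> where c: "c \<noteq> 0" and fx: "f x = Y.ymon c m * t" and t: "t dvd 1" and \<kappa>: "\<kappa> < 1"
    and t1: "\<And>s. s \<in> {rY, 1} \<Longrightarrow> Y.G s (t - 1) \<le> \<kappa>"
    by (rule Y.unit_factor[OF f_x_unit]) (rule that, assumption+)
  note w = winding[OF c fx t \<kappa> t1 refl \<gamma>]
  have rY: "0 < rY" "rY \<le> 1" using Y.r_pos Y.r_le by auto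
  have cpos: "bnorm c > 0" using c by (simp add: bnorm_pos_iff)
  have "\<exists>x1 c1 M t1. annulus \<iota>X rX x1 \<and> bnorm c1 = 1 \<and> M > 0 \<and> rX = rY ^ M \<and> t1 dvd 1 \<and>
     f x1 = Y.ymon c1 (int M) * t1 \<and> (\<forall>s\<in>{rY, 1}. Y.G s (t1 - 1) \<le> \<kappa>)"
  proof (cases "m > 0")
    case True
    then obtain M where M: "m = int M" "M > 0" using zero_less_imp_eq_int by blast
    have "rY ^ M \<le> 1" using rY by (simp add: power_le_one)
    then have "bnorm c * rY ^ M \<le> bnorm c" using cpos by simp
    then have "bnorm c = 1 \<and> rX = rY ^ M" using w(2) X.r_le by (auto simp: M doubleton_eq_iff)
    then show ?thesis using M fx t t1 X.annulus_axioms by blast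
  next
    case False
    then have "- m > 0" using w(1) by simp
    then obtain M where M: "- m = int M" "M > 0" using zero_less_imp_eq_int by blast
    have \<gamma>0: "\<gamma> \<noteq> 0" using \<gamma> X.r_pos by auto
    have rM: "rY powi m = inverse (rY ^ M)" using M(1) by (metis minus_equation_iff power_int_minus power_int_of_nat)
    have "rY ^ M \<le> 1" "0 < rY ^ M" using rY by (simp_all add: power_le_one)
    then have "1 \<le> inverse (rY ^ M)" by (simp add: one_le_inverse_iff)
    then have "bnorm c * 1 \<le> bnorm c * rY powi m" unfolding rM using cpos by (intro mult_left_mono) auto
    then have "bnorm c = rX \<and> bnorm c * rY powi m = 1" using w(2) X.r_le by (auto simp: doubleton_eq_iff)
    then have *: "bnorm c = rX" "rX = rY ^ M" using rY by (auto simp: rM field_simps)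
    let ?t = "unit_powi t (- 1)"
    have "unit_powi (f x) (- 1) = Y.ymon (inverse c) (- m) * ?t"
      using powi_fx[OF c fx t \<kappa> t1, of "- 1"] by (simp add: power_int_minus)
    then have "f (X.ymon \<gamma> (- 1)) = Y.ymon (\<gamma> * inverse c) (int M) * ?t"
      unfolding f_ymon by (simp add: Y.ymon_def mult.assoc M(1))
    moreover have "bnorm (\<gamma> * inverse c) = 1" using *(1) \<gamma> X.r_pos by (simp add: bnorm_mult bnorm_inverse)
    moreover have "\<forall>s\<in>{rY, 1}. Y.G s (?t - 1) \<le> \<kappa>" using Y.close_powi[OF t t1 \<kappa>] by blast
    ultimately show ?thesis
      using X.coordinate_inversion[OF \<gamma>] M(2) *(2) unit_powi_dvd[OF t, of "- 1"] by blast
  qed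
  then obtain x1 c1 M t1 where x1: "annulus \<iota>X rX x1" and c1: "bnorm c1 = 1"
    and M: "M > 0" "rX = rY ^ M" and t': "t1 dvd 1" "\<And>s. s \<in> {rY, 1} \<Longrightarrow> Y.G s (t1 - 1) \<le> \<kappa>"
    and fx1: "f x1 = Y.ymon c1 (int M) * t1" by blast
  interpret X1: annulus \<iota>X rX x1 by (rule x1)
  have c10: "c1 \<noteq> 0" using c1 by auto
  let ?x2 = "X1.ymon (inverse c1) 1"
  have x2: "annulus \<iota>X rX ?x2"
    by (rule X1.coordinate_change(1)[of "inverse c1" 1 0])
      (use c1 X1.G_zero[OF X1.end_points(1)] X1.G_zero[OF X1.end_points(2)] in \<open>auto simp: bnorm_inverse\<close>)
  interpret X2: annulus \<iota>X rX ?x2 by (rule x2)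
  have "f ?x2 = Y.ymon (inverse c1 * c1) (int M) * t1"
    using fx1 by (simp add: X1.ymon_def f_simps Y.ymon_def mult.assoc)
  then have "f ?x2 = Y.ymon 1 (int M) * t1" using c10 by simp
  then have "monic_map \<iota>X rX ?x2 \<iota>Y rY y f M t1 \<kappa>"
    using bounded_hom M t' \<kappa> by unfold_locales auto
  then show ?thesis by blast
qed

context monic_map
begin

lemma \<kappa>_nonneg: "0 \<le> \<kappa>"
  using t1[of 1] Y.G_nonneg[OF Y.end_points(2), of "t - 1"] by simp

definition basis :: "int \<Rightarrow> 'a" where
  "basis i = Y.ymon 1 i * unit_powi t (i div int M)"

lemma basis_close:
  assumes "s \<in> {rY, 1}"
  shows "Y.G s (basis i - Y.ymon 1 i) \<le> \<kappa> * s powi i"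
proof -
  note s = Y.in_end_points[OF assms]
  have "basis i - Y.ymon 1 i = Y.ymon 1 i * (unit_powi t (i div int M) - 1)"
    by (simp add: basis_def algebra_simps)
  then have "Y.G s (basis i - Y.ymon 1 i) = s powi i * Y.G s (unit_powi t (i div int M) - 1)"
    by (simp only: Y.G_ymon_mult[OF s] bnorm_one mult_1)
  then show ?thesis
    using Y.close_powi[OF t t1 \<kappa> assms, of "i div int M"] Y.powi_pos[OF s, of i] by (simp add: mult.commute)
qed

abbreviation "\<Psi> \<equiv> Y.perturbed basis"

lemma \<Psi>_add: "\<Psi> (a + b) = \<Psi> a + \<Psi> b"
  and \<Psi>_surj: "\<exists>a. \<Psi> a = b"
  using Y.perturbed_add[OF \<kappa>_nonneg \<kappa> basis_close]
    Y.perturbed_surj[OF \<kappa>_nonneg \<kappa> basis_close] by blast+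

lemma \<Psi>_close: "s \<in> {rY, 1} \<Longrightarrow> Y.G s (\<Psi> a - a) \<le> \<kappa> * Y.G s a"
  using Y.perturbed_close[OF \<kappa>_nonneg \<kappa> basis_close] by blast

lemma G_\<Psi>: "s \<in> {rY, 1} \<Longrightarrow> Y.G s (\<Psi> a) = Y.G s a"
  using Y.G_perturbed[OF \<kappa>_nonneg \<kappa> basis_close] by blast

lemma \<Psi>_eq_0: "\<Psi> a = 0 \<Longrightarrow> a = 0"
  using G_\<Psi>[of 1 a] Y.G_eq_0_iff[OF Y.end_points(2)] by (metis insertI1 insertI2)

lemma \<Psi>_sum: "\<Psi> (sum h F) = (\<Sum>i\<in>F. \<Psi> (h i))"
proof -
  interpret additive \<Psi> by standard (rule \<Psi>_add)
  show ?thesis by (rule sum)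
qed

definition spread :: "(int \<Rightarrow> 'k) \<Rightarrow> int \<Rightarrow> 'k" where
  "spread c i = (if int M dvd i then c (i div int M) else 0)"

lemma rX_powi: "rX powi q = rY powi (int M * q)"
  by (simp add: rX_eq power_int_mult)

lemma spread_in:
  assumes "c \<in> laurent_algebra rX"
  shows "spread c \<in> laurent_algebra rY"
  unfolding laurent_algebra_iff[OF Y.r_pos]
proof (intro allI impI)
  fix e :: real assume e: "e > 0"
  have "{i. e \<le> bnorm (spread c i) * max 1 (rY powi i)}
      \<subseteq> (\<lambda>q. int M * q) ` {q. e \<le> bnorm (c q) * max 1 (rX powi q)}"
  proof
    fix i assume i: "i \<in> {i. e \<le> bnorm (spread c i) * max 1 (rY powi i)}"
    then have "int M dvd i" using e by (auto simp: spread_def split: if_splits)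
    then obtain q where "i = int M * q" by blast
    then show "i \<in> (\<lambda>q. int M * q) ` {q. e \<le> bnorm (c q) * max 1 (rX powi q)}"
      using i M by (simp add: spread_def rX_powi)
  qed
  moreover have "finite {q. e \<le> bnorm (c q) * max 1 (rX powi q)}"
    using assms e by (simp add: laurent_algebra_iff[OF X.r_pos])
  ultimately show "finite {i. e \<le> bnorm (spread c i) * max 1 (rY powi i)}"
    using finite_subset by blast
qed

lemma section_in:
  assumes "c \<in> laurent_algebra rY"
  shows "(\<lambda>q. c (int M * q)) \<in> laurent_algebra rX"
  unfolding laurent_algebra_iff[OF X.r_pos]
proof (intro allI impI)
  fix e :: real assume "e > 0"
  then have "finite {i. e \<le> bnorm (c i) * max 1 (rY powi i)}"
    using assms by (simp add: laurent_algebra_iff[OF Y.r_pos])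
  then have "finite ((\<lambda>q. int M * q) -` {i. e \<le> bnorm (c i) * max 1 (rY powi i)})"
    using M by (intro finite_vimageI) (auto simp: inj_def)
  then show "finite {q. e \<le> bnorm (c (int M * q)) * max 1 (rX powi q)}"
    by (simp add: rX_powi vimage_def)
qed

definition lift :: "int \<Rightarrow> 'b \<Rightarrow> 'a" where
  "lift j b = Y.ymon 1 j * Y.ev (spread (X.lcoeff b))"

lemma lcoeff_lift: "Y.lcoeff (lift j b) i = spread (X.lcoeff b) (i - j)"
  by (simp add: lift_def Y.lcoeff_ymon_mult Y.lcoeff_eqI[OF spread_in[OF X.lcoeff_in] refl])

lemma unit_powi_fx: "unit_powi (f x) q = Y.ymon 1 (int M * q) * unit_powi t q"
  using powi_fx[OF _ fx t \<kappa> t1, of q] by simp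

lemma \<Psi>_lift:
  assumes j: "0 \<le> j" "j < int M"
  shows "\<Psi> (lift j b) = f b * Y.ymon 1 j"
proof -
  define h where "h q = int M * q + j" for q
  have inj: "inj h" using M by (auto simp: inj_def h_def)
  have basis_h: "basis (h q) = Y.ymon 1 j * unit_powi (f x) q" for q
  proof -
    have "h q div int M = q" using j M by (simp add: h_def)
    then show ?thesis
      by (simp add: basis_def unit_powi_fx Y.ymon_mult h_def add.commute flip: mult.assoc)
  qed
  have "f b * Y.ymon 1 j = infsum (\<lambda>q. Y.ymon 1 j * (\<iota>Y (X.lcoeff b q) * unit_powi (f x) q)) UNIV"
  proof -
    obtain C where C: "\<And>b. bnorm (f b) \<le> C * bnorm b" using f_bound by blast
    have "null_family (\<lambda>q. \<iota>Y (X.lcoeff b q) * unit_powi (f x) q)"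
      using null_family_bounded_additive(1)[OF X.null_family_ymon[OF X.lcoeff_in[of b]] f_simps(1) C]
      by (simp add: f_ymon)
    from infsum_mult[OF this, of "Y.ymon 1 j"] show ?thesis by (simp add: f_eq_infsum[of b] mult.commute)
  qed
  also have "\<dots> = infsum ((\<lambda>i. \<iota>Y (Y.lcoeff (lift j b) i) * basis i) \<circ> h) UNIV"
  proof (rule infsum_cong)
    fix q
    have "Y.lcoeff (lift j b) (h q) = X.lcoeff b q" using M by (simp add: lcoeff_lift spread_def h_def)
    then show "Y.ymon 1 j * (\<iota>Y (X.lcoeff b q) * unit_powi (f x) q)
        = ((\<lambda>i. \<iota>Y (Y.lcoeff (lift j b) i) * basis i) \<circ> h) q"
      by (simp add: basis_h mult.left_commute)
  qed
  also have "\<dots> = infsum (\<lambda>i. \<iota>Y (Y.lcoeff (lift j b) i) * basis i) (range h)"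
    by (rule infsum_reindex[OF inj, symmetric])
  also have "\<dots> = \<Psi> (lift j b)"
    unfolding Y.perturbed_def
  proof (rule infsum_cong_neutral)
    fix i assume "i \<in> UNIV - range h"
    then have "i \<noteq> h ((i - j) div int M)" by blast
    then have "\<not> int M dvd (i - j)" by (auto simp: h_def)
    then show "\<iota>Y (Y.lcoeff (lift j b) i) * basis i = 0" by (simp add: lcoeff_lift spread_def)
  qed auto
  finally show ?thesis ..
qed

lemma f_eq_\<Psi>: "f b = \<Psi> (lift 0 b)"
  using \<Psi>_lift[of 0 b] M by simp

lemma G_f:
  assumes s: "s \<in> {rY, 1}"
  shows "Y.G s (f b) = X.G (s ^ M) b"
proof -
  note s' = Y.in_end_points[OF s]
  have sM: "s ^ M \<in> {rX..1}" using s X.r_le by (auto simp: rX_eq)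
  have tm: "bnorm (X.lcoeff b q) * (s ^ M) powi q
      = bnorm (Y.lcoeff (lift 0 b) (int M * q)) * s powi (int M * q)" for q
    using M by (simp add: lcoeff_lift spread_def power_int_mult)
  have "Y.G s (lift 0 b) = X.G (s ^ M) b"
  proof (rule antisym)
    show "Y.G s (lift 0 b) \<le> X.G (s ^ M) b"
    proof (rule Y.G_le[OF s'])
      fix i
      show "bnorm (Y.lcoeff (lift 0 b) i) * s powi i \<le> X.G (s ^ M) b"
      proof (cases "int M dvd i")
        case True
        then obtain q where "i = int M * q" by blast
        then show ?thesis using X.lcoeff_le[OF sM, of b q] by (simp add: tm)
      next
        case False
        then show ?thesis using X.G_nonneg[OF sM] by (simp add: lcoeff_lift spread_def)
      qed
    qed
    show "X.G (s ^ M) b \<le> Y.G s (lift 0 b)"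
      by (rule X.G_le[OF sM]) (simp add: tm Y.lcoeff_le[OF s'])
  qed
  then show ?thesis by (simp add: f_eq_\<Psi> G_\<Psi>[OF s])
qed

lemma gauss_points: "Y.G rY \<circ> f = X.G rX" "Y.G 1 \<circ> f = X.G 1"
  using G_f[of rY] G_f[of 1] by (auto simp: rX_eq)

lemma lcoeff_sum_lift:
  assumes "j < M"
  shows "Y.lcoeff (\<Sum>j<M. lift (int j) (b j)) (int M * q + int j) = X.lcoeff (b j) q"
proof -
  have "spread (X.lcoeff (b i)) (int M * q + int j - int i) = (if i = j then X.lcoeff (b j) q else 0)"
    if "i < M" for i
  proof (cases "i = j")
    case True
    then show ?thesis using M by (simp add: spread_def)
  next
    case False
    have "\<not> int M dvd int M * q + int j - int i"
    proof
      assume "int M dvd int M * q + int j - int i"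
      then have "int M dvd int j - int i" by (simp add: dvd_add_right_iff flip: add_diff_eq)
      then have "int M \<le> \<bar>int j - int i\<bar>" using False by (intro zdvd_imp_le[of "int M" "\<bar>_\<bar>"]) auto
      then show False using assms that by linarith
    qed
    then show ?thesis using False by (simp add: spread_def)
  qed
  then show ?thesis using assms by (simp add: Y.lcoeff_sum lcoeff_lift)
qed

lemma independent_powers:
  assumes "(\<Sum>j<M. f (b j) * Y.ymon 1 (int j)) = 0" "j < M"
  shows "b j = 0"
proof -
  have "\<Psi> (\<Sum>j<M. lift (int j) (b j)) = 0" using assms(1) by (simp add: \<Psi>_sum \<Psi>_lift)
  then have "(\<Sum>j<M. lift (int j) (b j)) = 0" by (rule \<Psi>_eq_0)
  then have "X.lcoeff (b j) q = 0" for q using lcoeff_sum_lift[OF assms(2), of b q] by simp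
  then show ?thesis by (intro X.lcoeff_inject) simp
qed

lemma spanning_powers: "\<exists>b. a = (\<Sum>j<M. f (b j) * Y.ymon 1 (int j))"
proof -
  obtain a0 where a0: "\<Psi> a0 = a" using \<Psi>_surj by blast
  define c where "c j q = Y.lcoeff (Y.ymon 1 (- int j) * a0) (int M * q)" for j q
  define b where "b j = X.ev (c j)" for j
  have "c j \<in> laurent_algebra rX" for j
    unfolding c_def[abs_def] by (rule section_in[OF Y.lcoeff_in])
  then have b: "X.lcoeff (b j) q = Y.lcoeff a0 (int M * q + int j)" for j q
    using X.lcoeff_eqI[of "c j" "b j"] by (simp add: b_def c_def Y.lcoeff_ymon_mult)
  have "a0 = (\<Sum>j<M. lift (int j) (b j))"
  proof (rule Y.lcoeff_inject)
    fix i
    define j where "j = nat (i mod int M)"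
    have "int j = i mod int M" using M by (simp add: j_def)
    then have i: "i = int M * (i div int M) + int j" "j < M" using M by (auto simp: j_def nat_less_iff)
    show "Y.lcoeff a0 i = Y.lcoeff (\<Sum>j<M. lift (int j) (b j)) i"
      using lcoeff_sum_lift[OF i(2), of b "i div int M"] by (simp add: b flip: i(1))
  qed
  then have "a = (\<Sum>j<M. f (b j) * Y.ymon 1 (int j))" using a0 by (simp add: \<Psi>_sum \<Psi>_lift)
  then show ?thesis by blast
qed

lemma degree_eq:
  assumes "has_degree f d"
  shows "d = M"
proof (rule antisym)
  interpret module "module_scale f" using f_hom by (rule module_scale_module)
  obtain S where S: "finite S" "card S = d" "\<not> dependent S" using assms by (auto simp: has_degree_def)
  show "d \<le> M"
  proof (rule ccontr)
    assume "\<not> d \<le> M"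
    then have card: "M < card S" using S(2) by simp
    obtain A where A: "\<And>v. v = (\<Sum>j<M. f (A v j) * Y.ymon 1 (int j))" using spanning_powers by metis
    have "\<exists>w. (\<exists>v\<in>S. w v \<noteq> 0) \<and> (\<forall>i<M. (\<Sum>v\<in>S. w v * A v i) = 0)"
      by (rule homogeneous_system_solvable[OF _ S(1) card]) (simp add: X.mult_eq_0_iff)
    then obtain w where w: "\<exists>v\<in>S. w v \<noteq> 0" "\<And>i. i < M \<Longrightarrow> (\<Sum>v\<in>S. w v * A v i) = 0"
      by (elim exE conjE) simp
    have "(\<Sum>v\<in>S. module_scale f (w v) v) = (\<Sum>v\<in>S. f (w v) * (\<Sum>j<M. f (A v j) * Y.ymon 1 (int j)))"
      unfolding module_scale_def by (simp only: A[symmetric])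
    also have "\<dots> = (\<Sum>j<M. f (\<Sum>v\<in>S. w v * A v j) * Y.ymon 1 (int j))"
      by (subst sum_distrib_left, subst sum.swap)
        (simp add: ring_hom_type_sum[OF f_hom] f_simps sum_distrib_right mult.assoc)
    also have "\<dots> = 0" using w(2) by (simp add: f_simps)
    finally have "dependent S" using w(1) S(1) unfolding dependent_explicit by blast
    with S(3) show False ..
  qed
  define T where "T = (\<lambda>j. Y.ymon 1 (int j)) ` {..<M}"
  have inj: "inj (\<lambda>j. Y.ymon 1 (int j))"
  proof (rule injI)
    fix i j assume "Y.ymon 1 (int i) = Y.ymon 1 (int j)"
    then show "i = j" using Y.lcoeff_ymon[of 1 "int i" "int i"] Y.lcoeff_ymon[of 1 "int j" "int i"]
      by (simp split: if_splits)
  qed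
  have "\<not> dependent T"
  proof
    assume "dependent T"
    then obtain U u where U: "finite U" "U \<subseteq> T" "(\<Sum>v\<in>U. module_scale f (u v) v) = 0"
      and v: "\<exists>v\<in>U. u v \<noteq> 0" unfolding dependent_explicit by blast
    define b where "b j = (if Y.ymon 1 (int j) \<in> U then u (Y.ymon 1 (int j)) else 0)" for j
    have "(\<Sum>j<M. f (b j) * Y.ymon 1 (int j)) = (\<Sum>v\<in>T. if v \<in> U then f (u v) * v else 0)"
      unfolding T_def using inj
      by (subst sum.reindex) (auto simp: b_def f_simps inj_on_def inj_def intro!: sum.cong)
    also have "\<dots> = (\<Sum>v\<in>U. f (u v) * v)"
      using U(1,2) by (subst sum.inter_restrict[symmetric]) (auto simp: T_def Int_absorb1)
    finally have "(\<Sum>j<M. f (b j) * Y.ymon 1 (int j)) = 0" using U(3) by (simp add: module_scale_def)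
    then have "b j = 0" if "j < M" for j using independent_powers[OF _ that] by blast
    moreover obtain w where "w \<in> U" "u w \<noteq> 0" using v by blast
    moreover then obtain j where "j < M" "w = Y.ymon 1 (int j)" using U(2) unfolding T_def by blast
    ultimately show False unfolding b_def by metis
  qed
  then have "card T \<le> d" using assms by (auto simp: has_degree_def)
  moreover have "card T = M" unfolding T_def using inj by (subst card_image) (auto intro: inj_on_subset)
  ultimately show "M \<le> d" by simp
qed

lemma approximate_by_section:
  obtains b where "\<And>s. s \<in> {rY, 1} \<Longrightarrow> Y.G s (f b) \<le> Y.G s w"
    "\<And>s M'. s \<in> {rY, 1} \<Longrightarrow> (\<And>i. \<not> int M dvd i \<Longrightarrow> bnorm (Y.lcoeff w i) * s powi i \<le> M') \<Longrightarrow>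
      \<kappa> * Y.G s w \<le> M' \<Longrightarrow> Y.G s (w - f b) \<le> M'"
proof -
  define b where "b = X.ev (\<lambda>q. Y.lcoeff w (int M * q))"
  have b: "X.lcoeff b q = Y.lcoeff w (int M * q)" for q
    using X.lcoeff_eqI[OF section_in[OF Y.lcoeff_in[of w]], of b] by (simp add: b_def)
  have c: "Y.lcoeff (lift 0 b) i = (if int M dvd i then Y.lcoeff w i else 0)" for i
    by (auto simp: lcoeff_lift spread_def b)
  have le: "Y.G s (lift 0 b) \<le> Y.G s w" if s: "s \<in> {rY, 1}" for s
    using Y.lcoeff_le[OF Y.in_end_points[OF s], of w] Y.G_nonneg[OF Y.in_end_points[OF s], of w]
    by (intro Y.G_le[OF Y.in_end_points[OF s]]) (simp add: c)
  show thesis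
  proof (rule that)
    fix s assume s: "s \<in> {rY, 1}"
    show "Y.G s (f b) \<le> Y.G s w" using le[OF s] by (simp add: f_eq_\<Psi> G_\<Psi>[OF s])
  next
    fix s M' assume s: "s \<in> {rY, 1}" and M': "\<And>i. \<not> int M dvd i \<Longrightarrow> bnorm (Y.lcoeff w i) * s powi i \<le> M'"
      "\<kappa> * Y.G s w \<le> M'"
    note s' = Y.in_end_points[OF s]
    interpret g: ultra_seminorm "Y.G s" by (rule Y.G_ultra[OF s'])
    have "0 \<le> M'" using M'(2) \<kappa>_nonneg g.nonneg[of w] by (meson mult_nonneg_nonneg order_trans)
    then have 1: "Y.G s (w - lift 0 b) \<le> M'"
      using M'(1) by (intro Y.G_le[OF s']) (simp add: Y.lcoeff_diff c)
    have "\<kappa> * Y.G s (lift 0 b) \<le> \<kappa> * Y.G s w" using le[OF s] \<kappa>_nonneg by (rule mult_left_mono)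
    then have 2: "Y.G s (\<Psi> (lift 0 b) - lift 0 b) \<le> M'" using \<Psi>_close[OF s, of "lift 0 b"] M'(2) by linarith
    have "w - f b = (w - lift 0 b) - (\<Psi> (lift 0 b) - lift 0 b)" by (simp add: f_eq_\<Psi>)
    then show "Y.G s (w - f b) \<le> M'" using g.diff_le[OF 1 2] by simp
  qed
qed

end


section \<open>Unramified maps\<close>

lemma type_ring_simps [simp]:
  "carrier type_ring = UNIV" "x \<otimes>\<^bsub>type_ring\<^esub> y = x * y" "x \<oplus>\<^bsub>type_ring\<^esub> y = x + y"
  "\<one>\<^bsub>type_ring\<^esub> = 1" "\<zero>\<^bsub>type_ring\<^esub> = 0"
  by (simp_all add: type_ring_def)

lemma type_ring_minus [simp]: "x \<ominus>\<^bsub>type_ring\<^esub> y = x - y"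
proof -
  have "\<ominus>\<^bsub>type_ring\<^esub> y = - y"
    unfolding a_inv_def m_inv_def
    by (rule the_equality) (simp_all add: type_ring_def eq_neg_iff_add_eq_0)
  then show ?thesis by (simp add: a_minus_def)
qed

lemma sum_d_symbol: "finite F \<Longrightarrow> b \<in> F \<Longrightarrow> (\<Sum>z\<in>F. d_symbol type_ring s b z * h z) = s * h b"
proof -
  assume F: "finite F" "b \<in> F"
  have "(\<Sum>z\<in>F. d_symbol type_ring s b z * h z) = (\<Sum>z\<in>F. if z = b then s * h b else 0)"
    by (rule sum.cong) (simp_all add: d_symbol_def)
  then show ?thesis using F by simp
qed

text \<open>A derivation of \<open>S\<close> that maps the base into the ideal \<open>(d)\<close> induces a linear functional from the
  free module of differentials to \<open>S / (d)\<close> that vanishes on the relations.\<close>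

lemma derivation_on_relations:
  fixes h :: "'b::comm_ring_1 \<Rightarrow> 'a::comm_ring_1" and \<theta> :: "'a \<Rightarrow> 'a"
  assumes add: "\<And>a b. \<theta> (a + b) = \<theta> a + \<theta> b"
    and mult: "\<And>a b. \<theta> (a * b) = \<theta> a * b + a * \<theta> b"
    and base: "\<And>b. d dvd \<theta> (h b)"
    and u: "u \<in> kaehler_relations (type_ring :: 'b ring) (type_ring :: 'a ring) h"
  shows "\<exists>F. finite F \<and> (\<forall>z. z \<notin> F \<longrightarrow> u z = 0) \<and> d dvd (\<Sum>z\<in>F. u z * \<theta> z)"
  using u
proof induction
  case zero
  show ?case by (intro exI[of _ "{}"]) simp
next
  case (add u v)
  then obtain F F' where F: "finite F" "\<forall>z. z \<notin> F \<longrightarrow> u z = 0" "d dvd (\<Sum>z\<in>F. u z * \<theta> z)"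
    and F': "finite F'" "\<forall>z. z \<notin> F' \<longrightarrow> v z = 0" "d dvd (\<Sum>z\<in>F'. v z * \<theta> z)" by blast
  have "(\<Sum>z\<in>F \<union> F'. u z * \<theta> z) = (\<Sum>z\<in>F. u z * \<theta> z)"
    "(\<Sum>z\<in>F \<union> F'. v z * \<theta> z) = (\<Sum>z\<in>F'. v z * \<theta> z)"
    using F F' by (auto intro!: sum.mono_neutral_right)
  then have "d dvd (\<Sum>z\<in>F \<union> F'. (u z + v z) * \<theta> z)"
    using F(3) F'(3) by (simp add: distrib_right sum.distrib dvd_add)
  then show ?case using F F' by (intro exI[of _ "F \<union> F'"]) auto
next
  case (scale s u)
  then obtain F where F: "finite F" "\<forall>z. z \<notin> F \<longrightarrow> u z = 0" "d dvd (\<Sum>z\<in>F. u z * \<theta> z)" by blast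
  have "(\<Sum>z\<in>F. s * u z * \<theta> z) = s * (\<Sum>z\<in>F. u z * \<theta> z)" by (simp add: sum_distrib_left mult.assoc)
  then show ?case using F by (intro exI[of _ F]) auto
next
  case (additive b c)
  show ?case
    by (rule exI[of _ "{b + c, b, c}"])
      (simp only: type_ring_simps type_ring_minus left_diff_distrib sum_subtractf sum_d_symbol
        finite.intros insert_iff simp_thms, simp add: d_symbol_def add)
next
  case (leibniz b c)
  show ?case
    by (rule exI[of _ "{b * c, b, c}"])
      (simp only: type_ring_simps type_ring_minus left_diff_distrib sum_subtractf sum_d_symbol
        finite.intros insert_iff simp_thms, simp add: d_symbol_def mult algebra_simps)
next
  case (base a)
  show ?case
    by (rule exI[of _ "{h a}"]) (simp add: d_symbol_def assms(3))
qed

context annulus_map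
begin

lemma theta_f: "f x * Y.theta (f b) = f (X.theta b) * Y.theta (f x)"
proof -
  define D where "D b = f x * Y.theta (f b) - f (X.theta b) * Y.theta (f x)" for b
  from f_bound obtain C where C0: "C > 0 \<and> (\<forall>b. bnorm (f b) \<le> C * bnorm b)" ..
  then have C: "C > 0" "\<And>b. bnorm (f b) \<le> C * bnorm b" by simp_all
  define K where "K = bnorm (f x) * (Y.CC * Y.CC * C) + C * (X.CC * X.CC) * bnorm (Y.theta (f x))"
  have "D b = 0"
  proof (rule X.bounded_additive_eq_0[of D])
    show "D (a + b) = D a + D b" for a b
      by (simp add: D_def f_simps Y.theta_add X.theta_add algebra_simps)
    show "bnorm (D a) \<le> K * bnorm a" for a
    proof -
      have "Y.CC * Y.CC * bnorm (f a) \<le> Y.CC * Y.CC * (C * bnorm a)"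
        using C(2) by (intro mult_left_mono) auto
      then have "bnorm (Y.theta (f a)) \<le> Y.CC * Y.CC * (C * bnorm a)"
        using Y.bnorm_theta_le[of "f a"] by linarith
      then have 1: "bnorm (f x * Y.theta (f a)) \<le> bnorm (f x) * (Y.CC * Y.CC * (C * bnorm a))"
        by (rule bn.mult_le[OF order_refl])
      have "C * bnorm (X.theta a) \<le> C * (X.CC * X.CC * bnorm a)"
        using C(1) X.bnorm_theta_le by (intro mult_left_mono) auto
      then have "bnorm (f (X.theta a)) \<le> C * (X.CC * X.CC * bnorm a)"
        using C(2)[of "X.theta a"] by linarith
      then have 2: "bnorm (f (X.theta a) * Y.theta (f x)) \<le> C * (X.CC * X.CC * bnorm a) * bnorm (Y.theta (f x))"
        by (rule bn.mult_le[OF _ order_refl])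
      have "0 \<le> bnorm (f x) * (Y.CC * Y.CC * (C * bnorm a))"
        "0 \<le> C * (X.CC * X.CC * bnorm a) * bnorm (Y.theta (f x))"
        using C(1) X.CC_pos Y.CC_pos by (simp_all add: bn.nonneg)
      then have "bnorm (D a) \<le> bnorm (f x) * (Y.CC * Y.CC * (C * bnorm a))
          + C * (X.CC * X.CC * bnorm a) * bnorm (Y.theta (f x))"
        unfolding D_def using 1 2 by (intro bn.diff_le) linarith+
      then show ?thesis by (simp add: K_def algebra_simps)
    qed
    show "D (X.ymon c i) = 0" for c i
    proof -
      have "Y.theta (\<iota>Y c) = 0" using Y.theta_ymon[of c 0] by (simp add: Y.ymon_def)
      then have "f x * Y.theta (f (X.ymon c i)) = \<iota>Y c * (f x * Y.theta (unit_powi (f x) i))"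
        by (simp add: f_ymon Y.theta_mult mult_ac)
      also have "\<dots> = of_int i * (\<iota>Y c * unit_powi (f x) i) * Y.theta (f x)"
        unfolding Y.theta_unit_powi[OF f_x_unit] by (simp only: mult_ac)
      also have "of_int i * (\<iota>Y c * unit_powi (f x) i) = f (X.theta (X.ymon c i))"
        by (simp add: X.theta_ymon f_simps ring_hom_type_of_int[OF f_hom] flip: f_ymon)
      finally show ?thesis by (simp add: D_def)
    qed
  qed
  then show ?thesis by (simp add: D_def)
qed

lemma theta_f_eq: "Y.theta (f b) = unit_powi (f x) (- 1) * f (X.theta b) * Y.theta (f x)"
proof -
  have "unit_powi (f x) (- 1) * (f x * Y.theta (f b)) = unit_powi (f x) (- 1) * (f (X.theta b) * Y.theta (f x))"
    by (simp only: theta_f)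
  moreover have "unit_powi (f x) (- 1) * f x = 1"
    using unit_powi_inverse[OF f_x_unit, of 1] by (simp add: mult.commute)
  ultimately show ?thesis by (simp flip: mult.assoc)
qed

lemma unramified_imp_theta_unit:
  assumes "unramified_hom f"
  shows "Y.theta (f x) dvd 1"
proof -
  have free: "d_symbol type_ring 1 y \<in> kaehler_free (type_ring :: 'a ring)"
    by (simp add: kaehler_free_def d_symbol_def)
  have base: "Y.theta (f x) dvd Y.theta (f b)" for b by (simp add: theta_f_eq[of b])
  from free assms have "d_symbol type_ring 1 y \<in> kaehler_relations type_ring type_ring f"
    by (auto simp: unramified_hom_def)
  from derivation_on_relations[of Y.theta, OF Y.theta_add Y.theta_mult base this]
  obtain F where F: "finite F" "\<forall>z. z \<notin> F \<longrightarrow> d_symbol type_ring 1 y z = (0::'a)"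
    "Y.theta (f x) dvd (\<Sum>z\<in>F. d_symbol type_ring 1 y z * Y.theta z)" by blast
  have "y \<in> F" using F(2) by (auto simp: d_symbol_def)
  then have "Y.theta (f x) dvd y" using F(1,3) sum_d_symbol[of F y 1 Y.theta] by (simp add: Y.theta_y)
  then show ?thesis using Y.unit_y dvd_trans by blast
qed

end


section \<open>Norms of integers\<close>

lemma bnorm_of_int_coprime:
  assumes "prime p" "bnorm (of_nat p :: 'k::alg_closed_valued_field) < 1" "\<not> int p dvd i"
  shows "bnorm (of_int i :: 'k) = 1"
proof (rule antisym)
  show "bnorm (of_int i :: 'k) \<le> 1" by (rule bn.of_int_le1)
  show "1 \<le> bnorm (of_int i :: 'k)"
  proof (rule ccontr)
    assume *: "\<not> 1 \<le> bnorm (of_int i :: 'k)"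
    have "coprime (int p) i" using assms(1,3) by (intro prime_imp_coprime) auto
    then obtain a b where ab: "a * int p + b * i = 1" using coprime_iff_gcd_eq_1 bezout_int by metis
    have le: "bnorm (of_int c * z) \<le> bnorm z" for c and z :: 'k
      by (rule bn.mult_le1[OF bn.of_int_le1 order_refl])
    have "bnorm (of_int (a * int p + b * i) :: 'k) < 1"
      unfolding of_int_add of_int_mult of_int_of_nat_eq
      using assms(2) * le[of a "of_nat p"] le[of b "of_int i"] by (intro bn.add_less) linarith+
    then show False by (simp add: ab bnorm_one)
  qed
qed

lemma bnorm_of_int_dvd:
  assumes "int p dvd i"
  shows "bnorm (of_int i :: 'k::alg_closed_valued_field) \<le> bnorm (of_nat p :: 'k)"
proof -
  obtain j where "i = j * int p" using assms by (metis dvdE mult.commute)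
  then show ?thesis using bn.mult_le1[OF bn.of_int_le1 order_refl, of j "of_nat p :: 'k"] by simp
qed

lemma char_0_if_residual:
  assumes "prime p" "bnorm (of_nat p :: 'k::alg_closed_valued_field) < 1" "of_nat p \<noteq> (0::'k)"
  shows "CHAR('k) = 0"
proof (rule ccontr)
  assume "CHAR('k) \<noteq> 0"
  then have pr: "prime CHAR('k)" using prime_CHAR_semidom by auto
  show False
  proof (cases "p dvd CHAR('k)")
    case True
    then have "p = CHAR('k)" using pr assms(1) primes_dvd_imp_eq by blast
    then show False using assms(3) of_nat_CHAR by metis
  next
    case False
    then have "bnorm (of_int (int CHAR('k)) :: 'k) = 1" using assms by (intro bnorm_of_int_coprime) auto
    then show False by simp
  qed
qed

lemma (in monic_map) normalize:
  "\<exists>x' t'. monic_map \<iota>X rX x' \<iota>Y rY y f M t' \<kappa> \<and> Y.lcoeff (f x') (int M) = 1"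
proof -
  define \<tau> where "\<tau> = Y.lcoeff t 0"
  have \<tau>1: "bnorm (\<tau> - 1) \<le> \<kappa>"
    using Y.lcoeff_le[OF Y.end_points(2), of "t - 1" 0] t1[of 1] by (simp add: Y.lcoeff_diff Y.lcoeff_one \<tau>_def)
  then have \<tau>: "bnorm \<tau> = 1" using bn.eq_of_diff_less[of \<tau> 1] \<kappa> by (simp add: bnorm_one)
  then have \<tau>0: "\<tau> \<noteq> 0" by auto
  define x' where "x' = X.ymon (inverse \<tau>) 1"
  define t' where "t' = Y.ymon (inverse \<tau>) 0 * t"
  have "annulus \<iota>X rX x'"
    by (rule X.coordinate_change(1)[of "inverse \<tau>" 1 0])
      (use \<tau> X.G_zero[OF X.end_points(1)] X.G_zero[OF X.end_points(2)] in \<open>auto simp: bnorm_inverse x'_def\<close>)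
  then interpret X': annulus \<iota>X rX x' .
  have fx': "f x' = Y.ymon (inverse \<tau>) 0 * f x" by (simp add: x'_def f_ymon Y.ymon_def)
  have t'_eq: "f x' = Y.ymon 1 (int M) * t'"
    unfolding fx' t'_def by (subst fx) (rule mult.left_commute)
  have "Y.lcoeff (f x') (int M) = 1"
    unfolding fx' fx using \<tau>0 by (simp add: Y.lcoeff_ymon_mult \<tau>_def)
  moreover have "monic_map \<iota>X rX x' \<iota>Y rY y f M t' \<kappa>"
  proof
    show "t' dvd 1" using mult_dvd_mono[OF Y.ymon_dvd t, of "inverse \<tau>" 0] \<tau>0 by (simp add: t'_def)
    fix s assume s: "s \<in> {rY, 1}"
    note s' = Y.in_end_points[OF s]
    interpret g: ultra_seminorm "Y.G s" by (rule Y.G_ultra[OF s'])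
    have "t' - 1 = Y.ymon (inverse \<tau>) 0 * (t - Y.ymon \<tau> 0)"
      using \<tau>0 by (simp add: t'_def right_diff_distrib Y.ymon_mult)
    then have "Y.G s (t' - 1) = Y.G s (t - Y.ymon \<tau> 0)"
      by (simp add: Y.G_ymon_mult[OF s'] bnorm_inverse \<tau>)
    also have "t - Y.ymon \<tau> 0 = (t - 1) - Y.ymon (\<tau> - 1) 0" by (simp add: Y.ymon_def)
    also have "Y.G s \<dots> \<le> \<kappa>"
      by (rule g.diff_le[OF t1[OF s]]) (simp add: Y.G_ymon[OF s'] \<tau>1)
    finally show "Y.G s (t' - 1) \<le> \<kappa>" .
  qed (use bounded_hom t'_eq \<kappa> M rX_eq in auto)
  ultimately show ?thesis by blast
qed


section \<open>The normal form\<close>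

locale tame_map = monic_map \<iota>X rX x \<iota>Y rY y f M t \<kappa>
  for \<iota>X :: "'k::alg_closed_valued_field \<Rightarrow> 'b::nonarch_banach_ring" and rX :: real and x :: 'b
    and \<iota>Y :: "'k \<Rightarrow> 'a::nonarch_banach_ring" and rY :: real and y :: 'a and f :: "'b \<Rightarrow> 'a"
    and M :: nat and t :: 'a and \<kappa> :: real +
  fixes n :: int
  assumes prime: "prime M" and res: "bnorm (of_nat M :: 'k) < 1"
    and lead: "Y.lcoeff (f x) (int M) = 1"
    and dom: "\<And>s i. s \<in> {rY, 1} \<Longrightarrow> i \<noteq> n \<Longrightarrow> bnorm (of_int i * Y.lcoeff (f x) i) * s powi i
      < bnorm (of_int n * Y.lcoeff (f x) n) * s powi n"
begin

abbreviation "\<phi> \<equiv> Y.lcoeff (f x)"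

definition dd :: "real \<Rightarrow> real" where
  "dd s = bnorm (of_int n * \<phi> n) * s powi n"

definition ell :: "real \<Rightarrow> real" where
  "ell s = dd s / s ^ M"

lemma s_bounds: "s \<in> {rY, 1} \<Longrightarrow> 0 < s" "s \<in> {rY, 1} \<Longrightarrow> s \<le> 1"
  using Y.r_pos Y.r_le by auto

lemma sM: "s \<in> {rY, 1} \<Longrightarrow> 0 < s ^ M" "s \<in> {rY, 1} \<Longrightarrow> s ^ M \<le> 1"
  using Y.r_pos Y.r_le by (auto simp: power_le_one)

lemma phi_le:
  assumes s: "s \<in> {rY, 1}" and "i \<noteq> int M"
  shows "bnorm (\<phi> i) * s powi i \<le> \<kappa> * s ^ M"
proof -
  note s' = Y.in_end_points[OF s]
  have "f x - Y.ymon 1 (int M) = Y.ymon 1 (int M) * (t - 1)" using fx by (simp add: algebra_simps)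
  then have "Y.G s (f x - Y.ymon 1 (int M)) = s ^ M * Y.G s (t - 1)"
    by (simp add: Y.G_ymon_mult[OF s'] bnorm_one)
  also have "\<dots> \<le> s ^ M * \<kappa>" using t1[OF s] sM[OF s] by simp
  finally show ?thesis
    using Y.lcoeff_le[OF s', of "f x - Y.ymon 1 (int M)" i] assms(2)
    by (simp add: Y.lcoeff_diff Y.lcoeff_ymon mult.commute)
qed

lemma phi_le': "s \<in> {rY, 1} \<Longrightarrow> bnorm (\<phi> i) * s powi i \<le> s ^ M"
proof (cases "i = int M")
  case False
  assume s: "s \<in> {rY, 1}"
  have "\<kappa> * s ^ M \<le> 1 * s ^ M" using \<kappa> sM[OF s] by (intro mult_right_mono) auto
  then show ?thesis using phi_le[OF s False] by simp
qed (simp add: lead bnorm_one)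

lemma dd_pos:
  assumes s: "s \<in> {rY, 1}"
  shows "0 < dd s"
proof -
  have "0 \<le> bnorm (of_int (n + 1) * \<phi> (n + 1)) * s powi (n + 1)"
    using Y.powi_pos[OF Y.in_end_points[OF s], of "n + 1"] by (simp add: bn.nonneg)
  then show ?thesis using dom[OF s, of "n + 1"] by (simp add: dd_def)
qed

lemma ell_pos: "s \<in> {rY, 1} \<Longrightarrow> 0 < ell s"
  using dd_pos sM by (simp add: ell_def)

lemma dd_eq: "s \<in> {rY, 1} \<Longrightarrow> dd s = ell s * s ^ M"
  unfolding ell_def using sM(1)[of s] by (metis less_irrefl nonzero_eq_divide_eq)

lemma dd_le:
  assumes s: "s \<in> {rY, 1}"
  shows "dd s \<le> s ^ M"
proof -
  have "bnorm (of_int n * \<phi> n) * s powi n \<le> bnorm (\<phi> n) * s powi n"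
    using Y.powi_pos[OF Y.in_end_points[OF s], of n] bn.mult_le1[OF bn.of_int_le1 order_refl]
    by (intro mult_right_mono) auto
  then show ?thesis using phi_le'[OF s, of n] by (simp add: dd_def)
qed

lemma dd_le_1: "s \<in> {rY, 1} \<Longrightarrow> dd s \<le> 1"
  using dd_le sM order_trans by blast

lemma ell_le_1: "s \<in> {rY, 1} \<Longrightarrow> ell s \<le> 1"
  using dd_le sM by (simp add: ell_def)

lemma p_less:
  assumes "s \<in> {rY, 1}" "n \<noteq> int M"
  shows "bnorm (of_nat M :: 'k) * s ^ M < dd s"
  using dom[OF assms(1), of "int M"] assms(2) by (simp add: dd_def lead)

lemma dd_eq_p: "n = int M \<Longrightarrow> dd s = bnorm (of_nat M :: 'k) * s ^ M"
  unfolding dd_def by (simp add: lead)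

lemma p_le_ell:
  assumes s: "s \<in> {rY, 1}"
  shows "bnorm (of_nat M :: 'k) \<le> ell s"
proof -
  have "bnorm (of_nat M :: 'k) * s ^ M \<le> dd s"
    using p_less[OF s] dd_eq_p[of s] by fastforce
  then show ?thesis using sM(1)[OF s] by (simp add: ell_def pos_le_divide_eq)
qed

lemma n_cases: "n = int M \<or> \<not> int M dvd n"
proof (rule ccontr)
  assume "\<not> ?thesis"
  then have n: "n \<noteq> int M" "int M dvd n" by auto
  have s: "(1::real) \<in> {rY, 1}" by simp
  have "bnorm (of_int n * \<phi> n) \<le> bnorm (of_nat M :: 'k) * 1"
    using phi_le'[OF s, of n] by (intro bn.mult_le) (use bnorm_of_int_dvd[OF n(2)] in \<open>simp_all add: bnorm_mult\<close>)
  then show False using p_less[OF s n(1)] by (simp add: dd_def)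
qed

lemma bnorm_n: "n \<noteq> int M \<Longrightarrow> bnorm (of_int n :: 'k) = 1"
  using n_cases bnorm_of_int_coprime[OF prime res] by blast

lemma theta_f_le:
  assumes s: "s \<in> {rY, 1}"
  shows "Y.G s (Y.theta (f b)) \<le> ell s * Y.G s (f b)"
proof -
  note s' = Y.in_end_points[OF s]
  interpret g: ultra_seminorm "Y.G s" by (rule Y.G_ultra[OF s'])
  have 1: "Y.G s (unit_powi (f x) (- 1)) = inverse (s ^ M)"
    using G_powi_fx[OF _ fx t \<kappa> t1 s, of "- 1"] by (simp add: bnorm_one power_int_minus)
  have sM': "s ^ M \<in> {rX..1}" using s X.r_le by (auto simp: rX_eq)
  have 2: "Y.G s (f (X.theta b)) \<le> Y.G s (f b)"
    using X.G_theta_le[OF sM'] by (simp add: G_f[OF s])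
  have 3: "Y.G s (Y.theta (f x)) \<le> dd s"
  proof (rule Y.G_le[OF s'])
    fix j
    show "bnorm (Y.lcoeff (Y.theta (f x)) j) * s powi j \<le> dd s"
      using dom[OF s, of j] by (cases "j = n") (simp_all add: Y.lcoeff_theta dd_def)
  qed
  have "Y.G s (Y.theta (f b)) \<le> inverse (s ^ M) * Y.G s (f b) * dd s"
    unfolding theta_f_eq[of b] using 1 2 3 by (intro g.mult_le) auto
  then show ?thesis by (simp add: ell_def divide_inverse mult_ac)
qed

text \<open>Since \<open>\<theta>\<close> shrinks the image of \<open>f\<close> by the factor \<open>ell\<close> and is isometric on the tame part, elements
  on which \<open>\<theta>\<close> is small are close to the image of \<open>f\<close>.\<close>

lemma approximable:
  assumes w: "\<And>s. s \<in> {rY, 1} \<Longrightarrow> Y.G s w \<le> g s"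
    and \<theta>w: "\<And>s. s \<in> {rY, 1} \<Longrightarrow> Y.G s (Y.theta w) \<le> ell s * g s"
  obtains b where "\<And>s. s \<in> {rY, 1} \<Longrightarrow> Y.G s (w - f b) \<le> ell s * g s"
proof -
  have g0: "0 \<le> g s" if "s \<in> {rY, 1}" for s
    using w[OF that] Y.G_nonneg[OF Y.in_end_points[OF that], of w] by linarith
  have step: "\<exists>b. \<forall>s\<in>{rY, 1}. Y.G s (w - f b) \<le> max (ell s * g s) (\<kappa> ^ k * g s) \<and>
      Y.G s (Y.theta (w - f b)) \<le> ell s * g s" for k
  proof (induction k)
    case 0
    have "\<forall>s\<in>{rY, 1}. Y.G s (w - f 0) \<le> max (ell s * g s) (\<kappa> ^ 0 * g s) \<and>
      Y.G s (Y.theta (w - f 0)) \<le> ell s * g s"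
      using w \<theta>w by (simp add: f_simps le_max_iff_disj)
    then show ?case by blast
  next
    case (Suc k)
    then obtain b where b: "\<And>s. s \<in> {rY, 1} \<Longrightarrow> Y.G s (w - f b) \<le> max (ell s * g s) (\<kappa> ^ k * g s)"
      "\<And>s. s \<in> {rY, 1} \<Longrightarrow> Y.G s (Y.theta (w - f b)) \<le> ell s * g s" by blast
    obtain b' where b': "\<And>s. s \<in> {rY, 1} \<Longrightarrow> Y.G s (f b') \<le> Y.G s (w - f b)"
      "\<And>s N. s \<in> {rY, 1} \<Longrightarrow> (\<And>i. \<not> int M dvd i \<Longrightarrow> bnorm (Y.lcoeff (w - f b) i) * s powi i \<le> N) \<Longrightarrow>
        \<kappa> * Y.G s (w - f b) \<le> N \<Longrightarrow> Y.G s (w - f b - f b') \<le> N"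
      using approximate_by_section[of "w - f b"] by metis
    have "Y.G s (w - f (b + b')) \<le> max (ell s * g s) (\<kappa> ^ Suc k * g s) \<and>
        Y.G s (Y.theta (w - f (b + b'))) \<le> ell s * g s" if s: "s \<in> {rY, 1}" for s
    proof -
      note s' = Y.in_end_points[OF s]
      interpret g: ultra_seminorm "Y.G s" by (rule Y.G_ultra[OF s'])
      have eq: "w - f (b + b') = w - f b - f b'" by (simp add: f_simps)
      have le_g: "Y.G s (w - f b) \<le> g s"
      proof -
        have "ell s * g s \<le> 1 * g s" using ell_le_1[OF s] g0[OF s] by (rule mult_right_mono)
        moreover have "\<kappa> ^ k * g s \<le> 1 * g s"
          using g0[OF s] \<kappa> \<kappa>_nonneg by (intro mult_right_mono) (auto simp: power_le_one)
        ultimately show ?thesis using b(1)[OF s] by simp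
      qed
      have "Y.G s (w - f b - f b') \<le> max (ell s * g s) (\<kappa> ^ Suc k * g s)"
      proof (rule b'(2)[OF s])
        fix i assume "\<not> int M dvd i"
        then have "bnorm (Y.lcoeff (w - f b) i) * s powi i
            = bnorm (Y.lcoeff (Y.theta (w - f b)) i) * s powi i"
          using bnorm_of_int_coprime[OF prime res, of i] unfolding Y.lcoeff_theta bnorm_mult by simp
        also have "\<dots> \<le> ell s * g s"
          using Y.lcoeff_le[OF s', of "Y.theta (w - f b)" i] b(2)[OF s] by linarith
        finally show "bnorm (Y.lcoeff (w - f b) i) * s powi i \<le> max (ell s * g s) (\<kappa> ^ Suc k * g s)" by simp
      next
        have "\<kappa> * Y.G s (w - f b) \<le> \<kappa> * max (ell s * g s) (\<kappa> ^ k * g s)"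
          using b(1)[OF s] \<kappa>_nonneg by (rule mult_left_mono)
        also have "\<dots> = max (\<kappa> * (ell s * g s)) (\<kappa> ^ Suc k * g s)"
          using \<kappa>_nonneg by (simp add: max_mult_distrib_left mult.assoc)
        also have "\<dots> \<le> max (ell s * g s) (\<kappa> ^ Suc k * g s)"
        proof (rule max.mono)
          have "\<kappa> * (ell s * g s) \<le> 1 * (ell s * g s)"
            using \<kappa> g0[OF s] ell_pos[OF s] by (intro mult_right_mono) auto
          then show "\<kappa> * (ell s * g s) \<le> ell s * g s" by simp
        qed simp
        finally show "\<kappa> * Y.G s (w - f b) \<le> max (ell s * g s) (\<kappa> ^ Suc k * g s)" .
      qed
      moreover have "Y.G s (Y.theta (w - f b - f b')) \<le> ell s * g s"
      proof -
        have "ell s * Y.G s (f b') \<le> ell s * g s"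
          using b'(1)[OF s] le_g ell_pos[OF s] by (intro mult_left_mono) auto
        then show ?thesis
          unfolding Y.theta_diff[of "w - f b"] using b(2)[OF s] theta_f_le[OF s, of b']
          by (intro g.diff_le) linarith+
      qed
      ultimately show ?thesis unfolding eq by blast
    qed
    then show ?case by blast
  qed
  define l where "l = min (ell rY) (ell 1)"
  have "0 < l" using ell_pos by (simp add: l_def)
  then obtain k where k: "\<kappa> ^ k < l" using \<kappa> real_arch_pow_inv by blast
  obtain b where b: "\<And>s. s \<in> {rY, 1} \<Longrightarrow> Y.G s (w - f b) \<le> max (ell s * g s) (\<kappa> ^ k * g s)"
    using step[of k] by blast
  show thesis
  proof (rule that)
    fix s assume s: "s \<in> {rY, 1}"
    have "\<kappa> ^ k \<le> ell s" using k s by (auto simp: l_def)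
    then have "\<kappa> ^ k * g s \<le> ell s * g s" using g0[OF s] by (rule mult_right_mono)
    then show "Y.G s (w - f b) \<le> ell s * g s" using b[OF s] by simp
  qed
qed

lemma power_approximable:
  assumes v: "\<And>s. s \<in> {rY, 1} \<Longrightarrow> Y.G s v \<le> h s"
  obtains b where "\<And>s. s \<in> {rY, 1} \<Longrightarrow> Y.G s (v ^ M - f b) \<le> ell s * h s ^ M"
proof (rule approximable[of "v ^ M" "\<lambda>s. h s ^ M"])
  fix s assume s: "s \<in> {rY, 1}"
  note s' = Y.in_end_points[OF s]
  interpret g: ultra_seminorm "Y.G s" by (rule Y.G_ultra[OF s'])
  have h0: "0 \<le> h s" using v[OF s] g.nonneg[of v] by linarith
  show "Y.G s (v ^ M) \<le> h s ^ M" using v[OF s] by (rule g.power_le_power)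
  have "Y.G s (v ^ (M - 1) * Y.theta v) \<le> h s ^ (M - 1) * h s"
    using Y.G_theta_le[OF s', of v] v[OF s] by (intro g.mult_le g.power_le_power) auto
  also have "h s ^ (M - 1) * h s = h s ^ M" using M by (simp add: power_eq_if mult.commute)
  finally have "bnorm (of_nat M :: 'k) * Y.G s (v ^ (M - 1) * Y.theta v) \<le> ell s * h s ^ M"
    using p_le_ell[OF s] ell_pos[OF s] by (intro mult_mono g.nonneg) auto
  then show "Y.G s (Y.theta (v ^ M)) \<le> ell s * h s ^ M"
    by (simp add: Y.theta_power mult.assoc Y.G_of_nat_mult[OF s'])
qed (use that in blast)

definition D :: 'a where
  "D = Y.ymon (of_int n * \<phi> n) n"

definition Di :: 'a where
  "Di = Y.ymon (inverse (of_int n * \<phi> n)) (- n)"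

lemma n_phi_nz: "of_int n * \<phi> n \<noteq> 0"
  using dd_pos[of 1] by (auto simp: dd_def)

lemma G_D_mult: "s \<in> {rY, 1} \<Longrightarrow> Y.G s (D * a) = dd s * Y.G s a"
  by (simp add: D_def Y.G_ymon_mult[OF Y.in_end_points] dd_def)

lemma G_Di_mult:
  assumes "s \<in> {rY, 1}"
  shows "Y.G s (Di * a) = Y.G s a / dd s"
  unfolding Di_def Y.G_ymon_mult[OF Y.in_end_points[OF assms]] bnorm_inverse dd_def
  by (simp add: power_int_minus divide_inverse mult_ac)

lemma D_Di: "D * (Di * a) = a"
  using Y.ymon_inverse[OF n_phi_nz, of n] by (simp add: D_def Di_def flip: mult.assoc)

text \<open>The equation \<open>\<Gamma> \<epsilon> \<in> range f\<close> is solved by Newton's method with the linear part \<open>D\<close>; the term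
  \<open>(y d)\<^sup>p\<close>, which is not small compared to \<open>D d\<close>, is absorbed by the image of \<open>f\<close>.\<close>

lemma newton:
  assumes \<rho>: "0 \<le> \<rho>" "\<rho> < 1"
    and \<Gamma>: "\<And>\<epsilon> d s. s \<in> {rY, 1} \<Longrightarrow> (\<And>s. s \<in> {rY, 1} \<Longrightarrow> Y.G s \<epsilon> \<le> \<rho>) \<Longrightarrow>
      (\<And>s. s \<in> {rY, 1} \<Longrightarrow> Y.G s d \<le> \<rho>) \<Longrightarrow>
      Y.G s (\<Gamma> (\<epsilon> + d) - \<Gamma> \<epsilon> - (y * d) ^ M - D * d) \<le> \<rho> * (dd s * Y.G s d)"
    and init: "\<And>s. s \<in> {rY, 1} \<Longrightarrow> Y.G s (\<Gamma> 0 - f b0) \<le> \<rho> * dd s"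
  shows "\<exists>\<epsilon> b. (\<forall>s\<in>{rY, 1}. Y.G s \<epsilon> \<le> \<rho>) \<and> \<Gamma> \<epsilon> = f b"
proof -
  define P where "P k z \<longleftrightarrow> (\<forall>s\<in>{rY, 1}. Y.G s (fst z) \<le> \<rho> \<and>
    Y.G s (\<Gamma> (fst z) - f (snd z)) \<le> \<rho> ^ Suc k * dd s)" for k z
  define Q where "Q k z z' \<longleftrightarrow> (\<forall>s\<in>{rY, 1}. Y.G s (fst z' - fst z) \<le> \<rho> ^ Suc k \<and>
    Y.G s (f (snd z' - snd z)) \<le> \<rho> ^ Suc k)" for k and z z' :: "'a \<times> 'b"
  have pow_le: "\<rho> ^ Suc k \<le> \<rho>" for k
    using \<rho> power_decreasing[of 1 "Suc k" \<rho>] by simp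
  have Gy: "Y.G s (y * a) = s * Y.G s a" if "s \<in> {rY, 1}" for s a
    using Y.G_ymon_mult[OF Y.in_end_points[OF that], of 1 1 a] by (simp add: bnorm_one)
  have "\<exists>z. \<forall>k. P k (z k) \<and> Q k (z k) (z (Suc k))"
  proof (rule dependent_nat_choice)
    have "P 0 (0, b0)" using init \<rho> Y.G_zero[OF Y.in_end_points] by (simp add: P_def)
    then show "\<exists>z. P 0 z" by blast
    fix z k assume "P k z"
    obtain \<epsilon> b where z: "z = (\<epsilon>, b)" by (cases z)
    define w where "w = \<Gamma> \<epsilon> - f b"
    have \<epsilon>: "Y.G s \<epsilon> \<le> \<rho>" and w: "Y.G s w \<le> \<rho> ^ Suc k * dd s" if "s \<in> {rY, 1}" for s
      using \<open>P k z\<close> that by (auto simp: P_def z w_def)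
    define d where "d = - (Di * w)"
    have Dd: "D * d = - w" by (simp add: d_def D_Di)
    have d: "Y.G s d \<le> \<rho> ^ Suc k" if s: "s \<in> {rY, 1}" for s
    proof -
      interpret g: ultra_seminorm "Y.G s" by (rule Y.G_ultra[OF Y.in_end_points[OF s]])
      show ?thesis unfolding d_def g.minus G_Di_mult[OF s] using w[OF s] dd_pos[OF s] by (simp add: pos_divide_le_eq)
    qed
    have d': "Y.G s d \<le> \<rho>" if "s \<in> {rY, 1}" for s using d[OF that] pow_le[of k] by linarith
    have yd: "Y.G s (y * d) \<le> s * \<rho> ^ Suc k" if "s \<in> {rY, 1}" for s
      using d[OF that] s_bounds[OF that] by (simp add: Gy[OF that] mult_left_mono del: power_Suc)
    obtain b' where b': "\<And>s. s \<in> {rY, 1} \<Longrightarrow> Y.G s ((y * d) ^ M - f b') \<le> ell s * (s * \<rho> ^ Suc k) ^ M"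
      using power_approximable[of "y * d" "\<lambda>s. s * \<rho> ^ Suc k"] yd by blast
    have M2: "M \<ge> 2" using prime prime_ge_2_nat by blast
    have pw: "(\<rho> ^ Suc k) ^ M \<le> \<rho> ^ Suc (Suc k)"
    proof -
      have "Suc (Suc k) \<le> Suc k * 2" by simp
      also have "\<dots> \<le> Suc k * M" using M2 by (intro mult_left_mono) auto
      finally show ?thesis unfolding power_mult[symmetric] using \<rho> by (intro power_decreasing) auto
    qed
    have b'': "Y.G s ((y * d) ^ M - f b') \<le> \<rho> ^ Suc (Suc k) * dd s" if s: "s \<in> {rY, 1}" for s
    proof -
      have "ell s * (s * \<rho> ^ Suc k) ^ M = dd s * (\<rho> ^ Suc k) ^ M"
        using dd_eq[OF s] by (simp add: power_mult_distrib)
      also have "\<dots> \<le> dd s * \<rho> ^ Suc (Suc k)" using pw dd_pos[OF s] by (intro mult_left_mono) auto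
      finally show ?thesis using b'[OF s] by (simp add: mult.commute)
    qed
    have "P (Suc k) (\<epsilon> + d, b + b')"
      unfolding P_def
    proof (intro ballI conjI)
      fix s assume s: "s \<in> {rY, 1}"
      interpret g: ultra_seminorm "Y.G s" by (rule Y.G_ultra[OF Y.in_end_points[OF s]])
      show "Y.G s (fst (\<epsilon> + d, b + b')) \<le> \<rho>" using g.add_le[OF \<epsilon>[OF s] d'[OF s]] by simp
      have eq: "\<Gamma> (\<epsilon> + d) - f (b + b')
          = (\<Gamma> (\<epsilon> + d) - \<Gamma> \<epsilon> - (y * d) ^ M - D * d) + ((y * d) ^ M - f b')"
        by (simp add: Dd w_def f_simps)
      have "Y.G s (\<Gamma> (\<epsilon> + d) - \<Gamma> \<epsilon> - (y * d) ^ M - D * d) \<le> \<rho> ^ Suc (Suc k) * dd s"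
      proof -
        have "\<rho> * (dd s * Y.G s d) \<le> \<rho> * (dd s * \<rho> ^ Suc k)"
          using \<rho> dd_pos[OF s] d[OF s] by (intro mult_left_mono) auto
        then show ?thesis using \<Gamma>[OF s \<epsilon> d'] by (simp add: mult_ac)
      qed
      then show "Y.G s (\<Gamma> (fst (\<epsilon> + d, b + b')) - f (snd (\<epsilon> + d, b + b'))) \<le> \<rho> ^ Suc (Suc k) * dd s"
        unfolding fst_conv snd_conv eq using b''[OF s] by (rule g.add_le)
    qed
    moreover have "Q k z (\<epsilon> + d, b + b')"
      unfolding Q_def
    proof (intro ballI conjI)
      fix s assume s: "s \<in> {rY, 1}"
      interpret g: ultra_seminorm "Y.G s" by (rule Y.G_ultra[OF Y.in_end_points[OF s]])
      show "Y.G s (fst (\<epsilon> + d, b + b') - fst z) \<le> \<rho> ^ Suc k" using d[OF s] by (simp add: z)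
      have le: "\<rho> ^ Suc (Suc k) \<le> \<rho> ^ Suc k" using \<rho> by (intro power_decreasing) auto
      have "(s * \<rho> ^ Suc k) ^ M \<le> \<rho> ^ Suc k"
      proof -
        have "s ^ M * (\<rho> ^ Suc k) ^ M \<le> 1 * \<rho> ^ Suc k"
          using sM[OF s] pw le \<rho> by (intro mult_mono) (auto simp del: power_Suc)
        then show ?thesis by (simp add: power_mult_distrib)
      qed
      then have 1: "Y.G s ((y * d) ^ M) \<le> \<rho> ^ Suc k"
        using g.power_le_power[OF yd[OF s], of M] by linarith
      have "\<rho> ^ Suc (Suc k) * dd s \<le> \<rho> ^ Suc (Suc k) * 1"
        using dd_le_1[OF s] \<rho> by (intro mult_left_mono) auto
      then have 2: "Y.G s ((y * d) ^ M - f b') \<le> \<rho> ^ Suc k" using b''[OF s] le by linarith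
      show "Y.G s (f (snd (\<epsilon> + d, b + b') - snd z)) \<le> \<rho> ^ Suc k"
        using g.diff_le[OF 1 2] by (simp add: z)
    qed
    ultimately show "\<exists>z'. P (Suc k) z' \<and> Q k z z'" by blast
  qed
  then obtain z where z: "\<And>k. P k (z k)" "\<And>k. Q k (z k) (z (Suc k))" by blast
  obtain \<epsilon> where \<epsilon>: "\<And>s k. s \<in> {rY, 1} \<Longrightarrow> Y.G s (\<epsilon> - fst (z k)) \<le> \<rho> ^ Suc k"
    using Y.geometric_limit[OF \<rho>, of "\<lambda>k. fst (z k)"] z(2) unfolding Q_def by blast
  have step: "X.G s (snd (z (Suc k)) - snd (z k)) \<le> \<rho> ^ Suc k" if "s \<in> {rX, 1}" for s k
  proof -
    have "X.G s a = Y.G (if s = 1 then 1 else rY) (f a)" for a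
      using that G_f[of rY a] G_f[of 1 a] by (auto simp: rX_eq)
    then show ?thesis using z(2)[of k] unfolding Q_def by auto
  qed
  obtain b where b: "\<And>s k. s \<in> {rX, 1} \<Longrightarrow> X.G s (b - snd (z k)) \<le> \<rho> ^ Suc k"
    using X.geometric_limit[OF \<rho>, of "\<lambda>k. snd (z k)"] step by blast
  have b': "Y.G s (f (snd (z k) - b)) \<le> \<rho> ^ Suc k" if s: "s \<in> {rY, 1}" for s k
  proof -
    have s': "s ^ M \<in> {rX, 1}" using s by (auto simp: rX_eq)
    interpret g: ultra_seminorm "X.G (s ^ M)" by (rule X.G_ultra[OF X.in_end_points[OF s']])
    show ?thesis using b[OF s', of k] g.diff_commute by (simp add: G_f[OF s])
  qed
  have fin: "Y.G s \<epsilon> \<le> \<rho>" if s: "s \<in> {rY, 1}" for s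
  proof -
    interpret g: ultra_seminorm "Y.G s" by (rule Y.G_ultra[OF Y.in_end_points[OF s]])
    have "Y.G s (fst (z 0)) \<le> \<rho>" using z(1)[of 0] s unfolding P_def by blast
    then show ?thesis using g.add_le[of "\<epsilon> - fst (z 0)" \<rho> "fst (z 0)"] \<epsilon>[OF s, of 0] by simp
  qed
  have "Y.G 1 (\<Gamma> \<epsilon> - f b) \<le> \<rho> ^ Suc k" for k
  proof -
    have s: "(1::real) \<in> {rY, 1}" by simp
    interpret g: ultra_seminorm "Y.G 1" by (rule Y.G_ultra[OF Y.end_points(2)])
    define a where "a = fst (z k)"
    define d where "d = \<epsilon> - a"
    have a: "Y.G s a \<le> \<rho>" "Y.G s (\<Gamma> a - f (snd (z k))) \<le> \<rho> ^ Suc k * dd s" if "s \<in> {rY, 1}" for s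
      using z(1)[of k] that by (auto simp: P_def a_def)
    have d: "Y.G s d \<le> \<rho> ^ Suc k" "Y.G s d \<le> \<rho>" if "s \<in> {rY, 1}" for s
      using \<epsilon>[OF that, of k] pow_le[of k] by (auto simp: d_def a_def simp del: power_Suc)
    have dG: "dd 1 * Y.G 1 d \<le> \<rho> ^ Suc k"
    proof -
      have "dd 1 * Y.G 1 d \<le> 1 * \<rho> ^ Suc k"
        using dd_le_1[OF s] dd_pos[OF s] d(1)[OF s] by (intro mult_mono g.nonneg) auto
      then show ?thesis by simp
    qed
    have "Y.G 1 (\<Gamma> (a + d) - \<Gamma> a - (y * d) ^ M - D * d) \<le> \<rho> * (dd 1 * Y.G 1 d)"
      using \<Gamma>[OF s a(1) d(2)] .
    also have "\<dots> \<le> 1 * (dd 1 * Y.G 1 d)"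
      using \<rho> dd_pos[OF s] by (intro mult_right_mono) (auto simp: g.nonneg)
    finally have 1: "Y.G 1 (\<Gamma> (a + d) - \<Gamma> a - (y * d) ^ M - D * d) \<le> \<rho> ^ Suc k" using dG by linarith
    have 2: "Y.G 1 (D * d) \<le> \<rho> ^ Suc k" using dG by (simp add: G_D_mult)
    have 3: "Y.G 1 ((y * d) ^ M) \<le> \<rho> ^ Suc k"
    proof -
      have "Y.G 1 ((y * d) ^ M) \<le> (\<rho> ^ Suc k) ^ M"
        using d(1)[OF s] by (intro g.power_le_power) (simp add: Gy)
      also have "\<dots> \<le> (\<rho> ^ Suc k) ^ 1"
        using \<rho> M by (intro power_decreasing) (auto simp: power_le_one mult_le_one)
      finally show ?thesis by simp
    qed
    have 4: "Y.G 1 (\<Gamma> a - f (snd (z k))) \<le> \<rho> ^ Suc k"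
    proof -
      have "\<rho> ^ Suc k * dd 1 \<le> \<rho> ^ Suc k * 1" using dd_le_1[OF s] \<rho> by (intro mult_left_mono) auto
      then show ?thesis using a(2)[OF s] by simp
    qed
    have "\<Gamma> \<epsilon> - f b = ((\<Gamma> (a + d) - \<Gamma> a - (y * d) ^ M - D * d) + ((y * d) ^ M + D * d))
        + ((\<Gamma> a - f (snd (z k))) + f (snd (z k) - b))"
      by (simp add: d_def f_simps)
    then show ?thesis using 1 2 3 4 b'[OF s, of k] by (simp only: g.add_le)
  qed
  moreover have "(\<lambda>k. \<rho> ^ Suc k) \<longlonglongrightarrow> 0" using \<rho> by (intro LIMSEQ_Suc LIMSEQ_realpow_zero)
  ultimately have "Y.G 1 (\<Gamma> \<epsilon> - f b) \<le> 0" by (meson LIMSEQ_le_const)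
  then have "\<Gamma> \<epsilon> - f b = 0"
    using Y.G_eq_0_iff[OF Y.end_points(2)] Y.G_nonneg[OF Y.end_points(2)] by (meson order_antisym)
  then show ?thesis using fin by auto
qed

definition part :: "(int \<Rightarrow> bool) \<Rightarrow> 'a" where
  "part A = Y.ev (\<lambda>i. if A i then \<phi> i else 0)"

lemma lcoeff_part: "Y.lcoeff (part A) i = (if A i then \<phi> i else 0)"
proof -
  have "(\<lambda>i. if A i then \<phi> i else 0) \<in> laurent_algebra rY"
    by (rule laurent_algebra_dominated[OF Y.lcoeff_in[of "f x"] Y.r_pos, of _ 1]) (simp add: bn.nonneg)
  from Y.lcoeff_eqI[OF this refl] show ?thesis by (simp add: part_def)
qed

definition \<Gamma> :: "'a \<Rightarrow> 'a" where
  "\<Gamma> \<epsilon> = Y.ymon 1 (int M) * (1 + \<epsilon>) ^ M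
    + (if n = int M then 0 else Y.ymon (\<phi> n) n * unit_powi (1 + \<epsilon>) n)"

lemma \<Gamma>_0: "\<Gamma> 0 = f x - part (\<lambda>i. int M dvd i \<and> i \<noteq> int M) - part (\<lambda>i. \<not> int M dvd i \<and> i \<noteq> n)"
proof (rule Y.lcoeff_inject)
  fix i
  have "unit_powi (1::'a) n = 1" using Y.unit_powi_ymon[of 1 0 n] by simp
  then have "\<Gamma> 0 = Y.ymon 1 (int M) + (if n = int M then 0 else Y.ymon (\<phi> n) n)" by (simp add: \<Gamma>_def)
  then show "Y.lcoeff (\<Gamma> 0) i
      = Y.lcoeff (f x - part (\<lambda>i. int M dvd i \<and> i \<noteq> int M) - part (\<lambda>i. \<not> int M dvd i \<and> i \<noteq> n)) i"
    using n_cases lead by (auto simp: Y.lcoeff_add Y.lcoeff_diff Y.lcoeff_ymon lcoeff_part)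
qed

lemma \<Gamma>_linearization:
  assumes s: "s \<in> {rY, 1}" and \<rho>: "0 \<le> \<rho>" "\<rho> < 1"
    and \<epsilon>: "\<And>s. s \<in> {rY, 1} \<Longrightarrow> Y.G s \<epsilon> \<le> \<rho>" and d: "\<And>s. s \<in> {rY, 1} \<Longrightarrow> Y.G s d \<le> \<rho>"
    and p: "n \<noteq> int M \<Longrightarrow> bnorm (of_nat M :: 'k) * s ^ M \<le> \<rho> * dd s"
  shows "Y.G s (\<Gamma> (\<epsilon> + d) - \<Gamma> \<epsilon> - (y * d) ^ M - D * d) \<le> \<rho> * (dd s * Y.G s d)"
proof -
  note s' = Y.in_end_points[OF s]
  interpret g: ultra_seminorm "Y.G s" by (rule Y.G_ultra[OF s'])
  let ?Y = "Y.ymon 1 (int M)"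
  define w where "w = 1 + \<epsilon>"
  have w: "Y.G s (w - 1) \<le> \<rho>" "1 + (\<epsilon> + d) = w + d" using \<epsilon>[OF s] by (simp_all add: w_def)
  have w1: "Y.G s w \<le> 1" using g.close_one[OF w(1)] \<rho> by simp
  have d1: "Y.G s d \<le> 1" using d[OF s] \<rho> by simp
  have yd: "(y * d) ^ M = ?Y * d ^ M" by (simp add: power_mult_distrib Y.ymon_def unit_powi_of_nat)
  have GY: "Y.G s (?Y * a) = s ^ M * Y.G s a" for a by (simp add: Y.G_ymon_mult[OF s'] bnorm_one)
  have pM: "Y.G s (of_nat M) = bnorm (of_nat M :: 'k)" by (rule Y.G_of_nat[OF s'])
  show ?thesis
  proof (cases "n = int M")
    case True
    have "D * d = ?Y * (of_nat M * d)"
      using ring_hom_type_of_nat[OF Y.hom, of M] unfolding D_def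
      by (simp add: True lead Y.ymon_def mult_ac)
    then have "\<Gamma> (\<epsilon> + d) - \<Gamma> \<epsilon> - (y * d) ^ M - D * d
        = ?Y * ((w + d) ^ M - w ^ M - d ^ M - of_nat M * d)"
      unfolding \<Gamma>_def yd w(2) using True by (simp add: w_def[symmetric] algebra_simps)
    moreover have "s ^ M * Y.G s ((w + d) ^ M - w ^ M - d ^ M - of_nat M * d)
        \<le> s ^ M * (bnorm (of_nat M :: 'k) * (\<rho> * Y.G s d))"
      using g.prime_power_diff(2)[OF prime w1 d1 w(1) d[OF s]] sM(1)[OF s] by (simp add: pM)
    ultimately show ?thesis unfolding dd_eq_p[OF True] by (simp add: GY mult_ac)
  next
    case False
    have unit: "(1 + a) dvd 1" if "\<And>s. s \<in> {rY, 1} \<Longrightarrow> Y.G s a \<le> \<rho>" for a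
      using Y.one_plus_dvd[of a] that \<rho>(2) le_less_trans by blast
    have "Y.G s (\<epsilon> + d) \<le> \<rho>" if s: "s \<in> {rY, 1}" for s
    proof -
      interpret g: ultra_seminorm "Y.G s" by (rule Y.G_ultra[OF Y.in_end_points[OF s]])
      show ?thesis by (rule g.add_le[OF \<epsilon>[OF s] d[OF s]])
    qed
    then have units: "w dvd 1" "(w + d) dvd 1"
      using unit[OF \<epsilon>] unit[of "\<epsilon> + d"] by (simp_all add: w_def add.assoc)
    have "D * d = Y.ymon (\<phi> n) n * (of_int n * d)"
      using ring_hom_type_of_int[OF Y.hom, of n] by (simp add: D_def Y.ymon_def mult_ac)
    then have eq: "\<Gamma> (\<epsilon> + d) - \<Gamma> \<epsilon> - (y * d) ^ M - D * d
        = ?Y * ((w + d) ^ M - w ^ M - d ^ M)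
          + Y.ymon (\<phi> n) n * (unit_powi (w + d) n - unit_powi w n - of_int n * d)"
      unfolding \<Gamma>_def yd w(2) using False by (simp add: w_def[symmetric] algebra_simps)
    have 1: "Y.G s (?Y * ((w + d) ^ M - w ^ M - d ^ M)) \<le> \<rho> * (dd s * Y.G s d)"
    proof -
      have "s ^ M * Y.G s ((w + d) ^ M - w ^ M - d ^ M) \<le> s ^ M * (bnorm (of_nat M :: 'k) * Y.G s d)"
        using g.prime_power_diff(1)[OF prime w1 d1] sM(1)[OF s] by (simp add: pM)
      also have "\<dots> \<le> \<rho> * dd s * Y.G s d"
        using mult_right_mono[OF p[OF False] g.nonneg[of d]] by (simp add: mult_ac)
      finally show ?thesis by (simp add: GY mult.assoc)
    qed
    have dd: "dd s = bnorm (\<phi> n) * s powi n" by (simp add: dd_def bnorm_mult bnorm_n[OF False])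
    have 2: "Y.G s (Y.ymon (\<phi> n) n * (unit_powi (w + d) n - unit_powi w n - of_int n * d))
        \<le> \<rho> * (dd s * Y.G s d)"
    proof -
      have "dd s * Y.G s (unit_powi (w + d) n - unit_powi w n - of_int n * d) \<le> dd s * (\<rho> * Y.G s d)"
        using g.unit_powi_diff_linear[OF units w(1) d[OF s] \<rho>(2)] dd_pos[OF s] by (intro mult_left_mono) auto
      then show ?thesis by (simp add: Y.G_ymon_mult[OF s'] dd mult_ac)
    qed
    show ?thesis unfolding eq by (rule g.add_le[OF 1 2])
  qed
qed

lemma solution:
  obtains \<rho> \<epsilon> b where "\<kappa> \<le> \<rho>" "\<rho> < 1" "\<And>s. s \<in> {rY, 1} \<Longrightarrow> Y.G s \<epsilon> \<le> \<rho>" "\<Gamma> \<epsilon> = f b"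
proof -
  define P where "P = part (\<lambda>i. int M dvd i \<and> i \<noteq> int M)"
  define T where "T = part (\<lambda>i. \<not> int M dvd i \<and> i \<noteq> n)"
  have GP: "Y.G s P \<le> \<kappa> * s ^ M" if s: "s \<in> {rY, 1}" for s
    using phi_le[OF s] \<kappa>_nonneg sM(1)[OF s]
    by (intro Y.G_le[OF Y.in_end_points[OF s]]) (simp add: P_def lcoeff_part)
  have G\<theta>P: "Y.G s (Y.theta P) \<le> ell s * (\<kappa> * s ^ M)" if s: "s \<in> {rY, 1}" for s
  proof (rule Y.G_le[OF Y.in_end_points[OF s]])
    fix i
    show "bnorm (Y.lcoeff (Y.theta P) i) * s powi i \<le> ell s * (\<kappa> * s ^ M)"
    proof (cases "int M dvd i \<and> i \<noteq> int M")
      case True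
      have "bnorm (of_int i :: 'k) * (bnorm (\<phi> i) * s powi i) \<le> ell s * (\<kappa> * s ^ M)"
      proof (rule mult_mono)
        show "bnorm (of_int i :: 'k) \<le> ell s"
          using bnorm_of_int_dvd[of M i] True p_le_ell[OF s] order_trans by blast
        show "bnorm (\<phi> i) * s powi i \<le> \<kappa> * s ^ M" using phi_le[OF s] True by blast
        show "0 \<le> bnorm (\<phi> i) * s powi i"
          using Y.powi_pos[OF Y.in_end_points[OF s], of i] by (simp add: bn.nonneg)
      qed (use ell_pos[OF s] in simp)
      then show ?thesis using True by (simp add: Y.lcoeff_theta P_def lcoeff_part bnorm_mult mult.assoc)
    next
      case False
      then have "Y.lcoeff (Y.theta P) i = 0" by (auto simp: Y.lcoeff_theta P_def lcoeff_part)
      then show ?thesis using ell_pos[OF s] \<kappa>_nonneg sM(1)[OF s] by simp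
    qed
  qed
  obtain b1 where b1: "\<And>s. s \<in> {rY, 1} \<Longrightarrow> Y.G s (P - f b1) \<le> ell s * (\<kappa> * s ^ M)"
    using approximable[of P "\<lambda>s. \<kappa> * s ^ M"] GP G\<theta>P by blast
  have GT: "Y.G s T < dd s" if s: "s \<in> {rY, 1}" for s
  proof (rule Y.G_less[OF Y.in_end_points[OF s]])
    fix i
    show "bnorm (Y.lcoeff T i) * s powi i < dd s"
    proof (cases "\<not> int M dvd i \<and> i \<noteq> n")
      case True
      then have "bnorm (\<phi> i) * s powi i < dd s"
        using dom[OF s, of i] bnorm_of_int_coprime[OF prime res, of i] unfolding bnorm_mult dd_def by simp
      then show ?thesis using True by (simp add: T_def lcoeff_part)
    next
      case False
      then have "Y.lcoeff T i = 0" by (auto simp: T_def lcoeff_part)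
      then show ?thesis using dd_pos[OF s] by simp
    qed
  qed
  define q where "q s = max (Y.G s T) (if n = int M then 0 else bnorm (of_nat M :: 'k) * s ^ M) / dd s" for s
  define \<rho> where "\<rho> = max \<kappa> (max (q rY) (q 1))"
  have q1: "q s < 1" if "s \<in> {rY, 1}" for s
  proof -
    have "(if n = int M then 0 else bnorm (of_nat M :: 'k) * s ^ M) < dd s"
      using p_less[OF that] dd_pos[OF that] by metis
    then show ?thesis using GT[OF that] dd_pos[OF that] by (simp add: q_def pos_divide_less_eq del: if_split)
  qed
  have \<rho>: "\<kappa> \<le> \<rho>" "\<rho> < 1" "0 \<le> \<rho>" using \<kappa> \<kappa>_nonneg q1 by (auto simp: \<rho>_def le_max_iff_disj)
  have q: "max (Y.G s T) (if n = int M then 0 else bnorm (of_nat M :: 'k) * s ^ M) \<le> \<rho> * dd s"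
    if s: "s \<in> {rY, 1}" for s
  proof -
    have "q s \<le> \<rho>" using s by (auto simp: \<rho>_def)
    then show ?thesis using dd_pos[OF s] unfolding q_def by (simp only: pos_divide_le_eq)
  qed
  have "\<exists>\<epsilon> b. (\<forall>s\<in>{rY, 1}. Y.G s \<epsilon> \<le> \<rho>) \<and> \<Gamma> \<epsilon> = f b"
  proof (rule newton[OF \<rho>(3,2)])
    fix \<epsilon> d s assume s: "s \<in> {rY, 1}" and a: "\<And>s. s \<in> {rY, 1} \<Longrightarrow> Y.G s \<epsilon> \<le> \<rho>"
      "\<And>s. s \<in> {rY, 1} \<Longrightarrow> Y.G s d \<le> \<rho>"
    show "Y.G s (\<Gamma> (\<epsilon> + d) - \<Gamma> \<epsilon> - (y * d) ^ M - D * d) \<le> \<rho> * (dd s * Y.G s d)"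
      using q[OF s] by (intro \<Gamma>_linearization[OF s \<rho>(3,2) a]) auto
  next
    fix s assume s: "s \<in> {rY, 1}"
    interpret g: ultra_seminorm "Y.G s" by (rule Y.G_ultra[OF Y.in_end_points[OF s]])
    have "\<kappa> * dd s \<le> \<rho> * dd s" using \<rho>(1) dd_pos[OF s] by (intro mult_right_mono) auto
    then have 1: "Y.G s (P - f b1) \<le> \<rho> * dd s" using b1[OF s] dd_eq[OF s] by (simp add: mult_ac)
    have 2: "Y.G s T \<le> \<rho> * dd s" using q[OF s] by simp
    have eq: "\<Gamma> 0 - f (x - b1) = - ((P - f b1) + T)" by (simp add: \<Gamma>_0 P_def T_def f_simps)
    show "Y.G s (\<Gamma> 0 - f (x - b1)) \<le> \<rho> * dd s" unfolding eq g.minus by (rule g.add_le[OF 1 2])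
  qed
  then show thesis using that[OF \<rho>(1,2)] by blast
qed

lemma normal_form:
  "\<exists>x' y'. annulus \<iota>X rX x' \<and> annulus \<iota>Y rY y' \<and>
    (\<forall>s\<in>{rX, 1}. gauss_point \<iota>X rX x' s = X.G s) \<and> (\<forall>s\<in>{rY, 1}. gauss_point \<iota>Y rY y' s = Y.G s) \<and>
    f x' = laurent_eval \<iota>Y y' (\<lambda>i. lmonom 1 (int M) i + (if n = int M then 0 else lmonom (\<phi> n) n i))"
proof -
  obtain \<rho> \<epsilon> b where \<rho>: "\<kappa> \<le> \<rho>" "\<rho> < 1" and \<epsilon>: "\<And>s. s \<in> {rY, 1} \<Longrightarrow> Y.G s \<epsilon> \<le> \<rho>" and b: "\<Gamma> \<epsilon> = f b"
    by (rule solution) (rule that, assumption+)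
  have unit: "(1 + \<epsilon>) dvd 1" using Y.one_plus_dvd[of \<epsilon>] \<epsilon> \<rho>(2) le_less_trans by blast
  define y' where "y' = Y.ymon 1 1 * (1 + \<epsilon>)"
  have \<epsilon>': "Y.G s (1 + \<epsilon> - 1) \<le> \<rho>" if "s \<in> {rY, 1}" for s using \<epsilon>[OF that] by simp
  have y': "annulus \<iota>Y rY y'" "\<And>s a. s \<in> {rY, 1} \<Longrightarrow> gauss_point \<iota>Y rY y' s a = Y.G s a"
    using Y.coordinate_change[OF bnorm_one unit \<epsilon>' \<rho>(2) y'_def] by blast+
  have powi: "unit_powi y' i = unit_powi y i * unit_powi (1 + \<epsilon>) i" for i
    by (simp add: y'_def unit_powi_mult_distrib[OF Y.unit_y unit])
  have "laurent_eval \<iota>Y y' (\<lambda>i. lmonom 1 (int M) i + (if n = int M then 0 else lmonom (\<phi> n) n i))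
      = (\<Sum>i\<in>{int M, n}. \<iota>Y (lmonom 1 (int M) i + (if n = int M then 0 else lmonom (\<phi> n) n i)) * unit_powi y' i)"
    unfolding laurent_eval_def by (rule infsum_finite_support) (auto simp: lmonom_def)
  also have "\<dots> = \<Gamma> \<epsilon>"
    by (simp add: \<Gamma>_def lmonom_def powi Y.ymon_def unit_powi_of_nat mult.assoc)
  finally have fb: "f b = laurent_eval \<iota>Y y' (\<lambda>i. lmonom 1 (int M) i + (if n = int M then 0 else lmonom (\<phi> n) n i))"
    by (simp add: b)
  define w where "w = unit_powi x (- 1) * b"
  have close: "Y.G s (f (w - 1)) \<le> \<rho>" if s: "s \<in> {rY, 1}" for s
  proof -
    note s' = Y.in_end_points[OF s]
    interpret g: ultra_seminorm "Y.G s" by (rule Y.G_ultra[OF s'])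
    have inv: "unit_powi (f x) (- 1) * f x = 1"
      using unit_powi_inverse[OF f_x_unit, of 1] by (simp add: mult.commute)
    have "f (w - 1) = unit_powi (f x) (- 1) * f b - 1"
      by (simp add: w_def f_simps ring_hom_type_unit_powi[OF f_hom X.unit_y])
    also have "\<dots> = unit_powi (f x) (- 1) * (\<Gamma> \<epsilon> - f x)" by (simp add: b right_diff_distrib inv)
    finally have eq: "f (w - 1) = unit_powi (f x) (- 1) * (\<Gamma> \<epsilon> - f x)" .
    have Ginv: "Y.G s (unit_powi (f x) (- 1)) \<le> inverse (s ^ M)"
      using G_powi_fx[OF _ fx t \<kappa> t1 s, of "- 1"] by (simp add: bnorm_one power_int_minus)
    have 1: "Y.G s (Y.ymon 1 (int M) * ((1 + \<epsilon>) ^ M - 1)) \<le> \<rho> * s ^ M"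
      using g.close_one_power[OF \<epsilon>'[OF s], of M] \<rho>(2) sM(1)[OF s]
      by (simp add: Y.G_ymon_mult[OF s'] bnorm_one mult.commute)
    have 2: "Y.G s (if n = int M then 0 else Y.ymon (\<phi> n) n * unit_powi (1 + \<epsilon>) n) \<le> \<rho> * s ^ M"
    proof (cases "n = int M")
      case True
      then show ?thesis using \<rho>(1) \<kappa>_nonneg sM(1)[OF s] by (simp add: g.zero)
    next
      case False
      have "Y.G s (unit_powi (1 + \<epsilon>) n) \<le> 1"
        using g.close_one[OF Y.close_powi[OF unit \<epsilon>' \<rho>(2) s]] \<rho>(2) by simp
      then have "Y.G s (Y.ymon (\<phi> n) n * unit_powi (1 + \<epsilon>) n) \<le> (bnorm (\<phi> n) * s powi n) * 1"
        by (intro g.mult_le) (simp_all add: Y.G_ymon[OF s'])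
      also have "\<dots> \<le> \<rho> * s ^ M"
        using phi_le[OF s False] mult_right_mono[OF \<rho>(1), of "s ^ M"] sM(1)[OF s] by linarith
      finally show ?thesis using False by simp
    qed
    have 3: "Y.G s (Y.ymon 1 (int M) * (t - 1)) \<le> \<rho> * s ^ M"
    proof -
      have "s ^ M * Y.G s (t - 1) \<le> s ^ M * \<rho>"
        using t1[OF s] \<rho>(1) sM(1)[OF s] by (intro mult_left_mono) auto
      then show ?thesis unfolding Y.G_ymon_mult[OF s'] bnorm_one by (simp add: mult.commute)
    qed
    have "\<Gamma> \<epsilon> - f x = (Y.ymon 1 (int M) * ((1 + \<epsilon>) ^ M - 1)
        + (if n = int M then 0 else Y.ymon (\<phi> n) n * unit_powi (1 + \<epsilon>) n)) - Y.ymon 1 (int M) * (t - 1)"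
      unfolding \<Gamma>_def fx by (simp only: right_diff_distrib mult_1_right) simp
    then have "Y.G s (\<Gamma> \<epsilon> - f x) \<le> \<rho> * s ^ M" using g.diff_le[OF g.add_le[OF 1 2] 3] by simp
    from g.mult_le[OF Ginv this]
    have "Y.G s (f (w - 1)) \<le> (inverse (s ^ M) * s ^ M) * \<rho>" unfolding eq by (simp only: mult_ac)
    moreover have "inverse (s ^ M) * s ^ M = 1" using sM(1)[OF s] by (intro left_inverse) linarith
    ultimately show ?thesis by simp
  qed
  have w1: "X.G s (w - 1) \<le> \<rho>" if "s \<in> {rX, 1}" for s
  proof -
    have "X.G s (w - 1) = Y.G (if s = 1 then 1 else rY) (f (w - 1))"
      using that G_f[of rY "w - 1"] G_f[of 1 "w - 1"] by (auto simp: rX_eq)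
    also have "\<dots> \<le> \<rho>" by (rule close) auto
    finally show ?thesis .
  qed
  have w_unit: "w dvd 1" using X.one_plus_dvd[of "w - 1"] le_less_trans[OF w1 \<rho>(2)] by simp
  have "b = X.ymon 1 1 * w"
    using unit_powi_inverse[OF X.unit_y, of 1] by (simp add: w_def flip: mult.assoc)
  from X.coordinate_change[OF bnorm_one w_unit w1 \<rho>(2) this]
  have "annulus \<iota>X rX b" "\<And>s a. s \<in> {rX, 1} \<Longrightarrow> gauss_point \<iota>X rX b s a = X.G s a" by blast+
  then show ?thesis using y' fb by (intro exI[of _ b] exI[of _ y'] conjI ballI ext)
qed

end


section \<open>Dominant terms\<close>

context annulus
begin

lemma spectral_norm_ymon: "spectral_norm (ymon c m) = bnorm c * max 1 (r powi m)"
proof -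
  define S where "S = bnorm c * max 1 (r powi m)"
  have S0: "0 \<le> S" by (simp add: S_def bn.nonneg)
  have max_pow: "max (G r (ymon c m ^ k)) (G 1 (ymon c m ^ k)) = S ^ k" for k
  proof -
    have G_pow: "G s (ymon c m ^ k) = (bnorm c * s powi m) ^ k" if "s \<in> {r..1}" for s
      unfolding ymon_power G_ymon[OF that] by (simp add: bnorm_power power_mult_distrib power_int_mult)
    define a where "a = bnorm c * r powi m"
    have a0: "0 \<le> a" using r_pos by (simp add: a_def bn.nonneg)
    have "max (a ^ k) (bnorm c ^ k) = max a (bnorm c) ^ k"
    proof (cases "a \<le> bnorm c")
      case True
      then show ?thesis using power_mono[OF True a0, of k] by (simp add: max_def)
    next
      case False
      then have "bnorm c ^ k \<le> a ^ k" by (intro power_mono bn.nonneg) simp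
      then show ?thesis using False by (simp add: max_def)
    qed
    moreover have "S = max a (bnorm c)"
      by (simp add: S_def a_def max_mult_distrib_left bn.nonneg max.commute)
    ultimately show ?thesis
      unfolding G_pow[OF end_points(1)] G_pow[OF end_points(2)] by (simp add: a_def)
  qed
  have up: "bnorm (ymon c m ^ k) \<le> CC * S ^ k" for k
    using bnorm_le_CC[of "ymon c m ^ k"] unfolding max_pow .
  have lo: "inverse CC * S ^ k \<le> bnorm (ymon c m ^ k)" for k
    using max_le_CC[of "ymon c m ^ k"] CC_pos unfolding max_pow by (simp add: field_simps)
  have "(\<lambda>k. root k (bnorm (ymon c m ^ k))) \<longlonglongrightarrow> S"
  proof (rule tendsto_sandwich)
    show "eventually (\<lambda>k. root k (inverse CC) * S \<le> root k (bnorm (ymon c m ^ k))) sequentially"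
      using eventually_gt_at_top[of 0]
    proof eventually_elim
      case (elim k)
      then show ?case
        using real_root_le_mono[OF elim lo[of k]] S0 by (simp add: real_root_mult real_root_power_cancel)
    qed
    show "eventually (\<lambda>k. root k (bnorm (ymon c m ^ k)) \<le> root k CC * S) sequentially"
      using eventually_gt_at_top[of 0]
    proof eventually_elim
      case (elim k)
      then show ?case
        using real_root_le_mono[OF elim up[of k]] S0 by (simp add: real_root_mult real_root_power_cancel)
    qed
    show "(\<lambda>k. root k (inverse CC) * S) \<longlonglongrightarrow> S"
      using tendsto_mult_right[OF LIMSEQ_root_const, of "inverse CC" S] CC_pos by simp
    show "(\<lambda>k. root k CC * S) \<longlonglongrightarrow> S"
      using tendsto_mult_right[OF LIMSEQ_root_const, of CC S] CC_pos by simp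
  qed
  then show ?thesis unfolding spectral_norm_def S_def by (rule limI)
qed

lemma strictly_dominates_ymon:
  "strictly_dominates (ymon a n) (ymon b i) \<longleftrightarrow>
    a \<noteq> 0 \<and> (\<forall>s\<in>{r, 1}. bnorm b * s powi i < bnorm a * s powi n)"
proof (cases "a = 0")
  case True
  then show ?thesis by (simp add: strictly_dominates_def)
next
  case False
  then have apos: "0 < bnorm a" by (simp add: bnorm_pos_iff)
  have "ring_inverse (ymon a n) = ymon (inverse a) (- n)"
    by (rule ring_inverse_eq[OF ymon_inverse[OF False]])
  then have "spectral_norm (ymon b i * ring_inverse (ymon a n)) = bnorm b * inverse (bnorm a) * max 1 (r powi (i - n))"
    by (simp add: ymon_mult spectral_norm_ymon bnorm_mult bnorm_inverse)
  also have "\<dots> < 1 \<longleftrightarrow> (\<forall>s\<in>{r, 1}. bnorm b * s powi i < bnorm a * s powi n)"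
  proof -
    have "r powi i = r powi (i - n) * r powi n" using r_pos by (simp flip: power_int_add)
    moreover have "0 < r powi n" using r_pos by simp
    ultimately have "bnorm b * r powi i < bnorm a * r powi n \<longleftrightarrow> bnorm b * r powi (i - n) < bnorm a"
      by (simp only: mult.assoc[symmetric] mult_less_cancel_right_pos)
    moreover have "bnorm b * inverse (bnorm a) * max 1 (r powi (i - n)) < 1
        \<longleftrightarrow> bnorm b * inverse (bnorm a) * 1 < 1 \<and> bnorm b * inverse (bnorm a) * r powi (i - n) < 1"
    proof -
      have "0 \<le> bnorm b * inverse (bnorm a)" using apos by (simp add: bn.nonneg)
      then have "bnorm b * inverse (bnorm a) * max 1 (r powi (i - n))
          = max (bnorm b * inverse (bnorm a) * 1) (bnorm b * inverse (bnorm a) * r powi (i - n))"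
        by (simp only: max_mult_distrib_left if_True)
      then show ?thesis by (simp only: max_less_iff_conj)
    qed
    ultimately show ?thesis using apos by (auto simp: field_simps)
  qed
  finally show ?thesis using False ymon_dvd[OF False] by (simp add: strictly_dominates_def)
qed

lemma dominant_index_iff:
  "dominant_index \<iota> y c n \<longleftrightarrow>
    c n \<noteq> 0 \<and> (\<forall>i s. i \<noteq> n \<longrightarrow> s \<in> {r, 1} \<longrightarrow> bnorm (c i) * s powi i < bnorm (c n) * s powi n)"
proof -
  have "\<exists>i. i \<noteq> n" by (intro exI[of _ "n + 1"]) simp
  then show ?thesis
    unfolding dominant_index_def ymon_def[symmetric] strictly_dominates_ymon by blast
qed

lemma dominant_index_lderiv_iff:
  "dominant_index \<iota> y (lderiv c) (n - 1) \<longleftrightarrow> of_int n * c n \<noteq> 0 \<and>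
    (\<forall>i s. i \<noteq> n \<longrightarrow> s \<in> {r, 1} \<longrightarrow> bnorm (of_int i * c i) * s powi i < bnorm (of_int n * c n) * s powi n)"
proof -
  have shift: "bnorm a * s powi (i - 1) < bnorm b * s powi (n - 1) \<longleftrightarrow> bnorm a * s powi i < bnorm b * s powi n"
    if "s \<in> {r, 1}" for a b :: 'k and s i
  proof -
    have s: "s > 0" using that r_pos by auto
    then have e: "s powi j = s powi (j - 1) * s" for j using power_int_add_1[of s "j - 1"] by simp
    show ?thesis
      unfolding e[of i] e[of n] mult.assoc[symmetric] using s by (simp only: mult_less_cancel_right_pos)
  qed
  have "(\<forall>i. i \<noteq> n - 1 \<longrightarrow> Q (i + 1)) \<longleftrightarrow> (\<forall>i. i \<noteq> n \<longrightarrow> Q i)" for Q :: "int \<Rightarrow> bool"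
  proof safe
    fix i assume Q: "\<forall>i. i \<noteq> n - 1 \<longrightarrow> Q (i + 1)" and "i \<noteq> n"
    then show "Q i" using spec[OF Q, of "i - 1"] by simp
  next
    fix i assume Q: "\<forall>i. i \<noteq> n \<longrightarrow> Q i" and "i \<noteq> n - 1"
    then show "Q (i + 1)" using spec[OF Q, of "i + 1"] by simp
  qed
  from this[of "\<lambda>i. \<forall>s. s \<in> {r, 1} \<longrightarrow> bnorm (of_int i * c i) * s powi (i - 1) < bnorm (of_int n * c n) * s powi (n - 1)"]
  show ?thesis unfolding dominant_index_iff lderiv_def by (simp add: shift)
qed

lemma dominant_tame_term_ofI:
  assumes prime: "prime p" and res: "bnorm (of_nat p :: 'k) < 1" and lead: "c (int p) = 1"
    and domp: "\<And>i s. i \<noteq> int p \<Longrightarrow> s \<in> {r, 1} \<Longrightarrow> bnorm (c i) * s powi i < s ^ p"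
    and nz: "of_int n * c n \<noteq> 0"
    and domn: "\<And>i s. i \<noteq> n \<Longrightarrow> s \<in> {r, 1} \<Longrightarrow>
      bnorm (of_int i * c i) * s powi i < bnorm (of_int n * c n) * s powi n"
  shows "dominant_tame_term_of \<iota> r p y c (if n = int p then (\<lambda>_. 0) else lmonom (c n) n)"
proof -
  have idx: "dominant_index \<iota> y (lderiv c) (n - 1)"
    unfolding dominant_index_lderiv_iff using nz domn by blast
  show ?thesis
  proof (cases "n = int p")
    case True
    then have "of_nat p \<noteq> (0::'k)" using nz by auto
    then have "CHAR('k) = 0" by (rule char_0_if_residual[OF prime res])
    then show ?thesis unfolding dominant_tame_term_of_def using True idx by auto
  next
    case False
    have p_less: "bnorm (of_nat p :: 'k) * s ^ p < bnorm (of_int n * c n) * s powi n" if "s \<in> {r, 1}" for s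
      using domn[of "int p" s] False that by (simp add: lead)
    have cn: "bnorm (c n) * s powi n < s ^ p" if "s \<in> {r, 1}" for s using domp[OF False that] .
    have "\<not> int p dvd n"
    proof
      assume "int p dvd n"
      then have "bnorm (of_int n * c n) \<le> bnorm (of_nat p :: 'k) * 1"
        unfolding bnorm_mult using bnorm_of_int_dvd[of p n] cn[of 1] by (intro mult_mono bn.nonneg) auto
      then show False using p_less[of 1] by simp
    qed
    then have cop: "coprime n (int p)" and n1: "bnorm (of_int n :: 'k) = 1"
      using prime bnorm_of_int_coprime[OF prime res] prime_imp_coprime[of "int p" n]
      by (auto simp: coprime_commute)
    have shift: "bnorm a * r powi n < bnorm b * r ^ p \<longleftrightarrow> bnorm a * r powi (n - int p) < bnorm b"
      "bnorm b * r ^ p < bnorm a * r powi n \<longleftrightarrow> bnorm b * r powi (int p - n) < bnorm a" for a b :: 'k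
    proof -
      have e: "r powi n = r powi (n - int p) * r ^ p" "r ^ p = r powi (int p - n) * r powi n"
        and pos: "0 < r ^ p" "0 < r powi n"
        using r_pos by (simp_all flip: power_int_add power_int_of_nat)
      show "bnorm a * r powi n < bnorm b * r ^ p \<longleftrightarrow> bnorm a * r powi (n - int p) < bnorm b"
        unfolding e(1) mult.assoc[symmetric] using pos(1) by (simp only: mult_less_cancel_right_pos)
      show "bnorm b * r ^ p < bnorm a * r powi n \<longleftrightarrow> bnorm b * r powi (int p - n) < bnorm a"
        unfolding e(2) mult.assoc[symmetric] using pos(2) by (simp only: mult_less_cancel_right_pos)
    qed
    have up: "bnorm (c n) * max 1 (r powi (n - int p)) < 1"
      using cn[of 1] cn[of r] shift(1)[of "c n" 1] by (simp add: max_def bnorm_one)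
    have lo: "bnorm (of_nat p :: 'k) * max 1 (r powi (int p - n)) < bnorm (c n)"
      using p_less[of 1] p_less[of r] shift(2)[of "of_nat p" "c n"] by (simp add: max_def bnorm_mult n1)
    have "q (\<iota> (c n) * unit_powi y (n - int p)) < 1 \<and>
        bnorm (of_nat p :: 'k) < q (\<iota> (c n) * unit_powi y (n - int p))" if q: "q \<in> skeleton \<iota> r y" for q
    proof -
      obtain s where s: "s \<in> {r..1}" "q = G s" using q unfolding skeleton_def by blast
      have eq: "q (\<iota> (c n) * unit_powi y (n - int p)) = bnorm (c n) * s powi (n - int p)"
        using G_ymon[OF s(1), of "c n" "n - int p"] by (simp add: s(2) ymon_def)
      have "bnorm (c n) * s powi (n - int p) \<le> bnorm (c n) * max 1 (r powi (n - int p))"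
        using s r_pos by (intro mult_left_mono powi_le_max bn.nonneg) auto
      moreover have "bnorm (of_nat p :: 'k) * s powi (int p - n) \<le> bnorm (of_nat p :: 'k) * max 1 (r powi (int p - n))"
        using s r_pos by (intro mult_left_mono powi_le_max bn.nonneg) auto
      then have "bnorm (of_nat p :: 'k) * s powi (int p - n) * s powi (n - int p) < bnorm (c n) * s powi (n - int p)"
        using lo powi_pos[OF s(1), of "n - int p"] by (intro mult_strict_right_mono) auto
      moreover have "s powi (int p - n) * s powi (n - int p) = 1" using s_pos[OF s(1)] by (simp flip: power_int_add)
      ultimately show ?thesis using up by (simp add: eq mult.assoc)
    qed
    then show ?thesis unfolding dominant_tame_term_of_def using False idx cop by auto
  qed
qed

end


section \<open>Presentations of etale annular covers\<close>

lemma closed_annulus_imp_annulus: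
  "closed_annulus \<iota> r \<Longrightarrow> monic_coordinate \<iota> r y \<Longrightarrow> annulus \<iota> r y"
  by (auto simp: closed_annulus_def annulus_def)

lemma annular_cover_imp_annulus_map:
  assumes "annular_cover \<iota>X rX \<iota>Y rY f p" "monic_coordinate \<iota>X rX x" "monic_coordinate \<iota>Y rY y"
  shows "annulus_map \<iota>X rX x \<iota>Y rY y f"
  using assms closed_annulus_imp_annulus[of \<iota>X rX x] closed_annulus_imp_annulus[of \<iota>Y rY y]
  by (auto simp: annular_cover_def annulus_map_def annulus_map_axioms_def)

lemma has_degree_inj:
  assumes hom: "ring_hom_type f" and deg: "has_degree f d" and "d > 0" and b: "f b = 0"
  shows "b = 0"
proof (rule ccontr)
  assume "b \<noteq> 0"
  interpret module "module_scale f" using hom by (rule module_scale_module)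
  obtain S where S: "finite S" "card S = d" "\<not> dependent S" using deg by (auto simp: has_degree_def)
  then obtain v where "v \<in> S" using \<open>d > 0\<close> by fastforce
  then have "\<exists>t u. finite t \<and> t \<subseteq> S \<and> (\<Sum>v\<in>t. module_scale f (u v) v) = 0 \<and> (\<exists>v\<in>t. u v \<noteq> 0)"
    using b \<open>b \<noteq> 0\<close> by (intro exI[of _ "{v}"] exI[of _ "\<lambda>_. b"]) (simp add: module_scale_def)
  with S(3) show False unfolding dependent_explicit by blast
qed

lemma dominant_index_monicD:
  assumes "annulus \<iota> r y" "dominant_index \<iota> y c (int p)" "c (int p) = 1" "i \<noteq> int p" "s \<in> {r, 1}"
  shows "bnorm (c i) * s powi i < s ^ p"
proof -
  interpret annulus \<iota> r y by fact
  show ?thesis using assms(2-5) unfolding dominant_index_iff by (auto simp: bnorm_one)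
qed

lemma dominant_tame_term_exists:
  fixes \<iota>X :: "'k::alg_closed_valued_field \<Rightarrow> 'b::nonarch_banach_ring"
    and \<iota>Y :: "'k \<Rightarrow> 'a::nonarch_banach_ring"
  assumes cover: "annular_cover \<iota>X rX \<iota>Y rY f p" and p: "residual_char TYPE('k) p"
    and pres: "monic_presentation \<iota>X rX \<iota>Y rY f p u v x y \<phi>"
    and n: "dominant_index \<iota>Y y (lderiv \<phi>) (n - 1)"
  shows "dominant_tame_term \<iota>X rX \<iota>Y rY f p u v (if n = int p then (\<lambda>_. 0) else lmonom (\<phi> n) n)"
proof -
  have "monic_coordinate \<iota>Y rY y" using pres by (simp add: monic_presentation_def presentation_def oriented_coordinate_def)
  then have Y: "annulus \<iota>Y rY y" using cover closed_annulus_imp_annulus by (auto simp: annular_cover_def)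
  interpret Y: annulus \<iota>Y rY y by (rule Y)
  have lead: "\<phi> (int p) = 1" and dom: "dominant_index \<iota>Y y \<phi> (int p)"
    using pres by (auto simp: monic_presentation_def)
  have "dominant_tame_term_of \<iota>Y rY p y \<phi> (if n = int p then (\<lambda>_. 0) else lmonom (\<phi> n) n)"
  proof (rule Y.dominant_tame_term_ofI)
    show "prime p" "bnorm (of_nat p :: 'k) < 1" using p by (auto simp: residual_char_def)
    show "of_int n * \<phi> n \<noteq> 0" using n unfolding Y.dominant_index_lderiv_iff by blast
    show "bnorm (of_int i * \<phi> i) * s powi i < bnorm (of_int n * \<phi> n) * s powi n"
      if "i \<noteq> n" "s \<in> {rY, 1}" for i s
      using n that unfolding Y.dominant_index_lderiv_iff by blast
    show "bnorm (\<phi> i) * s powi i < s ^ p" if "i \<noteq> int p" "s \<in> {rY, 1}" for i s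
      by (rule dominant_index_monicD[OF Y dom lead that])
  qed (rule lead)
  then show ?thesis
    unfolding dominant_tame_term_def using pres bnorm_one[where 'a = 'k]
    by (intro exI[of _ x] exI[of _ y] exI[of _ \<phi>]
        exI[of _ "if n = int p then (\<lambda>_. 0) else lmonom (\<phi> n) n"] exI[of _ 1]) auto
qed

lemma presentation_exists:
  fixes \<iota>X :: "'k::alg_closed_valued_field \<Rightarrow> 'b::nonarch_banach_ring"
    and \<iota>Y :: "'k \<Rightarrow> 'a::nonarch_banach_ring"
  assumes p: "residual_char TYPE('k) p" and cover: "annular_cover \<iota>X rX \<iota>Y rY f p"
    and etale: "finite_etale f" and y: "oriented_coordinate \<iota>Y rY u v y"
  shows "\<exists>x y t. dominant_tame_term \<iota>X rX \<iota>Y rY f p u v t \<and>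
    presentation \<iota>X rX \<iota>Y rY f u v x y (\<lambda>i. lmonom 1 (int p) i + t i)"
proof -
  have prime: "prime p" and res: "bnorm (of_nat p :: 'k) < 1" using p by (auto simp: residual_char_def)
  obtain x0 where x0: "monic_coordinate \<iota>X rX x0" using cover by (auto simp: annular_cover_def closed_annulus_def)
  have my: "monic_coordinate \<iota>Y rY y" and uv: "gauss_point \<iota>Y rY y rY = u" "gauss_point \<iota>Y rY y 1 = v"
    using y by (auto simp: oriented_coordinate_def)
  interpret m0: annulus_map \<iota>X rX x0 \<iota>Y rY y f
    by (rule annular_cover_imp_annulus_map[OF cover x0 my])
  obtain \<gamma> :: 'k where \<gamma>: "bnorm \<gamma> = rX" using cover by (auto simp: annular_cover_def closed_annulus_def)
  have deg: "has_degree f p" and fin: "finite_hom f" using cover by (auto simp: annular_cover_def)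
  have inj: "b = 0" if "f b = 0" for b
    using has_degree_inj[OF m0.f_hom deg prime_gt_0_nat[OF prime] that] .
  have refl: "b dvd 1" if "f b dvd 1" for b
    by (rule finite_hom_reflects_units[OF m0.f_hom fin inj that])
  obtain x1 M t1 \<kappa> where x1: "monic_map \<iota>X rX x1 \<iota>Y rY y f M t1 \<kappa>"
    using m0.monic_map_exists[OF refl \<gamma>] by blast
  obtain x t where x: "monic_map \<iota>X rX x \<iota>Y rY y f M t \<kappa>"
    and lead: "laurent_coeffs \<iota>Y rY y (f x) (int M) = 1"
    using monic_map.normalize[OF x1] by blast
  interpret m: monic_map \<iota>X rX x \<iota>Y rY y f M t \<kappa> by (rule x)
  have Mp: "M = p" using m.degree_eq[OF deg] by simp
  have "unramified_hom f" using etale by (simp add: finite_etale_def)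
  then obtain a where "m0.Y.theta (f x) * a = 1" using m.unramified_imp_theta_unit by (metis dvdE)
  then obtain n where n: "\<And>s i. s \<in> {rY..1} \<Longrightarrow> i \<noteq> n \<Longrightarrow>
      bnorm (m0.Y.lcoeff (m0.Y.theta (f x)) i) * s powi i < bnorm (m0.Y.lcoeff (m0.Y.theta (f x)) n) * s powi n"
    by (rule m0.Y.unit_dominant) (rule that)
  interpret tm: tame_map \<iota>X rX x \<iota>Y rY y f M t \<kappa> n
  proof
    show "prime M" "bnorm (of_nat M :: 'k) < 1" using prime res by (simp_all add: Mp)
    show "m0.Y.lcoeff (f x) (int M) = 1" by (rule lead)
    show "bnorm (of_int i * m0.Y.lcoeff (f x) i) * s powi i < bnorm (of_int n * m0.Y.lcoeff (f x) n) * s powi n"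
      if "s \<in> {rY, 1}" "i \<noteq> n" for s i
      using n[OF m0.Y.in_end_points[OF that(1)] that(2)] by (simp add: m0.Y.lcoeff_theta)
  qed
  define \<phi> where "\<phi> = m0.Y.lcoeff (f x)"
  define t' where "t' = (if n = int p then (\<lambda>_. 0) else lmonom (\<phi> n) n)"
  have points: "m.X.G rX = u \<circ> f" "m.X.G 1 = v \<circ> f" using m.gauss_points uv by simp_all
  have "monic_presentation \<iota>X rX \<iota>Y rY f p u v x y \<phi>"
    unfolding monic_presentation_def presentation_def oriented_coordinate_def
  proof (intro conjI)
    show "dominant_index \<iota>Y y \<phi> (int p)"
      unfolding m0.Y.dominant_index_iff
    proof (intro conjI allI impI)
      show "\<phi> (int p) \<noteq> 0" using lead by (simp add: \<phi>_def Mp)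
      fix i s assume i: "i \<noteq> int p" and s: "s \<in> {rY, 1}"
      have "bnorm (\<phi> i) * s powi i \<le> \<kappa> * s ^ M" using tm.phi_le[OF s] i by (simp add: \<phi>_def Mp)
      also have "\<dots> < 1 * s ^ M" using m.\<kappa> tm.sM(1)[OF s] by (intro mult_strict_right_mono)
      finally show "bnorm (\<phi> i) * s powi i < bnorm (\<phi> (int p)) * s powi int p"
        using lead by (simp add: \<phi>_def Mp bnorm_one)
    qed
    show "monic_coordinate \<iota>X rX x" by (rule m.X.coordinate)
    show "f x = laurent_eval \<iota>Y y \<phi>" by (simp add: \<phi>_def m0.Y.ev_coeff)
    show "\<phi> \<in> laurent_algebra rY" unfolding \<phi>_def by (rule m0.Y.lcoeff_in)
    show "\<phi> (int p) = 1" using lead by (simp add: \<phi>_def Mp)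
  qed (fact points my uv)+
  moreover have "dominant_index \<iota>Y y (lderiv \<phi>) (n - 1)"
    unfolding m0.Y.dominant_index_lderiv_iff using tm.n_phi_nz tm.dom by (auto simp: \<phi>_def)
  ultimately have tame: "dominant_tame_term \<iota>X rX \<iota>Y rY f p u v t'"
    unfolding t'_def by (rule dominant_tame_term_exists[OF cover p])
  obtain x' y' where x': "annulus \<iota>X rX x'" and y': "annulus \<iota>Y rY y'"
    and gx: "\<And>s. s \<in> {rX, 1} \<Longrightarrow> gauss_point \<iota>X rX x' s = m.X.G s"
    and gy: "\<And>s. s \<in> {rY, 1} \<Longrightarrow> gauss_point \<iota>Y rY y' s = m0.Y.G s"
    and fx': "f x' = laurent_eval \<iota>Y y' (\<lambda>i. lmonom 1 (int M) i + (if n = int M then 0 else lmonom (\<phi> n) n i))"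
    using tm.normal_form unfolding \<phi>_def by blast
  have eq: "(\<lambda>i. lmonom 1 (int M) i + (if n = int M then 0 else lmonom (\<phi> n) n i))
      = (\<lambda>i. lmonom 1 (int p) i + t' i)"
    by (simp add: t'_def Mp fun_eq_iff)
  have "presentation \<iota>X rX \<iota>Y rY f u v x' y' (\<lambda>i. lmonom 1 (int p) i + t' i)"
    unfolding presentation_def oriented_coordinate_def
  proof (intro conjI)
    show "monic_coordinate \<iota>X rX x'" by (rule annulus.coordinate[OF x'])
    show "monic_coordinate \<iota>Y rY y'" by (rule annulus.coordinate[OF y'])
    show "gauss_point \<iota>X rX x' rX = u \<circ> f" "gauss_point \<iota>X rX x' 1 = v \<circ> f"
      using gx points by simp_all
    show "gauss_point \<iota>Y rY y' rY = u" "gauss_point \<iota>Y rY y' 1 = v" using gy uv by simp_all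
    show "f x' = laurent_eval \<iota>Y y' (\<lambda>i. lmonom 1 (int p) i + t' i)" using fx' unfolding eq .
    show "(\<lambda>i. lmonom 1 (int p) i + t' i) \<in> laurent_algebra rY"
      by (rule laurent_algebra_finite_support[OF m0.Y.r_pos, of "{int p, n}"]) (auto simp: lmonom_def t'_def)
  qed
  with tame show ?thesis by blast
qed

lemma kummer_or_binomial:
  fixes \<iota>X :: "'k::alg_closed_valued_field \<Rightarrow> 'b::nonarch_banach_ring"
    and \<iota>Y :: "'k \<Rightarrow> 'a::nonarch_banach_ring"
  assumes p: "residual_char TYPE('k) p" and cover: "annular_cover \<iota>X rX \<iota>Y rY f p"
    and etale: "finite_etale f"
    and pres: "kummer_presentation \<iota>X rX \<iota>Y rY f p u v x y \<phi> \<or> binomial_presentation \<iota>X rX \<iota>Y rY f p u v x y \<phi>"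
  shows "\<exists>t. dominant_tame_term \<iota>X rX \<iota>Y rY f p u v t \<and> \<phi> = (\<lambda>i. lmonom 1 (int p) i + t i)"
  using pres
proof
  assume "kummer_presentation \<iota>X rX \<iota>Y rY f p u v x y \<phi>"
  then have monic: "monic_presentation \<iota>X rX \<iota>Y rY f p u v x y \<phi>" and \<phi>: "\<phi> = lmonom 1 (int p)"
    by (auto simp: kummer_presentation_def)
  then have x: "monic_coordinate \<iota>X rX x" and y: "monic_coordinate \<iota>Y rY y" and fx: "f x = laurent_eval \<iota>Y y \<phi>"
    by (auto simp: monic_presentation_def presentation_def oriented_coordinate_def)
  interpret m: annulus_map \<iota>X rX x \<iota>Y rY y f
    by (rule annular_cover_imp_annulus_map[OF cover x y])
  have "m.Y.theta (f x) dvd 1"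
    using m.unramified_imp_theta_unit etale by (simp add: finite_etale_def)
  moreover have "m.Y.theta (f x) = \<iota>Y (of_nat p) * m.Y.ymon 1 (int p)"
    unfolding fx \<phi> m.Y.ev_lmonom m.Y.theta_ymon by (simp add: ring_hom_type_of_nat[OF m.Y.hom])
  ultimately have "of_nat p \<noteq> (0::'k)" by auto
  then have pos: "0 < bnorm (of_nat p :: 'k)" by (simp add: bnorm_pos_iff)
  have "dominant_index \<iota>Y y (lderiv \<phi>) (int p - 1)"
    unfolding m.Y.dominant_index_lderiv_iff \<phi>
    using \<open>of_nat p \<noteq> (0::'k)\<close> pos m.Y.r_pos by (auto simp: lmonom_def)
  from dominant_tame_term_exists[OF cover p monic this]
  have "dominant_tame_term \<iota>X rX \<iota>Y rY f p u v (\<lambda>_. 0)" by simp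
  then show ?thesis using \<phi> by (intro exI[of _ "\<lambda>_. 0"]) auto
next
  assume "binomial_presentation \<iota>X rX \<iota>Y rY f p u v x y \<phi>"
  then obtain n where monic: "monic_presentation \<iota>X rX \<iota>Y rY f p u v x y \<phi>" and n: "n \<noteq> int p"
    and \<phi>: "\<phi> = (\<lambda>i. lmonom 1 (int p) i + lmonom (\<phi> n) n i)"
    and dom: "dominant_index \<iota>Y y (lderiv \<phi>) (n - 1)"
    unfolding binomial_presentation_def by blast
  have "dominant_tame_term \<iota>X rX \<iota>Y rY f p u v (lmonom (\<phi> n) n)"
    using dominant_tame_term_exists[OF cover p monic dom] n by simp
  with \<phi> show ?thesis by blast
qed

theorem theorem4p3p8:
  fixes \<iota>X :: "'k::alg_closed_valued_field \<Rightarrow> 'b::nonarch_banach_ring"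
    and \<iota>Y :: "'k \<Rightarrow> 'a::nonarch_banach_ring"
    and f :: "'b \<Rightarrow> 'a" and p :: nat and rX rY :: real and u v :: "'a \<Rightarrow> real"
  assumes "residual_char TYPE('k) p"
    and "annular_cover \<iota>X rX \<iota>Y rY f p"
    and "finite_etale f"
    and "different_orientation \<iota>Y rY f u v"
  shows "(\<exists>x y t. dominant_tame_term \<iota>X rX \<iota>Y rY f p u v t \<and>
            presentation \<iota>X rX \<iota>Y rY f u v x y (\<lambda>i. lmonom 1 (int p) i + t i)) \<and>
         (\<forall>x y \<phi>. kummer_presentation \<iota>X rX \<iota>Y rY f p u v x y \<phi> \<or>
            binomial_presentation \<iota>X rX \<iota>Y rY f p u v x y \<phi> \<longrightarrow>
            (\<exists>t. dominant_tame_term \<iota>X rX \<iota>Y rY f p u v t \<and>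
               \<phi> = (\<lambda>i. lmonom 1 (int p) i + t i)))"
proof -
  obtain y where "oriented_coordinate \<iota>Y rY u v y" using assms(4) by (auto simp: different_orientation_def)
  from presentation_exists[OF assms(1-3) this] kummer_or_binomial[OF assms(1-3)] show ?thesis by blast
qed

end
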